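(* Let $X$ be a continuous vector field on $\mathbb{S}^1$ and let $\phi_X:\mathbb{S}^1\to\mathbb{R}$ be its support function. Let $u_X:\mathbb{H}^2\to\mathbb{R}$ be the unique function such that $\Delta u_X-2u_X=0$ and $\overline{u_X}|_{\mathbb{S}^1}=\phi_X$. Then $\mathrm{HL}(X):=\mathrm{J}\,\mathrm{grad}(u_X)$ is a harmonic Lagrangian vector field which extends continuously to $X$.
   Context: Minkowski space $\mathbb{R}^{1,2}$ is $\mathbb{R}^3$ with $\langle x,y\rangle_{1,2}=-x_0y_0+x_1y_1+x_2y_2$. The hyperbolic plane is $\mathbb{H}^2=\{x\in\mathbb{R}^{1,2}: \langle x,x\rangle_{1,2}=-1,\ x_0>0\}$ with the induced Riemannian metric $g$, Levi-Civita connection $\nabla$ and complex structure $\mathrm{J}_p(v)=p\boxtimes v$, where $\langle x\boxtimes y,v\rangle_{1,2}=\det(x,y,v)$ for all $v$. $\mathrm{grad}$ and $\Delta$ are the gradient and Laplace-Beltrami operator ($\Delta=\mathrm{tr}\,\mathrm{Hess}$). $\mathbb{D}^2\subset\mathbb{R}^2\cong\mathbb{C}$ is the open unit disk (Klein model), $\mathbb{S}^1=\partial\mathbb{D}^2$, $\Pi:\mathbb{H}^2\to\mathbb{D}^2$, $\Pi(x_0,x_1,x_2)=(x_1/x_0,x_2/x_0)$; for $u:\mathbb{H}^2\to\mathbb{R}$ set $\overline{u}(\eta)=\sqrt{1-|\eta|^2}\,u(\Pi^{-1}(\eta))$; the condition $\overline{u}|_{\mathbb{S}^1}=\phi$ means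 that $\overline{u}$ extends continuously to $\overline{\mathbb{D}^2}$ with boundary values $\phi$. The support function of $X$ is defined by $X(z)=iz\,\phi_X(z)$. Existence and uniqueness of the smooth function $u_X$ are known. For $(x,v)\in \mathrm{T}\mathbb{H}^2$, identify $\mathrm{T}_x\mathbb{H}^2\times \mathrm{T}_x\mathbb{H}^2\cong \mathrm{T}_{(x,v)}\mathrm{T}\mathbb{H}^2$ by $(w_1,w_2)\mapsto w_1^{\mathcal{H}}+w_2^{\mathcal{V}}$ (horizontal lift of $w_1$ with respect to $\nabla$ plus vertical lift of $w_2$). Put $\mathbb{G}((X_1,X_2),(Y_1,Y_2))=g(X_1,Y_2)+g(X_2,Y_1)$ and $\Omega((X_1,X_2),(Y_1,Y_2))=g(\mathrm{J}X_1,Y_2)-g(X_2,\mathrm{J}Y_1)$. A smooth vector field $V$ is harmonic Lagrangian if $V:(\mathbb{H}^2,g)\to(\mathrm{T}\mathbb{H}^2,\mathbb{G})$ is a harmonic map (vanishing tension field $\mathrm{tr}_g\nabla^2V$, with $\nabla^2V(X,Y)=\nabla^{\mathbb{G}}_{\mathrm{d}V(X)}\mathrm{d}V(Y)-\mathrm{d}V(\nabla_XY)$) and $V^*\Omega=0$. A vector field $V$ on $\mathbb{H}^2$ extends continuously to $X$ if $\Pi_*V(\eta)=\mathrm{d}_{\Pi^{-1}(\eta)}\Pi(V(\Pi^{-1}(\eta)))\in\mathbb{R}^2$ satisfies $\Pi_*V(\eta_n)\to X(\eta_\infty)$ whenever $\eta_n\in\mathbb{D}^2$ converges to $\eta_\infty\in\mathbb{S}^1$.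 *)

theory Defs
  imports "HOL-Analysis.Analysis"
begin

section \<open>Pseudo-Riemannian metrics on open subsets of a Euclidean space\<close>

text \<open>
  All manifolds below are covered by one global chart. A metric is therefore given by its
  coordinate expression: \<open>h p\<close> is the bilinear form on the tangent space at \<open>p\<close>, for \<open>p\<close> in an
  open subset of a Euclidean space \<open>'a\<close> (values of \<open>h\<close> outside that subset are irrelevant).
\<close>

type_synonym 'a metric = "'a \<Rightarrow> 'a \<Rightarrow> 'a \<Rightarrow> real"

text \<open>\<open>C\<^sup>k\<close> and \<open>C\<^sup>\<infinity>\<close> on an open set \<open>S\<close>.\<close>

primrec Ck_on :: "nat \<Rightarrow> 'a::real_normed_vector set \<Rightarrow> ('a \<Rightarrow> 'b::real_normed_vector) \<Rightarrow> bool" where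
  "Ck_on 0 S f \<longleftrightarrow> continuous_on S f"
| "Ck_on (Suc k) S f \<longleftrightarrow>
     (\<forall>x\<in>S. f differentiable (at x)) \<and> (\<forall>v. Ck_on k S (\<lambda>x. frechet_derivative f (at x) v))"

definition smooth_on :: "'a::real_normed_vector set \<Rightarrow> ('a \<Rightarrow> 'b::real_normed_vector) \<Rightarrow> bool" where
  "smooth_on S f \<longleftrightarrow> (\<forall>k. Ck_on k S f)"

text \<open>
  The Levi-Civita connection is \<open>\<nabla>\<^sub>X Y (p) = dY\<^sub>p(X p) + \<Gamma>\<^sub>p(X p, Y p)\<close>, where the bilinear map \<open>\<Gamma>\<^sub>p\<close>
  (the Christoffel symbols) is determined by \<open>\<nabla>\<close> being torsion-free and metric:
\<close>

definition is_levi_civita_at :: "'a::euclidean_space metric \<Rightarrow> 'a \<Rightarrow> ('a \<Rightarrow> 'a \<Rightarrow> 'a) \<Rightarrow> bool" where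
  "is_levi_civita_at h p \<Gamma> \<longleftrightarrow>
     bilinear \<Gamma> \<and>
     (\<forall>u v. \<Gamma> u v = \<Gamma> v u) \<and>
     (\<forall>w u v. frechet_derivative (\<lambda>q. h q u v) (at p) w = h p (\<Gamma> w u) v + h p u (\<Gamma> w v))"

definition christoffel :: "'a::euclidean_space metric \<Rightarrow> 'a \<Rightarrow> 'a \<Rightarrow> 'a \<Rightarrow> 'a" where
  "christoffel h p = (THE \<Gamma>. is_levi_civita_at h p \<Gamma>)"

text \<open>The vector representing the linear form \<open>\<alpha>\<close> with respect to \<open>h p\<close>.\<close>

definition sharp :: "'a::euclidean_space metric \<Rightarrow> 'a \<Rightarrow> ('a \<Rightarrow> real) \<Rightarrow> 'a" where
  "sharp h p \<alpha> = (THE w. \<forall>v. h p w v = \<alpha> v)"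

text \<open>The trace \<open>h\<^sup>i\<^sup>j B\<^sub>i\<^sub>j\<close> of a bilinear map \<open>B\<close> with respect to \<open>h p\<close>.\<close>

definition metric_trace ::
  "'a::euclidean_space metric \<Rightarrow> 'a \<Rightarrow> ('a \<Rightarrow> 'a \<Rightarrow> 'b::real_vector) \<Rightarrow> 'b" where
  "metric_trace h p B = (\<Sum>b\<in>Basis. B (sharp h p (\<lambda>v. v \<bullet> b)) b)"

definition hessian ::
  "'a::euclidean_space metric \<Rightarrow> ('a \<Rightarrow> real) \<Rightarrow> 'a \<Rightarrow> 'a \<Rightarrow> 'a \<Rightarrow> real" where
  "hessian h f p a b =
     frechet_derivative (\<lambda>q. frechet_derivative f (at q) b) (at p) a
     - frechet_derivative f (at p) (christoffel h p a b)"

definition laplacian :: "'a::euclidean_space metric \<Rightarrow> ('a \<Rightarrow> real) \<Rightarrow> 'a \<Rightarrow> real" where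
  "laplacian h f p = metric_trace h p (hessian h f p)"

text \<open>
  For a map \<open>f : (M,g) \<rightarrow> (N,h)\<close>, the value at \<open>p\<close> of
  \<open>\<nabla>\<^sup>2f(X,Y) = \<nabla>\<^sup>h\<^bsub>df(X)\<^esub> df(Y) - df(\<nabla>\<^sub>X Y)\<close>, which is tensorial in \<open>X\<close> and \<open>Y\<close>, for the constant
  coordinate fields \<open>X = a\<close>, \<open>Y = b\<close>.
\<close>

definition second_derivative ::
  "'a::euclidean_space metric \<Rightarrow> 'b::euclidean_space metric \<Rightarrow> ('a \<Rightarrow> 'b) \<Rightarrow> 'a \<Rightarrow> 'a \<Rightarrow> 'a \<Rightarrow> 'b" where
  "second_derivative g h f p a b =
     frechet_derivative (\<lambda>q. frechet_derivative f (at q) b) (at p) a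
     + christoffel h (f p) (frechet_derivative f (at p) a) (frechet_derivative f (at p) b)
     - frechet_derivative f (at p) (christoffel g p a b)"

definition tension_field ::
  "'a::euclidean_space metric \<Rightarrow> 'b::euclidean_space metric \<Rightarrow> ('a \<Rightarrow> 'b) \<Rightarrow> 'a \<Rightarrow> 'b" where
  "tension_field g h f p = metric_trace g p (second_derivative g h f p)"

definition harmonic_map_on ::
  "'a::euclidean_space set \<Rightarrow> 'a metric \<Rightarrow> 'b::euclidean_space metric \<Rightarrow> ('a \<Rightarrow> 'b) \<Rightarrow> bool" where
  "harmonic_map_on S g h f \<longleftrightarrow> smooth_on S f \<and> (\<forall>p\<in>S. tension_field g h f p = 0)"

text \<open>The descriptions by \<open>THE\<close> are justified for nondegenerate metrics.\<close>

lemma sharp_ex1: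
  fixes h :: "'a::euclidean_space metric"
  assumes bil: "bilinear (h p)" and nondeg: "\<And>w. (\<And>v. h p w v = 0) \<Longrightarrow> w = 0"
    and lin: "linear \<alpha>"
  shows "\<exists>!w. \<forall>v. h p w v = \<alpha> v"
proof -
  define T where "T w = (\<Sum>b\<in>Basis. h p w b *\<^sub>R b)" for w
  have l1: "linear (\<lambda>w. h p w v)" and l2: "linear (\<lambda>v. h p w v)" for v w
    using bil by (auto simp: bilinear_def)
  have TB: "T w \<bullet> v = h p w v" for w v
  proof -
    have "h p w v = h p w (\<Sum>b\<in>Basis. (v \<bullet> b) *\<^sub>R b)" by (simp add: euclidean_representation)
    also have "\<dots> = (\<Sum>b\<in>Basis. (v \<bullet> b) * h p w b)"
      by (simp add: linear_sum[OF l2] linear_cmul[OF l2])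
    finally show ?thesis by (simp add: T_def inner_sum_left mult.commute inner_commute[of v])
  qed
  have "linear T"
    by (rule linearI; rule vector_eq_rdot[THEN iffD1, OF allI])
       (simp_all add: TB inner_add_left linear_add[OF l1] linear_cmul[OF l1])
  moreover have "inj T"
    unfolding linear_injective_0[OF \<open>linear T\<close>]
    by (metis TB inner_zero_left nondeg)
  ultimately have "surj T" by (simp add: linear_injective_imp_surjective)
  define a where "a = (\<Sum>b\<in>Basis. \<alpha> b *\<^sub>R b)"
  have a: "a \<bullet> v = \<alpha> v" for v
  proof -
    have "\<alpha> v = \<alpha> (\<Sum>b\<in>Basis. (v \<bullet> b) *\<^sub>R b)" by (simp add: euclidean_representation)
    also have "\<dots> = (\<Sum>b\<in>Basis. (v \<bullet> b) * \<alpha> b)"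
      by (simp add: linear_sum[OF lin] linear_cmul[OF lin])
    finally show ?thesis by (simp add: a_def inner_sum_left mult.commute inner_commute[of v])
  qed
  obtain w where "T w = a" using \<open>surj T\<close> by (metis surjD)
  show ?thesis
  proof (rule ex1I[of _ w])
    show "\<forall>v. h p w v = \<alpha> v" using TB a \<open>T w = a\<close> by metis
    fix w' assume "\<forall>v. h p w' v = \<alpha> v"
    then have "T w' = T w" using \<open>T w = a\<close> TB a by (metis vector_eq_rdot)
    then show "w' = w" using \<open>inj T\<close> by (simp add: inj_eq)
  qed
qed

lemma levi_civita_ex1:
  fixes h :: "'a::euclidean_space metric"
  assumes S: "open S" "p \<in> S"
    and bil: "\<And>q. q \<in> S \<Longrightarrow> bilinear (h q)"
    and sym: "\<And>q u v. q \<in> S \<Longrightarrow> h q u v = h q v u"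
    and nondeg: "\<And>w. (\<And>v. h p w v = 0) \<Longrightarrow> w = 0"
    and diff: "\<And>u v. (\<lambda>q. h q u v) differentiable (at p)"
  shows "\<exists>!\<Gamma>. is_levi_civita_at h p \<Gamma>"
proof -
  define D where "D w u v = frechet_derivative (\<lambda>q. h q u v) (at p) w" for w u v
  have der: "((\<lambda>q. h q u v) has_derivative (\<lambda>w. D w u v)) (at p)" for u v
    using diff by (simp add: D_def frechet_derivative_works[symmetric])
  have DI: "D w u v = f' w"
    if "(f has_derivative f') (at p)" "\<And>q. q \<in> S \<Longrightarrow> f q = h q u v" for f f' u v w
    using has_derivative_unique[OF der[of u v] has_derivative_transform_within_open[OF that(1) S that(2)]]
    by (simp add: fun_eq_iff)
  have l1: "linear (\<lambda>w. h q w v)" and l2: "linear (\<lambda>v. h q w v)" if "q \<in> S" for q v w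
    using bil[OF that] by (auto simp: bilinear_def)
  note hl = linear_add[OF l1] linear_cmul[OF l1] linear_add[OF l2] linear_cmul[OF l2]
  have Ds: "D w u v = D w v u" for w u v
    by (rule DI[OF der]) (simp add: sym)
  have Da: "D w (u + u') v = D w u v + D w u' v" for w u u' v
    by (rule DI[OF has_derivative_add[OF der der]]) (simp add: hl)
  have Dc: "D w (c *\<^sub>R u) v = c * D w u v" for w u c v
    by (rule DI[OF has_derivative_mult_right[OF der]]) (simp add: hl)
  have D1: "linear (\<lambda>w. D w u v)" for u v using der has_derivative_linear by blast
  note Dl = Da Dc linear_add[OF D1] linear_cmul[OF D1]
  have Da': "D w u (v + v') = D w u v + D w u v'" and Dc': "D w u (c *\<^sub>R v) = c * D w u v" for w u v v' c
    by (metis Ds Da) (metis Ds Dc)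
  define K where "K w u v = (D w u v + D u w v - D v w u) / 2" for w u v
  have Kl: "linear (K w u)" for w u
    by (rule linearI) (simp_all add: K_def Dl Da' Dc' field_simps)
  define \<Gamma> where "\<Gamma> w u = sharp h p (K w u)" for w u
  have hp: "bilinear (h p)" using bil S by blast
  have \<Gamma>: "h p (\<Gamma> w u) v = K w u v" for w u v
    using theI'[OF sharp_ex1[where h = h and p = p, OF hp nondeg Kl[of w u]]] unfolding \<Gamma>_def sharp_def by blast
  have eqI: "x = y" if "\<And>v. h p x v = h p y v" for x y
  proof -
    have "h p (x - y) v = 0" for v using that linear_diff[OF l1[OF S(2)]] by simp
    then show ?thesis using nondeg[of "x - y"] by simp
  qed
  show ?thesis
  proof (rule ex1I[of _ \<Gamma>])
    have "bilinear \<Gamma>" unfolding bilinear_def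
      by (intro conjI allI linearI; rule eqI)
         (simp_all add: \<Gamma> hl[OF S(2)] K_def Dl Da' Dc' field_simps)
    moreover have "\<Gamma> u v = \<Gamma> v u" for u v
      by (rule eqI) (simp add: \<Gamma> K_def Ds[of _ u v])
    moreover have "D w u v = h p (\<Gamma> w u) v + h p u (\<Gamma> w v)" for w u v
      by (simp add: \<Gamma> sym[OF S(2), of u] K_def Ds[of _ v u] Ds[of _ v w] Ds[of _ u w] field_simps)
    ultimately show "is_levi_civita_at h p \<Gamma>"
      unfolding is_levi_civita_at_def D_def by blast
  next
    fix \<Gamma>' assume "is_levi_civita_at h p \<Gamma>'"
    then have s: "\<And>u v. \<Gamma>' u v = \<Gamma>' v u"
      and m: "\<And>w u v. D w u v = h p (\<Gamma>' w u) v + h p u (\<Gamma>' w v)"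
      unfolding is_levi_civita_at_def D_def by blast+
    have "h p (\<Gamma>' w u) v = K w u v" for w u v
      unfolding K_def m by (simp add: sym[OF S(2), of _ "\<Gamma>' _ _"] s[of u w] s[of v w] s[of v u])
    then show "\<Gamma>' = \<Gamma>" by (intro ext eqI) (simp add: \<Gamma>)
  qed
qed


section \<open>The tangent bundle in a chart\<close>

text \<open>
  A point of the tangent bundle is \<open>(x,v) :: 'a \<times> 'a\<close>, a tangent vector to the tangent bundle is an
  element of \<open>'a \<times> 'a\<close> as well. The horizontal lift of \<open>w\<close> is the velocity of the parallel
  transport of \<open>v\<close> along a curve with velocity \<open>w\<close>.
\<close>

definition horizontal_lift :: "'a::euclidean_space metric \<Rightarrow> 'a \<times> 'a \<Rightarrow> 'a \<Rightarrow> 'a \<times> 'a" where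
  "horizontal_lift g q w = (w, - christoffel g (fst q) w (snd q))"

definition vertical_lift :: "'a::euclidean_space \<times> 'a \<Rightarrow> 'a \<Rightarrow> 'a \<times> 'a" where
  "vertical_lift q w = (0, w)"

text \<open>The inverse of the identification \<open>(w\<^sub>1,w\<^sub>2) \<mapsto> w\<^sub>1\<^sup>H + w\<^sub>2\<^sup>V\<close>.\<close>

definition hv_split :: "'a::euclidean_space metric \<Rightarrow> 'a \<times> 'a \<Rightarrow> 'a \<times> 'a \<Rightarrow> 'a \<times> 'a" where
  "hv_split g q \<xi> = (fst \<xi>, snd \<xi> + christoffel g (fst q) (fst \<xi>) (snd q))"

lemma hv_split_iff:
  "hv_split g q \<xi> = (w1, w2) \<longleftrightarrow> \<xi> = horizontal_lift g q w1 + vertical_lift q w2"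
  by (cases \<xi>) (auto simp: hv_split_def horizontal_lift_def vertical_lift_def)

definition bundle_metric :: "'a::euclidean_space metric \<Rightarrow> ('a \<times> 'a) metric" where
  "bundle_metric g q \<xi> \<zeta> =
     (case (hv_split g q \<xi>, hv_split g q \<zeta>) of
        ((X1, X2), (Y1, Y2)) \<Rightarrow> g (fst q) X1 Y2 + g (fst q) X2 Y1)"

definition bundle_form ::
  "'a::euclidean_space metric \<Rightarrow> ('a \<Rightarrow> 'a \<Rightarrow> 'a) \<Rightarrow> 'a \<times> 'a \<Rightarrow> 'a \<times> 'a \<Rightarrow> 'a \<times> 'a \<Rightarrow> real" where
  "bundle_form g J q \<xi> \<zeta> =
     (case (hv_split g q \<xi>, hv_split g q \<zeta>) of
        ((X1, X2), (Y1, Y2)) \<Rightarrow> g (fst q) (J (fst q) X1) Y2 - g (fst q) X2 (J (fst q) Y1))"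


section \<open>The hyperbolic plane\<close>

text \<open>The coordinates \<open>(x\<^sub>0,x\<^sub>1,x\<^sub>2)\<close> are \<open>(x$1, x$2, x$3)\<close>.\<close>

definition mink :: "real^3 \<Rightarrow> real^3 \<Rightarrow> real" where
  "mink x y = - (x$1 * y$1) + x$2 * y$2 + x$3 * y$3"

definition mcross :: "real^3 \<Rightarrow> real^3 \<Rightarrow> real^3" where
  "mcross x y = (THE w. \<forall>v. mink w v = det (vector [x, y, v] :: real^3^3))"

lemma mcross_eq:
  "mcross x y = vector [x$3 * y$2 - x$2 * y$3, x$3 * y$1 - x$1 * y$3, x$1 * y$2 - x$2 * y$1]"
  (is "_ = ?c")
  unfolding mcross_def
proof (rule the_equality)
  show *: "\<forall>v. mink ?c v = det (vector [x, y, v] :: real^3^3)"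
    by (simp add: mink_def det_3 algebra_simps)
  fix w assume w: "\<forall>v. mink w v = det (vector [x, y, v] :: real^3^3)"
  have "mink w (axis i 1) = mink ?c (axis i 1)" for i using w * by simp
  from this[of 1] this[of 2] this[of 3] show "w = ?c"
    by (simp add: mink_def axis_def vec_eq_iff forall_3)
qed

definition hyp :: "(real^3) set" where
  "hyp = {x. mink x x = -1 \<and> x$1 > 0}"

definition tangent_hyp :: "real^3 \<Rightarrow> (real^3) set" where
  "tangent_hyp p = {v. mink p v = 0}"

definition klein :: "real^3 \<Rightarrow> complex" where
  "klein x = Complex (x$2 / x$1) (x$3 / x$1)"

definition klein_inv :: "complex \<Rightarrow> real^3" where
  "klein_inv \<eta> = (1 / sqrt (1 - (norm \<eta>)\<^sup>2)) *\<^sub>R vector [1, Re \<eta>, Im \<eta>]"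

lemma klein_inv_in_hyp: "norm \<eta> < 1 \<Longrightarrow> klein_inv \<eta> \<in> hyp"
proof -
  assume "norm \<eta> < 1"
  then have s: "1 - (norm \<eta>)\<^sup>2 > 0" by (simp add: abs_square_less_1)
  define r where "r = 1 / sqrt (1 - (norm \<eta>)\<^sup>2)"
  have "r > 0" and r: "r * r * (1 - ((Re \<eta>)\<^sup>2 + (Im \<eta>)\<^sup>2)) = 1"
    using s by (auto simp: r_def cmod_power2)
  have "klein_inv \<eta> = r *\<^sub>R vector [1, Re \<eta>, Im \<eta>]" by (simp add: klein_inv_def r_def)
  then show ?thesis
    using \<open>r > 0\<close> r by (simp add: hyp_def mink_def power2_eq_square algebra_simps)
qed

lemma klein_klein_inv: "norm \<eta> < 1 \<Longrightarrow> klein (klein_inv \<eta>) = \<eta>"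
  using abs_square_less_1[of "norm \<eta>"] by (simp add: klein_def klein_inv_def complex_eq_iff)

lemma
  assumes "x \<in> hyp"
  shows klein_in_ball: "norm (klein x) < 1" and klein_inv_klein: "klein_inv (klein x) = x"
proof -
  have x: "x$1 > 0" "(x$1)\<^sup>2 = 1 + (x$2)\<^sup>2 + (x$3)\<^sup>2"
    using assms by (auto simp: hyp_def mink_def power2_eq_square)
  have n: "1 - (norm (klein x))\<^sup>2 = (1 / x$1)\<^sup>2"
  proof -
    have "(x$1)\<^sup>2 - (x$2)\<^sup>2 - (x$3)\<^sup>2 = 1" using x(2) by simp
    moreover have "1 - (norm (klein x))\<^sup>2 = ((x$1)\<^sup>2 - (x$2)\<^sup>2 - (x$3)\<^sup>2) / (x$1)\<^sup>2"
      using x(1) by (simp add: klein_def cmod_power2 power_divide diff_divide_distrib)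
    ultimately show ?thesis by (simp add: power_divide)
  qed
  then have "(norm (klein x))\<^sup>2 < 1" using x(1) by (smt (verit) zero_less_divide_1_iff zero_less_power)
  then show "norm (klein x) < 1" by (simp add: abs_square_less_1)
  have "sqrt (1 - (norm (klein x))\<^sup>2) = 1 / x$1" unfolding n using x(1) by simp
  then show "klein_inv (klein x) = x"
    using x(1) by (simp add: klein_inv_def klein_def vec_eq_iff forall_3)
qed

text \<open>The global chart of the hyperbolic plane used below is \<open>klein\<close>, onto the open unit disk.\<close>

abbreviation disk :: "complex set" where
  "disk \<equiv> ball 0 1"

abbreviation circle :: "complex set" where
  "circle \<equiv> sphere 0 1"

text \<open>The Riemannian metric induced by \<open>mink\<close>, in this chart.\<close>

definition hyp_metric :: "complex metric" where
  "hyp_metric \<eta> a b =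
     mink (frechet_derivative klein_inv (at \<eta>) a) (frechet_derivative klein_inv (at \<eta>) b)"

definition hyp_J :: "real^3 \<Rightarrow> real^3 \<Rightarrow> real^3" where
  "hyp_J p v = mcross p v"

definition klein_J :: "complex \<Rightarrow> complex \<Rightarrow> complex" where
  "klein_J \<eta> a =
     frechet_derivative klein (at (klein_inv \<eta>))
       (hyp_J (klein_inv \<eta>) (frechet_derivative klein_inv (at \<eta>) a))"

text \<open>
  Functions and vector fields on the hyperbolic plane are functions on \<open>real^3\<close> of which only the
  values on \<open>hyp\<close> matter. In particular the differential of \<open>u\<close> at \<open>p \<in> hyp\<close> is taken along \<open>hyp\<close>,
  on tangent vectors \<open>w \<in> tangent_hyp p\<close>.
\<close>

definition smooth_fun_hyp :: "(real^3 \<Rightarrow> real) \<Rightarrow> bool" where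
  "smooth_fun_hyp u \<longleftrightarrow> smooth_on disk (u \<circ> klein_inv)"

definition hyp_differential :: "(real^3 \<Rightarrow> real) \<Rightarrow> real^3 \<Rightarrow> real^3 \<Rightarrow> real" where
  "hyp_differential u p w =
     frechet_derivative (u \<circ> klein_inv) (at (klein p)) (frechet_derivative klein (at p) w)"

definition hyp_grad :: "(real^3 \<Rightarrow> real) \<Rightarrow> real^3 \<Rightarrow> real^3" where
  "hyp_grad u p =
     (THE v. v \<in> tangent_hyp p \<and> (\<forall>w\<in>tangent_hyp p. mink v w = hyp_differential u p w))"

definition hyp_laplacian :: "(real^3 \<Rightarrow> real) \<Rightarrow> real^3 \<Rightarrow> real" where
  "hyp_laplacian u p = laplacian hyp_metric (u \<circ> klein_inv) (klein p)"

definition klein_push :: "(real^3 \<Rightarrow> real^3) \<Rightarrow> complex \<Rightarrow> complex" where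
  "klein_push V \<eta> = frechet_derivative klein (at (klein_inv \<eta>)) (V (klein_inv \<eta>))"

definition smooth_vector_field_hyp :: "(real^3 \<Rightarrow> real^3) \<Rightarrow> bool" where
  "smooth_vector_field_hyp V \<longleftrightarrow>
     (\<forall>p\<in>hyp. V p \<in> tangent_hyp p) \<and> smooth_on disk (klein_push V)"

text \<open>The vector field \<open>V\<close> as a map into the tangent bundle, in the chart.\<close>

definition bundle_section :: "(real^3 \<Rightarrow> real^3) \<Rightarrow> complex \<Rightarrow> complex \<times> complex" where
  "bundle_section V \<eta> = (\<eta>, klein_push V \<eta>)"

definition harmonic_vector_field :: "(real^3 \<Rightarrow> real^3) \<Rightarrow> bool" where
  "harmonic_vector_field V \<longleftrightarrow>
     harmonic_map_on disk hyp_metric (bundle_metric hyp_metric) (bundle_section V)"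

definition lagrangian_vector_field :: "(real^3 \<Rightarrow> real^3) \<Rightarrow> bool" where
  "lagrangian_vector_field V \<longleftrightarrow>
     (\<forall>\<eta>\<in>disk. \<forall>a b. bundle_form hyp_metric klein_J (bundle_section V \<eta>)
        (frechet_derivative (bundle_section V) (at \<eta>) a)
        (frechet_derivative (bundle_section V) (at \<eta>) b) = 0)"

definition harmonic_lagrangian :: "(real^3 \<Rightarrow> real^3) \<Rightarrow> bool" where
  "harmonic_lagrangian V \<longleftrightarrow>
     smooth_vector_field_hyp V \<and> harmonic_vector_field V \<and> lagrangian_vector_field V"


section \<open>Boundary values\<close>

definition continuous_circle_field :: "(complex \<Rightarrow> complex) \<Rightarrow> bool" where
  "continuous_circle_field X \<longleftrightarrow> continuous_on circle X \<and> (\<forall>z\<in>circle. X z \<bullet> z = 0)"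

definition support_function :: "(complex \<Rightarrow> complex) \<Rightarrow> complex \<Rightarrow> real" where
  "support_function X z = (THE r. X z = \<i> * z * complex_of_real r)"

lemma support_function:
  assumes "continuous_circle_field X" "z \<in> circle"
  shows "X z = \<i> * z * complex_of_real (support_function X z)"
proof -
  have z: "(Re z)\<^sup>2 + (Im z)\<^sup>2 = 1" "z \<noteq> 0"
    using assms(2) by (auto simp: cmod_power2[symmetric])
  have t: "Re (X z) * Re z + Im (X z) * Im z = 0"
    using assms by (auto simp: continuous_circle_field_def inner_complex_def)
  define r where "r = Im (X z) * Re z - Re (X z) * Im z"
  have "Im (X z) = r * Re z" "Re (X z) = - (r * Im z)"
    unfolding r_def using z(1) t by algebra+
  then have "X z = \<i> * z * complex_of_real r"
    by (simp add: complex_eq_iff mult.commute)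
  moreover have "s = r" if "X z = \<i> * z * complex_of_real s" for s
    using that calculation z(2) by simp
  ultimately show ?thesis unfolding support_function_def by (metis (mono_tags, lifting) theI)
qed

definition ubar :: "(real^3 \<Rightarrow> real) \<Rightarrow> complex \<Rightarrow> real" where
  "ubar u \<eta> = sqrt (1 - (norm \<eta>)\<^sup>2) * u (klein_inv \<eta>)"

definition has_boundary_values :: "(real^3 \<Rightarrow> real) \<Rightarrow> (complex \<Rightarrow> real) \<Rightarrow> bool" where
  "has_boundary_values u \<phi> \<longleftrightarrow>
     (\<exists>F. continuous_on (cball 0 1) F \<and> (\<forall>\<eta>\<in>disk. F \<eta> = ubar u \<eta>) \<and> (\<forall>z\<in>circle. F z = \<phi> z))"

definition extends_continuously_to :: "(real^3 \<Rightarrow> real^3) \<Rightarrow> (complex \<Rightarrow> complex) \<Rightarrow> bool" where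
  "extends_continuously_to V X \<longleftrightarrow>
     (\<forall>\<eta> z. (\<forall>n::nat. \<eta> n \<in> disk) \<longrightarrow> z \<in> circle \<longrightarrow> \<eta> \<longlonglongrightarrow> z \<longrightarrow>
        (\<lambda>n. klein_push V (\<eta> n)) \<longlonglongrightarrow> X z)"

end

theory Submission
  imports Defs
begin

text \<open>
  Write \<open>F = ubar u\<close>. It is the restriction to the plane \<open>x\<^sub>0 = 1\<close> of the extension \<open>U\<close> of \<open>u\<close> to the future
  cone that is homogeneous of degree \<open>1\<close>. On such extensions \<open>\<Delta> u - 2 u = 0\<close> says that the Minkowski
  wave operator annihilates \<open>U\<close>, and in terms of \<open>F\<close> this is the equation
  \<open>(1 - x\<^sup>2) F\<^sub>x\<^sub>x - 2 x y F\<^sub>x\<^sub>y + (1 - y\<^sup>2) F\<^sub>y\<^sub>y = 0\<close> on the disk, which has no terms of lower order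
  (\<open>laplacian_height_mult\<close>). The radial part of the Minkowski gradient of \<open>U\<close> is killed by the cross
  product with \<open>p\<close>, so that \<open>J grad u\<close> reads \<open>\<i> (\<eta> F + (1 - |\<eta>|\<^sup>2) \<nabla>F)\<close> in the Klein chart
  (\<open>klein_push_rotated_gradient\<close>). All claims are about this explicit field.

  Harmonic: in the chart, the neutral metric at \<open>(x,v)\<close> is the complete lift of \<open>g\<close>: its quadratic part
  in the base direction is the derivative of \<open>g\<close> at \<open>x\<close> along \<open>v\<close>. Hence its Christoffel symbols are those
  of \<open>g\<close> together with their derivative along \<open>v\<close> (\<open>christoffel_bundle_metric\<close>). The tension
  field of a section is therefore vertical and linear in the vector field
  (\<open>tension_field_bundle_section\<close>), and for the field above it is a combination of the equation for \<open>F\<close>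
  and of its first derivatives.

  Lagrangian: since \<open>g(J a, b)\<close> is the area form, the pull-back of the symplectic form is the divergence
  of the field times the area form. A rotated gradient has divergence zero because second derivatives
  commute.

  Boundary values: when \<open>\<eta>\<close> tends to \<open>z\<close> on the circle, \<open>\<i> \<eta> F\<close> tends to \<open>\<i> z \<phi>(z) = X z\<close>, so what is needed
  is \<open>(1 - |\<eta>|\<^sup>2) \<nabla>F \<rightarrow> 0\<close>. This is an interior gradient estimate which is uniform under isometries. At
  the origin, the gradient is bounded by the supremum of \<open>|F|\<close> on a disk of fixed radius: the difference
  of \<open>F\<close> and its mirror image vanishes on the mirror line, hence stays below an explicit barrier on the
  half disk (\<open>half_disk_barrier\<close>, \<open>gradient_estimate_origin\<close>). A Lorentz transformation acts on
  solutions through \<open>U\<close> (\<open>klein_solution_lorentz\<close>), and moves any \<open>\<eta>\<close> to the origin while the disk of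
  fixed radius becomes a neighbourhood of \<open>\<eta>\<close> of size \<open>O(sqrt (1 - |\<eta>|\<^sup>2))\<close> (\<open>gradient_estimate\<close>). Applied
  to the solution \<open>F - \<phi>(z)\<close>, which is small near \<open>z\<close>, this gives the limit.
\<close>

section \<open>Calculus on open sets\<close>

definition dir_deriv :: "'a \<Rightarrow> ('a::real_normed_vector \<Rightarrow> 'b::real_normed_vector) \<Rightarrow> 'a \<Rightarrow> 'b" where
  "dir_deriv v f x = frechet_derivative f (at x) v"

lemma dir_deriv_eq: "(f has_derivative f') (at x) \<Longrightarrow> dir_deriv v f x = f' v"
  by (simp add: dir_deriv_def frechet_derivative_at[symmetric])

lemma has_derivative_dir_deriv:
  "f differentiable (at x) \<Longrightarrow> (f has_derivative (\<lambda>v. dir_deriv v f x)) (at x)"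
  by (simp add: dir_deriv_def frechet_derivative_works[symmetric])

lemma Ck_on_Suc_dir:
  "Ck_on (Suc k) S f \<longleftrightarrow> (\<forall>x\<in>S. f differentiable (at x)) \<and> (\<forall>v. Ck_on k S (dir_deriv v f))"
  by (simp add: dir_deriv_def[abs_def])

\<comment> \<open>Unfolding it would expose \<open>frechet_derivative\<close>; \<open>Ck_on_Suc_dir\<close> takes its place.\<close>
declare Ck_on.simps(2)[simp del]

lemma Ck_on_cong:
  assumes "open S" "\<And>x. x \<in> S \<Longrightarrow> f x = g x" "Ck_on k S f"
  shows "Ck_on k S g"
  using assms(2,3)
proof (induction k arbitrary: f g)
  case 0
  then show ?case by (simp cong: continuous_on_cong)
next
  case (Suc k)
  have d: "(g has_derivative (\<lambda>v. dir_deriv v f x)) (at x)" if "x \<in> S" for x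
    by (rule has_derivative_transform_within_open[OF has_derivative_dir_deriv assms(1) that])
       (use Suc.prems that in \<open>auto simp: Ck_on_Suc_dir\<close>)
  show ?case
    unfolding Ck_on_Suc_dir
  proof (intro conjI ballI allI)
    show "g differentiable (at x)" if "x \<in> S" for x
      using d[OF that] by (auto simp: differentiable_def)
    show "Ck_on k S (dir_deriv v g)" for v
    proof (rule Suc.IH)
      show "Ck_on k S (dir_deriv v f)" using Suc.prems(2) by (simp add: Ck_on_Suc_dir)
      show "dir_deriv v f x = dir_deriv v g x" if "x \<in> S" for x by (simp add: dir_deriv_eq[OF d[OF that]])
    qed
  qed
qed

lemma Ck_on_SucI:
  assumes "open S" "\<And>x. x \<in> S \<Longrightarrow> (f has_derivative f' x) (at x)"
    "\<And>v. Ck_on k S (\<lambda>x. f' x v)"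
  shows "Ck_on (Suc k) S f"
  unfolding Ck_on_Suc_dir
proof (intro conjI ballI allI)
  show "f differentiable (at x)" if "x \<in> S" for x
    using assms(2)[OF that] by (auto simp: differentiable_def)
  show "Ck_on k S (dir_deriv v f)" for v
    by (rule Ck_on_cong[OF assms(1) _ assms(3)[of v]]) (simp add: dir_deriv_eq[OF assms(2)])
qed

lemma Ck_on_SucD:
  assumes "Ck_on (Suc k) S f"
  shows "Ck_on k S f"
  using assms
proof (induction k arbitrary: f)
  case 0
  then show ?case
    by (auto simp: Ck_on_Suc_dir intro!: continuous_at_imp_continuous_on differentiable_imp_continuous_within)
next
  case (Suc k)
  have "Ck_on k S (dir_deriv v f)" for v
    using Suc.prems by (intro Suc.IH) (simp add: Ck_on_Suc_dir[where f = f])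
  then show ?case using Suc.prems by (simp add: Ck_on_Suc_dir[where f = f])
qed

lemma Ck_on_Suc_derivative:
  "Ck_on (Suc k) S f \<Longrightarrow> x \<in> S \<Longrightarrow> (f has_derivative (\<lambda>v. dir_deriv v f x)) (at x)"
  by (simp add: Ck_on_Suc_dir has_derivative_dir_deriv)

lemma Ck_on_const: "open S \<Longrightarrow> Ck_on k S (\<lambda>x. c)"
proof (induction k arbitrary: c)
  case (Suc k)
  show ?case
    by (rule Ck_on_SucI[OF Suc.prems has_derivative_const Suc.IH[OF Suc.prems]])
qed simp

lemma Ck_on_bounded_linear:
  assumes "bounded_linear l" "open S" "Ck_on k S f"
  shows "Ck_on k S (\<lambda>x. l (f x))"
  using assms(3)
proof (induction k arbitrary: f)
  case 0
  then show ?case by (simp add: bounded_linear.continuous_on[OF assms(1)])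
next
  case (Suc k)
  show ?case
    by (rule Ck_on_SucI[OF assms(2)
          bounded_linear.has_derivative[OF assms(1) Ck_on_Suc_derivative[OF Suc.prems]] Suc.IH])
       (use Suc.prems in \<open>auto simp: Ck_on_Suc_dir\<close>)
qed

lemma Ck_on_add:
  assumes "open S" "Ck_on k S f" "Ck_on k S g"
  shows "Ck_on k S (\<lambda>x. f x + g x)"
  using assms(2,3)
proof (induction k arbitrary: f g)
  case 0
  then show ?case by (simp add: continuous_on_add)
next
  case (Suc k)
  show ?case
    by (rule Ck_on_SucI[OF assms(1) has_derivative_add[OF Ck_on_Suc_derivative Ck_on_Suc_derivative] Suc.IH])
       (use Suc.prems in \<open>auto simp: Ck_on_Suc_dir\<close>)
qed

lemma Ck_on_mult:
  fixes f g :: "'a::real_normed_vector \<Rightarrow> real"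
  assumes "open S" "Ck_on k S f" "Ck_on k S g"
  shows "Ck_on k S (\<lambda>x. f x * g x)"
  using assms(2,3)
proof (induction k arbitrary: f g)
  case 0
  then show ?case by (simp add: continuous_on_mult)
next
  case (Suc k)
  note low = Ck_on_SucD[OF Suc.prems(1)] Ck_on_SucD[OF Suc.prems(2)]
  have "Ck_on k S (dir_deriv v f)" "Ck_on k S (dir_deriv v g)" for v
    using Suc.prems by (auto simp: Ck_on_Suc_dir)
  then have "Ck_on k S (\<lambda>x. f x * dir_deriv v g x + dir_deriv v f x * g x)" for v
    using low by (intro Ck_on_add[OF assms(1)] Suc.IH)
  moreover have "((\<lambda>x. f x * g x) has_derivative (\<lambda>v. f x * dir_deriv v g x + dir_deriv v f x * g x)) (at x)"
    if "x \<in> S" for x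
    by (rule has_derivative_mult[OF Ck_on_Suc_derivative[OF Suc.prems(1) that]
          Ck_on_Suc_derivative[OF Suc.prems(2) that]])
  ultimately show ?case by (intro Ck_on_SucI[OF assms(1)])
qed

lemma Ck_on_id: "open S \<Longrightarrow> Ck_on k S (\<lambda>x. x)"
proof (cases k)
  case (Suc m)
  assume "open S"
  from Ck_on_SucI[OF this has_derivative_ident Ck_on_const[OF this]] show ?thesis unfolding Suc .
qed simp

lemma smooth_onD: "smooth_on S f \<Longrightarrow> Ck_on k S f"
  by (simp add: smooth_on_def)

lemma smooth_on_has_derivative:
  "smooth_on S f \<Longrightarrow> x \<in> S \<Longrightarrow> (f has_derivative (\<lambda>v. dir_deriv v f x)) (at x)"
  by (rule Ck_on_Suc_derivative[OF smooth_onD])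

lemma smooth_on_dir_deriv: "smooth_on S f \<Longrightarrow> smooth_on S (dir_deriv v f)"
  using Ck_on_Suc_dir unfolding smooth_on_def by blast

lemma smooth_on_linear:
  "bounded_linear l \<Longrightarrow> open S \<Longrightarrow> smooth_on S f \<Longrightarrow> smooth_on S (\<lambda>x. l (f x))"
  by (simp add: smooth_on_def Ck_on_bounded_linear)

lemma smooth_on_const: "open S \<Longrightarrow> smooth_on S (\<lambda>x. c)"
  by (simp add: smooth_on_def Ck_on_const)

lemma smooth_on_id: "open S \<Longrightarrow> smooth_on S (\<lambda>x. x)"
  by (simp add: smooth_on_def Ck_on_id)

lemma smooth_on_add:
  "open S \<Longrightarrow> smooth_on S f \<Longrightarrow> smooth_on S g \<Longrightarrow> smooth_on S (\<lambda>x. f x + g x)"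
  by (simp add: smooth_on_def Ck_on_add)

lemma smooth_on_mult:
  fixes f g :: "'a::real_normed_vector \<Rightarrow> real"
  shows "open S \<Longrightarrow> smooth_on S f \<Longrightarrow> smooth_on S g \<Longrightarrow> smooth_on S (\<lambda>x. f x * g x)"
  by (simp add: smooth_on_def Ck_on_mult)

lemma smooth_on_cong:
  "open S \<Longrightarrow> (\<And>x. x \<in> S \<Longrightarrow> f x = g x) \<Longrightarrow> smooth_on S f \<Longrightarrow> smooth_on S g"
  unfolding smooth_on_def using Ck_on_cong by blast

lemma Complex_has_derivative:
  fixes f g :: "'a::real_normed_vector \<Rightarrow> real"
  assumes "(f has_derivative f') (at q)" "(g has_derivative g') (at q)"
  shows "((\<lambda>q. Complex (f q) (g q)) has_derivative (\<lambda>v. Complex (f' v) (g' v))) (at q)"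
  by (subst has_derivative_componentwise_within)
     (use assms in \<open>simp add: Basis_complex_def inner_complex_def\<close>)

subsection \<open>Symmetry of second derivatives\<close>

text \<open>
  The mean value theorem in direction \<open>v\<close>, applied to the difference of \<open>f\<close> along \<open>t w\<close>, leaves a difference
  of values of \<open>\<lambda>x. f' x v\<close>, which is \<open>t * A w\<close> to first order.
  The quotient is symmetric in \<open>v\<close> and \<open>w\<close>, which is why the two mixed derivatives agree.
\<close>
lemma second_difference_tendsto:
  fixes f :: "'a::real_normed_vector \<Rightarrow> real"
  assumes S: "open S" "p \<in> S" and f: "\<And>x. x \<in> S \<Longrightarrow> (f has_derivative f' x) (at x)"
    and A: "((\<lambda>x. f' x v) has_derivative A) (at p)"
  shows "((\<lambda>t. (f (p + t *\<^sub>R v + t *\<^sub>R w) - f (p + t *\<^sub>R v) - f (p + t *\<^sub>R w) + f p) / t\<^sup>2)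
           \<longlongrightarrow> A w) (at_right 0)"
proof (rule tendstoI)
  fix e :: real assume e: "e > 0"
  \<comment> \<open>The factor \<open>2\<close> is for the two points at which \<open>A\<close> approximates \<open>\<lambda>x. f' x v\<close> below.\<close>
  define c where "c = e / (2 * (norm v + norm w + 1))"
  have c: "c > 0" "2 * (c * (norm v + norm w)) < e"
    using e by (auto simp: c_def field_simps add_pos_nonneg add_nonneg_pos intro!: add_nonneg_pos)
  obtain d1 where d1: "d1 > 0" "\<And>y. norm (y - p) < d1 \<Longrightarrow>
      \<bar>f' y v - f' p v - A (y - p)\<bar> \<le> c * norm (y - p)"
    using A c(1) unfolding has_derivative_at_alt real_norm_def by metis
  obtain d2 where d2: "d2 > 0" "\<And>y. norm (y - p) < d2 \<Longrightarrow> y \<in> S"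
    using S unfolding open_dist dist_norm by metis
  define d where "d = min d1 d2 / (norm v + norm w + 1)"
  have dpos: "d > 0" using d1 d2 by (simp add: d_def add_nonneg_pos)
  have linA: "linear A" using A has_derivative_linear by blast
  have "dist ((f (p + t *\<^sub>R v + t *\<^sub>R w) - f (p + t *\<^sub>R v) - f (p + t *\<^sub>R w) + f p) / t\<^sup>2) (A w) < e"
    if t: "0 < t" "t < d" for t
  proof -
    have near: "norm (x *\<^sub>R v + y *\<^sub>R w) \<le> t * (norm v + norm w)"
               "norm (x *\<^sub>R v + y *\<^sub>R w) < min d1 d2" if "0 \<le> x" "x \<le> t" "0 \<le> y" "y \<le> t" for x y
    proof -
      have "norm (x *\<^sub>R v + y *\<^sub>R w) \<le> x * norm v + y * norm w"
        using norm_triangle_ineq[of "x *\<^sub>R v" "y *\<^sub>R w"] that by simp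
      also have "\<dots> \<le> t * norm v + t * norm w"
        using that by (intro add_mono mult_right_mono) auto
      finally show 1: "norm (x *\<^sub>R v + y *\<^sub>R w) \<le> t * (norm v + norm w)" by (simp add: algebra_simps)
      have "t * (norm v + norm w + 1) < min d1 d2"
        using t(2) by (simp add: d_def pos_less_divide_eq add_nonneg_pos)
      then show "norm (x *\<^sub>R v + y *\<^sub>R w) < min d1 d2" using 1 t by (simp add: algebra_simps)
    qed
    define \<phi> where "\<phi> x = f (p + x *\<^sub>R v + t *\<^sub>R w) - f (p + x *\<^sub>R v)" for x
    have der: "(\<phi> has_real_derivative (f' (p + x *\<^sub>R v + t *\<^sub>R w) v - f' (p + x *\<^sub>R v) v)) (at x)"
      if "0 \<le> x" "x \<le> t" for x
    proof -
      have "p + x *\<^sub>R v + t *\<^sub>R w \<in> S" "p + x *\<^sub>R v \<in> S"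
        using near(2)[of x t] near(2)[of x 0] that t(1) by (auto intro!: d2(2) simp: add.assoc)
      note fd = f[OF this(1)] f[OF this(2)]
      have "((\<lambda>x. f (p + x *\<^sub>R v + t *\<^sub>R w)) has_derivative (\<lambda>h. f' (p + x *\<^sub>R v + t *\<^sub>R w) (h *\<^sub>R v))) (at x)"
        by (rule has_derivative_compose[where f = "\<lambda>x. p + x *\<^sub>R v + t *\<^sub>R w", OF _ fd(1)]) (auto intro!: derivative_eq_intros)
      moreover have "((\<lambda>x. f (p + x *\<^sub>R v)) has_derivative (\<lambda>h. f' (p + x *\<^sub>R v) (h *\<^sub>R v))) (at x)"
        by (rule has_derivative_compose[where f = "\<lambda>x. p + x *\<^sub>R v", OF _ fd(2)]) (auto intro!: derivative_eq_intros)
      ultimately have "(\<phi> has_derivative (\<lambda>h. f' (p + x *\<^sub>R v + t *\<^sub>R w) (h *\<^sub>R v) - f' (p + x *\<^sub>R v) (h *\<^sub>R v))) (at x)"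
        unfolding \<phi>_def by (rule has_derivative_diff)
      then show ?thesis
        unfolding has_field_derivative_def
        by (rule has_derivative_eq_rhs)
           (auto simp: linear_cmul[OF has_derivative_linear[OF fd(1)]]
             linear_cmul[OF has_derivative_linear[OF fd(2)]] left_diff_distrib)
    qed
    obtain z where z: "0 < z" "z < t"
      "\<phi> t - \<phi> 0 = (t - 0) * (f' (p + z *\<^sub>R v + t *\<^sub>R w) v - f' (p + z *\<^sub>R v) v)"
      using MVT2[OF t(1), of \<phi> "\<lambda>x. f' (p + x *\<^sub>R v + t *\<^sub>R w) v - f' (p + x *\<^sub>R v) v"] der by blast
    have b1: "\<bar>f' (p + z *\<^sub>R v + t *\<^sub>R w) v - f' p v - A (z *\<^sub>R v + t *\<^sub>R w)\<bar> \<le> c * (t * (norm v + norm w))"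
      using order_trans[OF d1(2)[of "p + (z *\<^sub>R v + t *\<^sub>R w)", unfolded add_diff_cancel_left']
          mult_left_mono[OF near(1)[of z t]]] near(2)[of z t] z(1,2) c(1)
      by (simp add: add.assoc)
    have b2: "\<bar>f' (p + z *\<^sub>R v) v - f' p v - A (z *\<^sub>R v)\<bar> \<le> c * (t * (norm v + norm w))"
      using order_trans[OF d1(2)[of "p + z *\<^sub>R v", unfolded add_diff_cancel_left'] mult_left_mono[OF near(1)[of z 0, unfolded scaleR_zero_left add_0_right]]]
        near(2)[of z 0] z(1,2) c(1)
      by simp
    have "A (z *\<^sub>R v + t *\<^sub>R w) = A (z *\<^sub>R v) + t * A w"
      by (simp add: linear_add[OF linA] linear_cmul[OF linA])
    with b1 b2 have "\<bar>f' (p + z *\<^sub>R v + t *\<^sub>R w) v - f' (p + z *\<^sub>R v) v - t * A w\<bar>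
        \<le> 2 * (c * (t * (norm v + norm w)))" by linarith
    also have "\<dots> = t * (2 * (c * (norm v + norm w)))" by simp
    also have "\<dots> < t * e" using c(2) t(1) by (intro mult_strict_left_mono) auto
    finally have 1: "\<bar>(f' (p + z *\<^sub>R v + t *\<^sub>R w) v - f' (p + z *\<^sub>R v) v) / t - A w\<bar> < e"
      using t(1) by (simp add: field_simps abs_less_iff)
    have "(f (p + t *\<^sub>R v + t *\<^sub>R w) - f (p + t *\<^sub>R v) - f (p + t *\<^sub>R w) + f p) = \<phi> t - \<phi> 0"
      by (simp add: \<phi>_def)
    then have "(f (p + t *\<^sub>R v + t *\<^sub>R w) - f (p + t *\<^sub>R v) - f (p + t *\<^sub>R w) + f p) / t\<^sup>2
        = (f' (p + z *\<^sub>R v + t *\<^sub>R w) v - f' (p + z *\<^sub>R v) v) / t"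
      using z(3) t(1) by (simp add: power2_eq_square)
    then show ?thesis using 1 by (simp only: dist_real_def)
  qed
  then show "\<forall>\<^sub>F t in at_right 0. dist ((f (p + t *\<^sub>R v + t *\<^sub>R w) - f (p + t *\<^sub>R v) - f (p + t *\<^sub>R w) + f p) / t\<^sup>2) (A w) < e"
    unfolding eventually_at_right_field using dpos by blast
qed

lemma second_derivative_symmetric:
  fixes f :: "'a::real_normed_vector \<Rightarrow> real"
  assumes S: "open S" "p \<in> S" and f: "\<And>x. x \<in> S \<Longrightarrow> (f has_derivative f' x) (at x)"
    and A: "((\<lambda>x. f' x v) has_derivative A) (at p)" and B: "((\<lambda>x. f' x w) has_derivative B) (at p)"
  shows "A w = B v"
proof (rule tendsto_unique[OF trivial_limit_at_right_real second_difference_tendsto[OF S f A, of w]])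
  have "f (p + t *\<^sub>R w + t *\<^sub>R v) - f (p + t *\<^sub>R w) - f (p + t *\<^sub>R v) + f p
      = f (p + t *\<^sub>R v + t *\<^sub>R w) - f (p + t *\<^sub>R v) - f (p + t *\<^sub>R w) + f p" for t
    by (simp add: add.assoc add.commute[of "t *\<^sub>R w"])
  then show "((\<lambda>t. (f (p + t *\<^sub>R v + t *\<^sub>R w) - f (p + t *\<^sub>R v) - f (p + t *\<^sub>R w) + f p) / t\<^sup>2)
      \<longlongrightarrow> B v) (at_right 0)"
    using second_difference_tendsto[OF S f B, of v] by (simp only:)
qed

lemma dir_deriv_commute:
  fixes f :: "'a::real_normed_vector \<Rightarrow> real"
  assumes "open S" "smooth_on S f" "x \<in> S"
  shows "dir_deriv v (dir_deriv w f) x = dir_deriv w (dir_deriv v f) x"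
  by (rule second_derivative_symmetric[OF assms(1,3) smooth_on_has_derivative[OF assms(2)]
        smooth_on_has_derivative[OF smooth_on_dir_deriv[OF assms(2)] assms(3)]
        smooth_on_has_derivative[OF smooth_on_dir_deriv[OF assms(2)] assms(3)]])

subsection \<open>Partial derivatives in the plane\<close>

definition has_partials_on ::
  "complex set \<Rightarrow> (complex \<Rightarrow> real) \<Rightarrow> (complex \<Rightarrow> real) \<Rightarrow> (complex \<Rightarrow> real) \<Rightarrow> bool" where
  "has_partials_on S F Fx Fy \<longleftrightarrow>
     (\<forall>\<eta>\<in>S. (F has_derivative (\<lambda>v. Re v * Fx \<eta> + Im v * Fy \<eta>)) (at \<eta>))"

definition twice_differentiable_on where
  "twice_differentiable_on S F Fx Fy Fxx Fxy Fyy \<longleftrightarrow>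
     has_partials_on S F Fx Fy \<and> has_partials_on S Fx Fxx Fxy \<and> has_partials_on S Fy Fxy Fyy"

lemma twice_differentiable_onD:
  assumes "twice_differentiable_on S F Fx Fy Fxx Fxy Fyy" "\<eta> \<in> S"
  shows "(F has_derivative (\<lambda>v. Re v * Fx \<eta> + Im v * Fy \<eta>)) (at \<eta>)"
    "(Fx has_derivative (\<lambda>v. Re v * Fxx \<eta> + Im v * Fxy \<eta>)) (at \<eta>)"
    "(Fy has_derivative (\<lambda>v. Re v * Fxy \<eta> + Im v * Fyy \<eta>)) (at \<eta>)"
  using assms by (auto simp: twice_differentiable_on_def has_partials_on_def)

lemma smooth_on_has_partials:
  fixes F :: "complex \<Rightarrow> real"
  assumes "smooth_on S F"
  shows "has_partials_on S F (dir_deriv 1 F) (dir_deriv \<i> F)"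
  unfolding has_partials_on_def
proof
  fix \<eta> assume "\<eta> \<in> S"
  note d = smooth_on_has_derivative[OF assms this]
  have "dir_deriv v F \<eta> = Re v * dir_deriv 1 F \<eta> + Im v * dir_deriv \<i> F \<eta>" for v
  proof -
    have "dir_deriv v F \<eta> = dir_deriv (Re v *\<^sub>R 1 + Im v *\<^sub>R \<i>) F \<eta>"
      by (rule arg_cong[where f = "\<lambda>v. dir_deriv v F \<eta>"]) (simp add: complex_eq_iff)
    then show ?thesis
      by (simp only: linear_add[OF has_derivative_linear[OF d]] linear_cmul[OF has_derivative_linear[OF d]]
          real_scaleR_def)
  qed
  then show "(F has_derivative (\<lambda>v. Re v * dir_deriv 1 F \<eta> + Im v * dir_deriv \<i> F \<eta>)) (at \<eta>)"
    by (intro has_derivative_eq_rhs[OF d] ext)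
qed

lemma has_partials_on_cong_derivative:
  assumes "has_partials_on S F Fx Fy" "\<And>\<eta>. \<eta> \<in> S \<Longrightarrow> Fx \<eta> = Gx \<eta>" "\<And>\<eta>. \<eta> \<in> S \<Longrightarrow> Fy \<eta> = Gy \<eta>"
  shows "has_partials_on S F Gx Gy"
  using assms by (simp add: has_partials_on_def)

lemma smooth_on_twice_differentiable:
  fixes F :: "complex \<Rightarrow> real"
  assumes "open S" "smooth_on S F"
  shows "twice_differentiable_on S F (dir_deriv 1 F) (dir_deriv \<i> F)
    (dir_deriv 1 (dir_deriv 1 F)) (dir_deriv \<i> (dir_deriv 1 F)) (dir_deriv \<i> (dir_deriv \<i> F))"
  unfolding twice_differentiable_on_def
  using smooth_on_has_partials[OF assms(2)] smooth_on_has_partials[OF smooth_on_dir_deriv[OF assms(2)]]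
    has_partials_on_cong_derivative[OF smooth_on_has_partials[OF smooth_on_dir_deriv[OF assms(2)]]
      dir_deriv_commute[OF assms]]
  by blast

lemma dir_deriv_partials:
  "has_partials_on S F Fx Fy \<Longrightarrow> \<eta> \<in> S \<Longrightarrow> dir_deriv v F \<eta> = Re v * Fx \<eta> + Im v * Fy \<eta>"
  unfolding has_partials_on_def using dir_deriv_eq by blast

lemma has_partials_on_cong:
  assumes "open S" "\<And>\<eta>. \<eta> \<in> S \<Longrightarrow> f \<eta> = g \<eta>" "has_partials_on S f fx fy"
  shows "has_partials_on S g fx fy"
  unfolding has_partials_on_def
proof
  fix \<eta> assume "\<eta> \<in> S"
  with assms(3) have "(f has_derivative (\<lambda>v. Re v * fx \<eta> + Im v * fy \<eta>)) (at \<eta>)"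
    by (simp add: has_partials_on_def)
  from has_derivative_transform_within_open[OF this assms(1) \<open>\<eta> \<in> S\<close> assms(2)]
  show "(g has_derivative (\<lambda>v. Re v * fx \<eta> + Im v * fy \<eta>)) (at \<eta>)" .
qed

section \<open>An interior gradient estimate\<close>

text \<open>
  The second-order operator whose kernel, in the affine chart \<open>x\<^sub>0 = 1\<close>, consists of the functions with
  homogeneous extension of degree \<open>1\<close> annihilated by the Minkowski wave operator. Its coefficient matrix
  \<open>1 - \<eta> \<eta>\<^sup>T\<close> is positive definite exactly inside the unit disk.
\<close>
definition klein_operator :: "(complex \<Rightarrow> real) \<Rightarrow> (complex \<Rightarrow> real) \<Rightarrow> (complex \<Rightarrow> real) \<Rightarrow> complex \<Rightarrow> real" where
  "klein_operator Fxx Fxy Fyy \<eta> =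
     (1 - (Re \<eta>)\<^sup>2) * Fxx \<eta> - 2 * Re \<eta> * Im \<eta> * Fxy \<eta> + (1 - (Im \<eta>)\<^sup>2) * Fyy \<eta>"

text \<open>
  The gradient is a parameter and the second derivatives are not, since only the former appears in
  the estimates below.
\<close>
definition klein_solution :: "(complex \<Rightarrow> real) \<Rightarrow> (complex \<Rightarrow> real) \<Rightarrow> (complex \<Rightarrow> real) \<Rightarrow> bool" where
  "klein_solution F Fx Fy \<longleftrightarrow> (\<exists>Fxx Fxy Fyy.
     twice_differentiable_on disk F Fx Fy Fxx Fxy Fyy \<and> (\<forall>\<eta>\<in>disk. klein_operator Fxx Fxy Fyy \<eta> = 0))"

lemma twice_differentiable_on_lincomb:
  assumes "twice_differentiable_on S F Fx Fy Fxx Fxy Fyy" "twice_differentiable_on S G Gx Gy Gxx Gxy Gyy"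
  shows "twice_differentiable_on S (\<lambda>\<eta>. a * F \<eta> + b * G \<eta>) (\<lambda>\<eta>. a * Fx \<eta> + b * Gx \<eta>) (\<lambda>\<eta>. a * Fy \<eta> + b * Gy \<eta>)
    (\<lambda>\<eta>. a * Fxx \<eta> + b * Gxx \<eta>) (\<lambda>\<eta>. a * Fxy \<eta> + b * Gxy \<eta>) (\<lambda>\<eta>. a * Fyy \<eta> + b * Gyy \<eta>)"
proof -
  have *: "((\<lambda>\<eta>. a * f \<eta> + b * g \<eta>) has_derivative (\<lambda>v. Re v * (a * fx + b * gx) + Im v * (a * fy + b * gy))) (at \<eta>)"
    if "(f has_derivative (\<lambda>v. Re v * fx + Im v * fy)) (at \<eta>)" "(g has_derivative (\<lambda>v. Re v * gx + Im v * gy)) (at \<eta>)"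
    for f g :: "complex \<Rightarrow> real" and fx fy gx gy \<eta>
    by (rule has_derivative_eq_rhs[OF has_derivative_add[OF has_derivative_mult_right[OF that(1)] has_derivative_mult_right[OF that(2)]]])
       (simp add: fun_eq_iff algebra_simps)
  show ?thesis
    using assms unfolding twice_differentiable_on_def has_partials_on_def by (blast intro: *)
qed

lemma klein_solution_lincomb:
  assumes "klein_solution F Fx Fy" "klein_solution G Gx Gy"
  shows "klein_solution (\<lambda>\<eta>. a * F \<eta> + b * G \<eta>) (\<lambda>\<eta>. a * Fx \<eta> + b * Gx \<eta>) (\<lambda>\<eta>. a * Fy \<eta> + b * Gy \<eta>)"
proof -
  obtain Fxx Fxy Fyy Gxx Gxy Gyy where
    d: "twice_differentiable_on disk F Fx Fy Fxx Fxy Fyy" "twice_differentiable_on disk G Gx Gy Gxx Gxy Gyy"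
    and e: "\<forall>\<eta>\<in>disk. klein_operator Fxx Fxy Fyy \<eta> = 0" "\<forall>\<eta>\<in>disk. klein_operator Gxx Gxy Gyy \<eta> = 0"
    using assms unfolding klein_solution_def by blast
  have "klein_operator (\<lambda>\<eta>. a * Fxx \<eta> + b * Gxx \<eta>) (\<lambda>\<eta>. a * Fxy \<eta> + b * Gxy \<eta>) (\<lambda>\<eta>. a * Fyy \<eta> + b * Gyy \<eta>) \<eta>
      = a * klein_operator Fxx Fxy Fyy \<eta> + b * klein_operator Gxx Gxy Gyy \<eta>" for \<eta>
    by (simp add: klein_operator_def algebra_simps)
  then show ?thesis
    unfolding klein_solution_def using twice_differentiable_on_lincomb[OF d, of a b] e
    by (metis (no_types, lifting) add_0 mult_zero_right)
qed

lemma klein_solution_const: "klein_solution (\<lambda>\<eta>. c) (\<lambda>\<eta>. 0) (\<lambda>\<eta>. 0)"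
  unfolding klein_solution_def
  by (rule exI[of _ "\<lambda>\<eta>. 0"])+ (simp add: twice_differentiable_on_def has_partials_on_def klein_operator_def)

subsection \<open>The maximum principle\<close>

lemma second_derivative_nonneg_at_local_min:
  fixes h :: "real \<Rightarrow> real"
  assumes d: "d > 0" and h: "\<And>t. \<bar>t\<bar> < d \<Longrightarrow> (h has_real_derivative h' t) (at t)"
    and h': "(h' has_real_derivative c) (at 0)" and min: "\<And>t. \<bar>t\<bar> < d \<Longrightarrow> h 0 \<le> h t"
  shows "c \<ge> 0"
proof (rule ccontr)
  assume "\<not> c \<ge> 0"
  then obtain e where e: "e > 0" "\<And>t. 0 < t \<Longrightarrow> t < e \<Longrightarrow> h' t < h' 0"
    using DERIV_neg_dec_right[OF h'] by auto
  have "h' 0 = 0"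
    using DERIV_local_min[OF h[of 0] d] min d by simp
  define s where "s = min d e / 2"
  have s: "0 < s" "s < d" "s < e" using d e by (auto simp: s_def)
  then obtain z where z: "0 < z" "z < s" "h s - h 0 = (s - 0) * h' z"
    using MVT2[of 0 s h h'] h by (metis abs_of_nonneg order_le_less_trans)
  then have "h s < h 0"
    using e(2)[of z] \<open>h' 0 = 0\<close> s by (smt (verit) mult_pos_neg)
  then show False using min[of s] s by auto
qed

lemma hessian_nonneg_at_local_min:
  assumes S: "open S" "q \<in> S" and h: "twice_differentiable_on S h hx hy hxx hxy hyy"
    and min: "\<And>\<eta>. \<eta> \<in> S \<Longrightarrow> h q \<le> h \<eta>"
  shows "0 \<le> hxx q * (Re v)\<^sup>2 + 2 * hxy q * Re v * Im v + hyy q * (Im v)\<^sup>2"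
proof -
  obtain e where e: "e > 0" "ball q e \<subseteq> S" using S open_contains_ball by blast
  define d where "d = e / (norm v + 1)"
  have d: "d > 0" using e by (simp add: d_def add_nonneg_pos)
  have inS: "q + t *\<^sub>R v \<in> S" if "\<bar>t\<bar> < d" for t
  proof -
    have "\<bar>t\<bar> * (norm v + 1) < e" using that by (simp add: d_def pos_less_divide_eq add_nonneg_pos)
    then have "\<bar>t\<bar> * norm v < e" by (simp add: algebra_simps)
    then show ?thesis using e(2) by (auto simp: dist_norm subset_eq)
  qed
  have line: "((\<lambda>t. q + t *\<^sub>R v) has_derivative (\<lambda>s. s *\<^sub>R v)) (at t)" for t
    by (auto intro!: derivative_eq_intros)
  have comp: "((\<lambda>t. f (q + t *\<^sub>R v)) has_real_derivative Re v * a + Im v * b) (at t)"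
    if "(f has_derivative (\<lambda>v. Re v * a + Im v * b)) (at (q + t *\<^sub>R v))" for f :: "complex \<Rightarrow> real" and a b t
    unfolding has_field_derivative_def
    by (rule has_derivative_eq_rhs[OF has_derivative_compose[OF line that]]) (simp add: fun_eq_iff algebra_simps)
  have "0 \<le> Re v * (Re v * hxx q + Im v * hxy q) + Im v * (Re v * hxy q + Im v * hyy q)"
  proof (rule second_derivative_nonneg_at_local_min[OF d])
    show "((\<lambda>t. h (q + t *\<^sub>R v)) has_real_derivative Re v * hx (q + t *\<^sub>R v) + Im v * hy (q + t *\<^sub>R v)) (at t)"
      if "\<bar>t\<bar> < d" for t
      using comp[OF twice_differentiable_onD(1)[OF h inS[OF that]]] .
    have "((\<lambda>t. hx (q + t *\<^sub>R v)) has_real_derivative Re v * hxx q + Im v * hxy q) (at 0)"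
      using comp[of hx _ _ 0] twice_differentiable_onD(2)[OF h S(2)] by simp
    moreover have "((\<lambda>t. hy (q + t *\<^sub>R v)) has_real_derivative Re v * hxy q + Im v * hyy q) (at 0)"
      using comp[of hy _ _ 0] twice_differentiable_onD(3)[OF h S(2)] by simp
    ultimately show "((\<lambda>t. Re v * hx (q + t *\<^sub>R v) + Im v * hy (q + t *\<^sub>R v)) has_real_derivative
        Re v * (Re v * hxx q + Im v * hxy q) + Im v * (Re v * hxy q + Im v * hyy q)) (at 0)"
      by (intro DERIV_add DERIV_cmult)
    show "h (q + 0 *\<^sub>R v) \<le> h (q + t *\<^sub>R v)" if "\<bar>t\<bar> < d" for t
      using min[OF inS[OF that]] by simp
  qed
  then show ?thesis by (simp add: algebra_simps power2_eq_square)
qed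

text \<open>
  At a minimum the Hessian is nonnegative in every direction. Completing the square in the coefficient
  matrix writes the operator as a nonnegative combination of the second derivatives in two directions.
\<close>
lemma klein_operator_nonneg_at_local_min:
  assumes S: "open S" "q \<in> S" and h: "twice_differentiable_on S h hx hy hxx hxy hyy"
    and min: "\<And>\<eta>. \<eta> \<in> S \<Longrightarrow> h q \<le> h \<eta>" and q: "norm q < 1"
  shows "0 \<le> klein_operator hxx hxy hyy q"
proof -
  define x y where "x = Re q" and "y = Im q"
  have xy: "x\<^sup>2 + y\<^sup>2 < 1"
    using q by (simp add: x_def y_def cmod_power2[symmetric] abs_square_less_1)
  then have x: "1 - x\<^sup>2 > 0" by (smt (verit) zero_le_power2)
  \<comment> \<open>The first direction is \<open>(k, - x y)\<close>, the first row of the coefficient matrix; the second is \<open>\<i>\<close>.\<close>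
  define k where "k = 1 - x\<^sup>2"
  note H = hessian_nonneg_at_local_min[OF S h min]
  have "0 \<le> hxx q * k\<^sup>2 - 2 * hxy q * k * x * y + hyy q * x\<^sup>2 * y\<^sup>2"
    using H[of "Complex k (- (x * y))"] by (simp add: power_mult_distrib mult.assoc)
  moreover have "0 \<le> (1 - x\<^sup>2 - y\<^sup>2) * hyy q" using H[of \<i>] xy by simp
  ultimately have "0 \<le> (hxx q * k\<^sup>2 - 2 * hxy q * k * x * y + hyy q * x\<^sup>2 * y\<^sup>2) + (1 - x\<^sup>2 - y\<^sup>2) * hyy q"
    by linarith
  also have "\<dots> = k * klein_operator hxx hxy hyy q"
    by (simp add: klein_operator_def k_def x_def y_def algebra_simps power2_eq_square)
  finally show ?thesis using x by (simp add: k_def zero_le_mult_iff)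
qed

text \<open>
  The barrier \<open>b = x - x\<^sup>2 + y\<^sup>2 / 2\<close> is a strict supersolution where \<open>x\<^sup>2 + y\<^sup>2 < 1/4\<close>, because the operator
  maps it to \<open>- 1 + 2 x\<^sup>2 - y\<^sup>2\<close>. It is nonnegative on the diameter \<open>x = 0\<close>, where \<open>G\<close> vanishes, and at
  least \<open>1/8\<close> on the half circle. So \<open>K b - G\<close> has no negative minimum.
\<close>
lemma half_disk_barrier:
  assumes sol: "klein_solution G Gx Gy" and K: "K > 0" and odd: "\<And>y. G (Complex 0 y) = 0"
    and bound: "\<And>\<eta>. norm \<eta> = 1/2 \<Longrightarrow> G \<eta> \<le> K / 8"
    and \<eta>: "norm \<eta> \<le> 1/2" "0 \<le> Re \<eta>"
  shows "G \<eta> \<le> K * (Re \<eta> - (Re \<eta>)\<^sup>2 + (Im \<eta>)\<^sup>2 / 2)"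
proof -
  obtain Gxx Gxy Gyy where d: "twice_differentiable_on disk G Gx Gy Gxx Gxy Gyy"
    and e: "\<forall>\<eta>\<in>disk. klein_operator Gxx Gxy Gyy \<eta> = 0"
    using sol unfolding klein_solution_def by blast
  define b where "b \<eta> = Re \<eta> - (Re \<eta>)\<^sup>2 + (Im \<eta>)\<^sup>2 / 2" for \<eta>
  have "twice_differentiable_on disk b (\<lambda>\<eta>. 1 - 2 * Re \<eta>) Im (\<lambda>_. - 2) (\<lambda>_. 0) (\<lambda>_. 1)"
    unfolding twice_differentiable_on_def has_partials_on_def b_def
    by (auto intro!: derivative_eq_intros simp: fun_eq_iff algebra_simps)
  note dh = twice_differentiable_on_lincomb[OF this d, of K "-1"]
  define h where "h = (\<lambda>\<eta>. K * b \<eta> + - 1 * G \<eta>)"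
  define T where "T = cball 0 (1/2) \<inter> {\<eta>. 0 \<le> Re \<eta>}"
  have T: "compact T" unfolding T_def
    by (intro compact_Int_closed compact_cball closed_halfspace_Re_ge)
  have sub: "T \<subseteq> disk" by (auto simp: T_def)
  have cont: "continuous_on T h"
    unfolding h_def
    using has_derivative_continuous[OF twice_differentiable_onD(1)[OF dh subsetD[OF sub]]]
    by (intro continuous_at_imp_continuous_on) blast
  have "\<eta> \<in> T" using \<eta> by (simp add: T_def)
  obtain q where q: "q \<in> T" "\<And>\<zeta>. \<zeta> \<in> T \<Longrightarrow> h q \<le> h \<zeta>"
    using continuous_attains_inf[OF T _ cont] \<open>\<eta> \<in> T\<close> by blast
  have "h q \<ge> 0"
  proof (rule ccontr)
    assume neg: "\<not> h q \<ge> 0"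
    have "Re q \<noteq> 0"
    proof
      assume "Re q = 0"
      then have "G q = 0" using odd[of "Im q"] by (metis complex_surj)
      then show False using neg K \<open>Re q = 0\<close> by (simp add: h_def b_def)
    qed
    then have re: "Re q > 0" using q(1) by (simp add: T_def)
    have "norm q \<noteq> 1/2"
    proof
      assume n: "norm q = 1/2"
      have "(norm q)\<^sup>2 = 1/4" by (simp add: n power2_eq_square)
      then have n2: "(Re q)\<^sup>2 + (Im q)\<^sup>2 = 1/4" by (simp add: cmod_power2)
      have "Re q \<le> 1/2" using complex_Re_le_cmod[of q] n by simp
      have "Re q * (1/2 - Re q) \<ge> 0" using re \<open>Re q \<le> 1/2\<close> by simp
      then have "(Re q)\<^sup>2 \<le> Re q / 2" by (simp add: power2_eq_square algebra_simps)
      then have "b q \<ge> 1/8" using n2 \<open>Re q \<le> 1/2\<close> re unfolding b_def by linarith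
      then have "K * b q \<ge> K * (1/8)" using K by (intro mult_left_mono) auto
      then show False using neg bound[OF n] by (simp add: h_def)
    qed
    then have nq: "norm q < 1/2" using q(1) by (simp add: T_def)
    define S where "S = ball 0 (1/2) \<inter> {\<eta>::complex. 0 < Re \<eta>}"
    have S: "open S" "q \<in> S" "S \<subseteq> T" "S \<subseteq> disk"
      using re nq by (auto simp: S_def T_def open_halfspace_Re_gt intro!: open_Int)
    have "0 \<le> klein_operator (\<lambda>\<eta>. K * - 2 + - 1 * Gxx \<eta>) (\<lambda>\<eta>. K * 0 + - 1 * Gxy \<eta>) (\<lambda>\<eta>. K * 1 + - 1 * Gyy \<eta>) q"
    proof (rule klein_operator_nonneg_at_local_min[OF S(1,2)])
      show "twice_differentiable_on S h (\<lambda>\<eta>. K * (1 - 2 * Re \<eta>) + - 1 * Gx \<eta>) (\<lambda>\<eta>. K * Im \<eta> + - 1 * Gy \<eta>)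
          (\<lambda>\<eta>. K * - 2 + - 1 * Gxx \<eta>) (\<lambda>\<eta>. K * 0 + - 1 * Gxy \<eta>) (\<lambda>\<eta>. K * 1 + - 1 * Gyy \<eta>)"
        using dh S(4) unfolding h_def twice_differentiable_on_def has_partials_on_def by blast
      show "h q \<le> h \<eta>" if "\<eta> \<in> S" for \<eta> using q(2) S(3) that by blast
      show "norm q < 1" using nq by simp
    qed
    also have "\<dots> = K * (- 1 + 2 * (Re q)\<^sup>2 - (Im q)\<^sup>2) - klein_operator Gxx Gxy Gyy q"
      by (simp add: klein_operator_def algebra_simps)
    also have "\<dots> = K * (- 1 + 2 * (Re q)\<^sup>2 - (Im q)\<^sup>2)" using e S by auto
    finally have "0 \<le> - 1 + 2 * (Re q)\<^sup>2 - (Im q)\<^sup>2" using K by (simp add: zero_le_mult_iff)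
    moreover have "(norm q)\<^sup>2 < (1/2)\<^sup>2" using nq by (intro power_strict_mono) auto
    then have "(Re q)\<^sup>2 + (Im q)\<^sup>2 < 1/4" by (simp add: cmod_power2 power_divide)
    ultimately show False using zero_le_power2[of "Im q"] by linarith
  qed
  then have "h \<eta> \<ge> 0" using q(2)[OF \<open>\<eta> \<in> T\<close>] by simp
  then show ?thesis by (simp add: h_def b_def)
qed

subsection \<open>Invariance under Lorentz transformations\<close>

text \<open>
  The linear map that sends the standard basis to the vectors \<open>(c, p)\<close>, \<open>(a1, w1)\<close>, \<open>(a2, w2)\<close> is, by the
  assumptions \<open>frame\<close> and for \<open>\<kappa> > 0\<close>, \<open>sqrt \<kappa>\<close> times a Lorentz transformation. It carries \<open>(1, \<eta>)\<close> to
  \<open>D \<eta> (1, Z \<eta>)\<close>, so that \<open>D \<eta> * F (Z \<eta>)\<close> is the value at \<open>(1, \<eta>)\<close> of the transformed homogeneous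
  extension of \<open>F\<close>.

  The second derivatives of the new function are the Hessian of \<open>F\<close>, divided by \<open>D\<close>, on the vectors
  \<open>W\<^sub>i = w\<^sub>i - a\<^sub>i Z\<close>, which have the coordinates \<open>(A\<^sub>i, B\<^sub>i)\<close> below. The equation then follows from
  \<open>W\<^sub>1 W\<^sub>1\<^sup>T + W\<^sub>2 W\<^sub>2\<^sup>T - (c Z - p) (c Z - p)\<^sup>T = \<kappa> (1 - Z Z\<^sup>T)\<close>.
\<close>
lemma klein_solution_lorentz:
  fixes c a1 a2 \<kappa> :: real and p w1 w2 :: complex and D :: "complex \<Rightarrow> real" and Z :: "complex \<Rightarrow> complex"
  assumes sol: "klein_solution F Fx Fy"
    and D: "\<And>\<eta>. D \<eta> = c + Re \<eta> * a1 + Im \<eta> * a2"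
    and Z: "\<And>\<eta>. Z \<eta> = (p + Re \<eta> *\<^sub>R w1 + Im \<eta> *\<^sub>R w2) /\<^sub>R D \<eta>"
    and pos: "\<And>\<eta>. \<eta> \<in> disk \<Longrightarrow> D \<eta> > 0" and disk: "\<And>\<eta>. \<eta> \<in> disk \<Longrightarrow> Z \<eta> \<in> disk"
    and frame: "a1\<^sup>2 + a2\<^sup>2 - c\<^sup>2 = - \<kappa>" "a1 *\<^sub>R w1 + a2 *\<^sub>R w2 = c *\<^sub>R p"
      "(Re w1)\<^sup>2 + (Re w2)\<^sup>2 - (Re p)\<^sup>2 = \<kappa>" "(Im w1)\<^sup>2 + (Im w2)\<^sup>2 - (Im p)\<^sup>2 = \<kappa>"
      "Re w1 * Im w1 + Re w2 * Im w2 = Re p * Im p"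
  shows "klein_solution (\<lambda>\<eta>. D \<eta> * F (Z \<eta>))
      (\<lambda>\<eta>. a1 * F (Z \<eta>) + Fx (Z \<eta>) * (Re w1 - a1 * Re (Z \<eta>)) + Fy (Z \<eta>) * (Im w1 - a1 * Im (Z \<eta>)))
      (\<lambda>\<eta>. a2 * F (Z \<eta>) + Fx (Z \<eta>) * (Re w2 - a2 * Re (Z \<eta>)) + Fy (Z \<eta>) * (Im w2 - a2 * Im (Z \<eta>)))"
proof -
  obtain Fxx Fxy Fyy where d: "twice_differentiable_on disk F Fx Fy Fxx Fxy Fyy"
    and e: "\<forall>\<eta>\<in>disk. klein_operator Fxx Fxy Fyy \<eta> = 0"
    using sol unfolding klein_solution_def by blast
  define A1 A2 B1 B2 where "A1 \<eta> = Re w1 - a1 * Re (Z \<eta>)" and "A2 \<eta> = Re w2 - a2 * Re (Z \<eta>)"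
    and "B1 \<eta> = Im w1 - a1 * Im (Z \<eta>)" and "B2 \<eta> = Im w2 - a2 * Im (Z \<eta>)" for \<eta>
  note AB = A1_def A2_def B1_def B2_def
  define Gxx where "Gxx \<eta> = (Fxx (Z \<eta>) * (A1 \<eta>)\<^sup>2 + 2 * Fxy (Z \<eta>) * A1 \<eta> * B1 \<eta> + Fyy (Z \<eta>) * (B1 \<eta>)\<^sup>2) / D \<eta>" for \<eta>
  define Gxy where "Gxy \<eta> = (Fxx (Z \<eta>) * A1 \<eta> * A2 \<eta> + Fxy (Z \<eta>) * (A1 \<eta> * B2 \<eta> + A2 \<eta> * B1 \<eta>) + Fyy (Z \<eta>) * B1 \<eta> * B2 \<eta>) / D \<eta>" for \<eta>
  define Gyy where "Gyy \<eta> = (Fxx (Z \<eta>) * (A2 \<eta>)\<^sup>2 + 2 * Fxy (Z \<eta>) * A2 \<eta> * B2 \<eta> + Fyy (Z \<eta>) * (B2 \<eta>)\<^sup>2) / D \<eta>" for \<eta>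
  have dD: "(D has_derivative (\<lambda>v. Re v * a1 + Im v * a2)) (at \<eta>)" for \<eta>
    unfolding D[abs_def] by (auto intro!: derivative_eq_intros)
  define ZR ZI where "ZR \<eta> v = (Re v * A1 \<eta> + Im v * A2 \<eta>) / D \<eta>"
    and "ZI \<eta> v = (Re v * B1 \<eta> + Im v * B2 \<eta>) / D \<eta>" for \<eta> v
  have RZ: "Re (Z \<eta>) = (Re p + Re \<eta> * Re w1 + Im \<eta> * Re w2) / D \<eta>"
    and IZ: "Im (Z \<eta>) = (Im p + Re \<eta> * Im w1 + Im \<eta> * Im w2) / D \<eta>" for \<eta>
    by (simp_all add: Z divide_inverse mult.commute)
  have dRZ: "((\<lambda>\<eta>. Re (Z \<eta>)) has_derivative ZR \<eta>) (at \<eta>)"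
    and dIZ: "((\<lambda>\<eta>. Im (Z \<eta>)) has_derivative ZI \<eta>) (at \<eta>)" if "\<eta> \<in> disk" for \<eta>
  proof -
    have D0: "D \<eta> \<noteq> 0" using pos[OF that] by simp
    show "((\<lambda>\<eta>. Re (Z \<eta>)) has_derivative ZR \<eta>) (at \<eta>)" unfolding RZ ZR_def[abs_def] AB
      by (rule derivative_eq_intros dD D0 refl | simp)+ (use D0 in \<open>simp add: fun_eq_iff field_simps\<close>)
    show "((\<lambda>\<eta>. Im (Z \<eta>)) has_derivative ZI \<eta>) (at \<eta>)" unfolding IZ ZI_def[abs_def] AB
      by (rule derivative_eq_intros dD D0 refl | simp)+ (use D0 in \<open>simp add: fun_eq_iff field_simps\<close>)
  qed
  have dZ: "(Z has_derivative (\<lambda>v. Complex (ZR \<eta> v) (ZI \<eta> v))) (at \<eta>)" if "\<eta> \<in> disk" for \<eta>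
    using Complex_has_derivative[OF dRZ[OF that] dIZ[OF that]] by simp
  have comp: "((\<lambda>\<eta>. f (Z \<eta>)) has_derivative (\<lambda>v. ZR \<eta> v * fx + ZI \<eta> v * fy)) (at \<eta>)"
    if "(f has_derivative (\<lambda>v. Re v * fx + Im v * fy)) (at (Z \<eta>))" "\<eta> \<in> disk" for f :: "complex \<Rightarrow> real" and fx fy \<eta>
    using has_derivative_compose[OF dZ[OF that(2)] that(1)] by simp
  have "twice_differentiable_on disk (\<lambda>\<eta>. D \<eta> * F (Z \<eta>))
      (\<lambda>\<eta>. a1 * F (Z \<eta>) + Fx (Z \<eta>) * A1 \<eta> + Fy (Z \<eta>) * B1 \<eta>)
      (\<lambda>\<eta>. a2 * F (Z \<eta>) + Fx (Z \<eta>) * A2 \<eta> + Fy (Z \<eta>) * B2 \<eta>) Gxx Gxy Gyy"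
    unfolding twice_differentiable_on_def has_partials_on_def
  proof (intro ballI conjI)
    fix \<eta> :: complex assume \<eta>: "\<eta> \<in> disk"
    have D0: "D \<eta> \<noteq> 0" using pos[OF \<eta>] by simp
    note dF = comp[OF twice_differentiable_onD(1)[OF d disk[OF \<eta>]] \<eta>]
      comp[OF twice_differentiable_onD(2)[OF d disk[OF \<eta>]] \<eta>]
      comp[OF twice_differentiable_onD(3)[OF d disk[OF \<eta>]] \<eta>] dRZ[OF \<eta>] dIZ[OF \<eta>]
    show "((\<lambda>\<eta>. D \<eta> * F (Z \<eta>)) has_derivative
        (\<lambda>v. Re v * (a1 * F (Z \<eta>) + Fx (Z \<eta>) * A1 \<eta> + Fy (Z \<eta>) * B1 \<eta>)
           + Im v * (a2 * F (Z \<eta>) + Fx (Z \<eta>) * A2 \<eta> + Fy (Z \<eta>) * B2 \<eta>))) (at \<eta>)"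
      by (rule derivative_eq_intros dD dF refl)+
         (use D0 in \<open>simp add: fun_eq_iff ZR_def ZI_def field_simps\<close>)
    show "((\<lambda>\<eta>. a1 * F (Z \<eta>) + Fx (Z \<eta>) * A1 \<eta> + Fy (Z \<eta>) * B1 \<eta>) has_derivative
        (\<lambda>v. Re v * Gxx \<eta> + Im v * Gxy \<eta>)) (at \<eta>)"
      unfolding A1_def B1_def
      by (rule derivative_eq_intros dF refl)+
         (use D0 in \<open>simp add: fun_eq_iff ZR_def ZI_def Gxx_def Gxy_def A1_def[symmetric] B1_def[symmetric],
          simp add: field_simps power2_eq_square\<close>)
    show "((\<lambda>\<eta>. a2 * F (Z \<eta>) + Fx (Z \<eta>) * A2 \<eta> + Fy (Z \<eta>) * B2 \<eta>) has_derivative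
        (\<lambda>v. Re v * Gxy \<eta> + Im v * Gyy \<eta>)) (at \<eta>)"
      unfolding A2_def B2_def
      by (rule derivative_eq_intros dF refl)+
         (use D0 in \<open>simp add: fun_eq_iff ZR_def ZI_def Gyy_def Gxy_def A2_def[symmetric] B2_def[symmetric],
          simp add: field_simps power2_eq_square\<close>)
  qed
  moreover have "klein_operator Gxx Gxy Gyy \<eta> = 0" if \<eta>: "\<eta> \<in> disk" for \<eta>
  proof -
    have D0: "D \<eta> \<noteq> 0" using pos[OF \<eta>] by simp
    define X Y x y where "X = Re (Z \<eta>)" and "Y = Im (Z \<eta>)" and "x = Re \<eta>" and "y = Im \<eta>"
    have ND: "D \<eta> * X = Re p + x * Re w1 + y * Re w2" "D \<eta> * Y = Im p + x * Im w1 + y * Im w2"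
      using D0 by (simp_all add: X_def Y_def x_def y_def RZ IZ)
    \<comment> \<open>The image of \<open>\<eta>\<close> under the frame is proportional to \<open>(1, Z)\<close>, hence \<open>x W\<^sub>1 + y W\<^sub>2 = c Z - p\<close>.\<close>
    then have lin: "x * A1 \<eta> + y * A2 \<eta> = c * X - Re p" "x * B1 \<eta> + y * B2 \<eta> = c * Y - Im p"
      unfolding AB X_def[symmetric] Y_def[symmetric]
      by (simp_all add: D x_def[symmetric] y_def[symmetric] algebra_simps)
    have fr: "a1 * Re w1 + a2 * Re w2 = c * Re p" "a1 * Im w1 + a2 * Im w2 = c * Im p"
      using arg_cong[OF frame(2), of Re] arg_cong[OF frame(2), of Im] by simp_all
    have t: "(A1 \<eta>)\<^sup>2 + (A2 \<eta>)\<^sup>2 - (c * X - Re p)\<^sup>2 = \<kappa> * (1 - X\<^sup>2)"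
      "(B1 \<eta>)\<^sup>2 + (B2 \<eta>)\<^sup>2 - (c * Y - Im p)\<^sup>2 = \<kappa> * (1 - Y\<^sup>2)"
      "A1 \<eta> * B1 \<eta> + A2 \<eta> * B2 \<eta> - (c * X - Re p) * (c * Y - Im p) = - \<kappa> * X * Y"
      unfolding AB X_def[symmetric] Y_def[symmetric] using frame(1,3,4,5) fr by algebra+
    have "D \<eta> * klein_operator Gxx Gxy Gyy \<eta> =
      Fxx (Z \<eta>) * ((A1 \<eta>)\<^sup>2 + (A2 \<eta>)\<^sup>2 - (x * A1 \<eta> + y * A2 \<eta>)\<^sup>2)
      + 2 * Fxy (Z \<eta>) * (A1 \<eta> * B1 \<eta> + A2 \<eta> * B2 \<eta> - (x * A1 \<eta> + y * A2 \<eta>) * (x * B1 \<eta> + y * B2 \<eta>))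
      + Fyy (Z \<eta>) * ((B1 \<eta>)\<^sup>2 + (B2 \<eta>)\<^sup>2 - (x * B1 \<eta> + y * B2 \<eta>)\<^sup>2)"
      using D0 unfolding klein_operator_def Gxx_def Gxy_def Gyy_def x_def[symmetric] y_def[symmetric]
      by (simp add: field_simps power2_eq_square)
    also have "\<dots> = \<kappa> * klein_operator Fxx Fxy Fyy (Z \<eta>)"
      unfolding lin t klein_operator_def X_def[symmetric] Y_def[symmetric] by (simp add: algebra_simps)
    finally show ?thesis using e disk[OF \<eta>] D0 by simp
  qed
  ultimately show ?thesis unfolding klein_solution_def AB by blast
qed

text \<open>
  The reflection \<open>R\<close> in the axis \<open>x = 0\<close> is a Lorentz transformation, so \<open>F - F \<circ> R\<close> is a solution which
  vanishes on that axis, is at most \<open>2 M\<close>, and has twice the normal derivative of \<open>F\<close> at the origin.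
  The barrier with slope \<open>16 M\<close> bounds that derivative.
\<close>
lemma gradient_estimate_origin_upper:
  assumes sol: "klein_solution F Fx Fy" and M: "M > 0"
    and bound: "\<And>\<eta>. norm \<eta> \<le> 1/2 \<Longrightarrow> \<bar>F \<eta>\<bar> \<le> M"
  shows "Fx 0 \<le> 8 * M"
proof -
  define R where "R \<eta> = (0 + Re \<eta> *\<^sub>R (- 1) + Im \<eta> *\<^sub>R \<i>) /\<^sub>R 1" for \<eta>
  have R: "norm (R \<eta>) = norm \<eta>" for \<eta> by (simp add: R_def cmod_def)
  have "klein_solution (\<lambda>\<eta>. 1 * F (R \<eta>))
      (\<lambda>\<eta>. 0 * F (R \<eta>) + Fx (R \<eta>) * (Re (- 1) - 0 * Re (R \<eta>)) + Fy (R \<eta>) * (Im (- 1) - 0 * Im (R \<eta>)))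
      (\<lambda>\<eta>. 0 * F (R \<eta>) + Fx (R \<eta>) * (Re \<i> - 0 * Re (R \<eta>)) + Fy (R \<eta>) * (Im \<i> - 0 * Im (R \<eta>)))"
    by (rule klein_solution_lorentz[OF sol, where c = 1 and \<kappa> = 1 and p = 0]) (simp_all add: R, simp add: R_def)
  from klein_solution_lincomb[OF sol this, of 1 "-1"]
  have "klein_solution (\<lambda>\<eta>. F \<eta> - F (R \<eta>)) (\<lambda>\<eta>. Fx \<eta> + Fx (R \<eta>)) (\<lambda>\<eta>. Fy \<eta> - Fy (R \<eta>))" by simp
  note G = this
  have R1: "R (Complex 0 y) = Complex 0 y" for y by (simp add: R_def complex_eq_iff)
  have diff: "F \<eta> - F (R \<eta>) \<le> 16 * M / 8" if "norm \<eta> = 1/2" for \<eta>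
    using bound[of \<eta>] bound[of "R \<eta>"] that by (simp add: R abs_le_iff)
  have bar: "F \<eta> - F (R \<eta>) \<le> 16 * M * (Re \<eta> - (Re \<eta>)\<^sup>2 + (Im \<eta>)\<^sup>2 / 2)" if "norm \<eta> \<le> 1/2" "0 \<le> Re \<eta>" for \<eta>
    using half_disk_barrier[OF G, of "16 * M", OF _ _ diff that] M by (simp add: R1)
  define k where "k t = 16 * M * t - (F (complex_of_real t) - F (R (complex_of_real t)))" for t
  have k0: "k 0 = 0" by (simp add: k_def R_def)
  have kpos: "k t \<ge> 0" if "0 < t" "t < 1/2" for t
  proof -
    have "F t - F (R t) \<le> 16 * M * (t - t\<^sup>2)" using bar[of "complex_of_real t"] that by simp
    also have "\<dots> \<le> 16 * M * t" using M by (intro mult_left_mono) auto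
    finally show ?thesis by (simp add: k_def)
  qed
  have "((\<lambda>\<eta>. F \<eta> - F (R \<eta>)) has_derivative (\<lambda>v. Re v * (Fx 0 + Fx (R 0)) + Im v * (Fy 0 - Fy (R 0)))) (at (complex_of_real 0))"
    using G unfolding klein_solution_def twice_differentiable_on_def has_partials_on_def by auto
  then have "((\<lambda>t. F (complex_of_real t) - F (R (complex_of_real t))) has_derivative (\<lambda>t. t * (2 * Fx 0))) (at 0)"
    using has_derivative_compose[OF has_derivative_of_real[OF has_derivative_ident]] by (fastforce simp: R_def)
  then have "((\<lambda>t. F (complex_of_real t) - F (R (complex_of_real t))) has_real_derivative 2 * Fx 0) (at 0)"
    by (simp add: has_field_derivative_def mult.commute[of _ "2 * Fx 0"])
  then have dk: "(k has_real_derivative (16 * M - 2 * Fx 0)) (at 0)"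
    unfolding k_def by (rule DERIV_diff[OF DERIV_cmult_Id])
  show ?thesis
  proof (rule ccontr)
    assume "\<not> ?thesis"
    then have "16 * M - 2 * Fx 0 < 0" by simp
    from DERIV_neg_dec_right[OF dk this] obtain d where "d > 0" "\<And>t. 0 < t \<Longrightarrow> t < d \<Longrightarrow> k t < 0"
      using k0 by auto
    then show False using kpos[of "min d (1/2) / 2"] by (smt (verit) field_sum_of_halves)
  qed
qed

lemma gradient_estimate_origin:
  assumes sol: "klein_solution F Fx Fy" and M: "M > 0"
    and bound: "\<And>\<eta>. norm \<eta> \<le> 1/2 \<Longrightarrow> \<bar>F \<eta>\<bar> \<le> M"
  shows "\<bar>Fx 0\<bar> \<le> 8 * M" "\<bar>Fy 0\<bar> \<le> 8 * M"
proof -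
  have *: "\<bar>Gx 0\<bar> \<le> 8 * M" if "klein_solution G Gx Gy" "\<And>\<eta>. norm \<eta> \<le> 1/2 \<Longrightarrow> \<bar>G \<eta>\<bar> \<le> M" for G Gx Gy
    using gradient_estimate_origin_upper[OF that(1) M that(2)]
      gradient_estimate_origin_upper[OF klein_solution_lincomb[OF that(1,1), of "-1" 0] M] that(2)
    by (auto simp: abs_le_iff)
  show "\<bar>Fx 0\<bar> \<le> 8 * M" by (rule *[OF sol bound])
  \<comment> \<open>Exchanging the coordinates turns the bound on \<open>Fx\<close> into one on \<open>Fy\<close>.\<close>
  define R where "R \<eta> = (0 + Re \<eta> *\<^sub>R \<i> + Im \<eta> *\<^sub>R 1) /\<^sub>R 1" for \<eta>
  have R: "norm (R \<eta>) = norm \<eta>" for \<eta> by (simp add: R_def cmod_def add.commute)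
  have "klein_solution (\<lambda>\<eta>. 1 * F (R \<eta>))
      (\<lambda>\<eta>. 0 * F (R \<eta>) + Fx (R \<eta>) * (Re \<i> - 0 * Re (R \<eta>)) + Fy (R \<eta>) * (Im \<i> - 0 * Im (R \<eta>)))
      (\<lambda>\<eta>. 0 * F (R \<eta>) + Fx (R \<eta>) * (Re 1 - 0 * Re (R \<eta>)) + Fy (R \<eta>) * (Im 1 - 0 * Im (R \<eta>)))"
    by (rule klein_solution_lorentz[OF sol, where c = 1 and \<kappa> = 1 and p = 0]) (simp_all add: R, simp add: R_def)
  from *[OF this] bound show "\<bar>Fy 0\<bar> \<le> 8 * M" by (simp add: R) (simp add: R_def)
qed

section \<open>The hyperbolic plane in the Klein chart\<close>

text \<open>
  This is \<open>x\<^sub>0\<^sup>2\<close> at the point of the hyperboloid over \<open>\<eta>\<close>. The coefficients of the metric and of its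
  connection are polynomials in it and in inner products, so that most identities below reduce to
  ring arithmetic.
\<close>
definition klein_factor :: "complex \<Rightarrow> real" where
  "klein_factor \<eta> = 1 / (1 - \<eta> \<bullet> \<eta>)"

text \<open>
  The coordinate \<open>x\<^sub>0\<close> of \<open>klein_inv \<eta>\<close>.
\<close>
definition height :: "complex \<Rightarrow> real" where
  "height \<eta> = 1 / sqrt (1 - \<eta> \<bullet> \<eta>)"

lemma disk_inner: "\<eta> \<in> disk \<Longrightarrow> \<eta> \<bullet> \<eta> < 1"
  by (simp add: dot_square_norm abs_square_less_1)

lemma inner_eq_coords: "(a::complex) \<bullet> b = Re a * Re b + Im a * Im b"
  by (simp add: inner_complex_def)

lemma
  assumes "\<eta> \<in> disk"
  shows height_pos: "height \<eta> > 0" and height_squared: "(height \<eta>)\<^sup>2 = klein_factor \<eta>"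
    and height_squared_mult: "(height \<eta>)\<^sup>2 * (1 - \<eta> \<bullet> \<eta>) = 1"
    and klein_factor_mult: "klein_factor \<eta> * (1 - \<eta> \<bullet> \<eta>) = 1"
    and klein_factor_pos: "klein_factor \<eta> > 0"
  using disk_inner[OF assms] by (auto simp: height_def klein_factor_def power_divide)

lemma one_minus_inner_has_derivative:
  "((\<lambda>\<eta>::complex. 1 - \<eta> \<bullet> \<eta>) has_derivative (\<lambda>v. - 2 * (\<eta> \<bullet> v))) (at \<eta>)"
  by (auto intro!: derivative_eq_intros simp: inner_commute)

lemma klein_factor_has_derivative:
  assumes "\<eta> \<in> disk"
  shows "(klein_factor has_derivative (\<lambda>v. 2 * (\<eta> \<bullet> v) * (klein_factor \<eta>)\<^sup>2)) (at \<eta>)"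
proof -
  have "1 - \<eta> \<bullet> \<eta> \<noteq> 0" using disk_inner[OF assms] by simp
  from has_derivative_divide[OF has_derivative_const one_minus_inner_has_derivative this]
  show ?thesis
    unfolding klein_factor_def[abs_def]
    by (rule has_derivative_eq_rhs) (simp add: fun_eq_iff power2_eq_square divide_inverse)
qed

lemma height_has_derivative:
  assumes "\<eta> \<in> disk"
  shows "(height has_derivative (\<lambda>v. (\<eta> \<bullet> v) * (height \<eta>) ^ 3)) (at \<eta>)"
proof -
  have "((\<lambda>s. 1 / sqrt s) has_real_derivative - ((1 / sqrt s) ^ 3 / 2)) (at s)" if "s > 0" for s
    using that by (auto intro!: derivative_eq_intros simp: field_simps power3_eq_cube)
  from this[of "1 - \<eta> \<bullet> \<eta>"] disk_inner[OF assms]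
  have "((\<lambda>s. 1 / sqrt s) has_derivative (*) (- ((1 / sqrt (1 - \<eta> \<bullet> \<eta>)) ^ 3 / 2))) (at (1 - \<eta> \<bullet> \<eta>))"
    unfolding has_field_derivative_def by simp
  from has_derivative_compose[OF one_minus_inner_has_derivative this] show ?thesis
    unfolding height_def[abs_def] by (rule has_derivative_eq_rhs) (simp add: fun_eq_iff)
qed

lemma klein_inv_eq: "klein_inv \<eta> = height \<eta> *\<^sub>R vector [1, Re \<eta>, Im \<eta>]"
  by (simp add: klein_inv_def height_def dot_square_norm)

lemma klein_inv_has_derivative:
  assumes "\<eta> \<in> disk"
  shows "(klein_inv has_derivative (\<lambda>a. ((\<eta> \<bullet> a) * (height \<eta>) ^ 3) *\<^sub>R vector [1, Re \<eta>, Im \<eta>]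
           + height \<eta> *\<^sub>R vector [0, Re a, Im a])) (at \<eta>)"
proof -
  have v: "vector [x, y, z] = x *\<^sub>R axis 1 1 + y *\<^sub>R axis 2 1 + z *\<^sub>R (axis 3 1 :: real^3)" for x y z
    by (simp add: vec_eq_iff forall_3 axis_def)
  show ?thesis
    unfolding klein_inv_eq[abs_def] v
    by (rule derivative_eq_intros height_has_derivative[OF assms] refl)+
       (simp add: fun_eq_iff algebra_simps)
qed

lemmas klein_inv_derivative = frechet_derivative_at[OF klein_inv_has_derivative, symmetric]

lemma klein_has_derivative:
  assumes "p$1 \<noteq> 0"
  shows "(klein has_derivative
           (\<lambda>v. Complex ((v$2 - v$1 * (p$2 / p$1)) / p$1) ((v$3 - v$1 * (p$3 / p$1)) / p$1))) (at p)"
proof -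
  have nth: "((\<lambda>x. x $ i) has_derivative (\<lambda>v. v $ i)) (at p)" for i :: 3
    by (rule bounded_linear_imp_has_derivative[OF bounded_linear_vec_nth])
  have "((\<lambda>x. x$i / x$1) has_derivative (\<lambda>v. (v$i - v$1 * (p$i / p$1)) / p$1)) (at p)" for i
    by (rule has_derivative_eq_rhs[OF has_derivative_divide[OF nth nth assms]])
       (use assms in \<open>simp add: fun_eq_iff field_simps\<close>)
  from this[of 2] this[of 3] show ?thesis
    by (subst has_derivative_componentwise_within)
       (simp add: Basis_complex_def inner_complex_def klein_def)
qed

lemmas klein_derivative = frechet_derivative_at[OF klein_has_derivative, symmetric]

subsection \<open>The metric and its Levi-Civita connection\<close>

lemma hyp_metric_eq:
  assumes "\<eta> \<in> disk"
  shows "hyp_metric \<eta> a b = klein_factor \<eta> * (a \<bullet> b) + (klein_factor \<eta>)\<^sup>2 * (\<eta> \<bullet> a) * (\<eta> \<bullet> b)"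
proof -
  define h where "h = height \<eta>"
  have h: "h\<^sup>2 * (1 - \<eta> \<bullet> \<eta>) = 1" using height_squared_mult[OF assms] by (simp add: h_def)
  have "hyp_metric \<eta> a b = h\<^sup>2 * (a \<bullet> b) + 2 * h ^ 4 * (\<eta> \<bullet> a) * (\<eta> \<bullet> b)
      - h ^ 4 * (h\<^sup>2 * (1 - \<eta> \<bullet> \<eta>)) * (\<eta> \<bullet> a) * (\<eta> \<bullet> b)"
    unfolding hyp_metric_def klein_inv_derivative[OF assms] h_def[symmetric]
    by (simp add: mink_def inner_eq_coords algebra_simps power2_eq_square power3_eq_cube power4_eq_xxxx)
  then show ?thesis unfolding h height_squared[OF assms, symmetric] h_def[symmetric]
    by (simp add: algebra_simps)
qed

lemma bilinear_hyp_metric: "\<eta> \<in> disk \<Longrightarrow> bilinear (hyp_metric \<eta>)"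
  by (auto simp: bilinear_def hyp_metric_eq algebra_simps inner_simps intro!: linearI)

lemma hyp_metric_commute: "\<eta> \<in> disk \<Longrightarrow> hyp_metric \<eta> a b = hyp_metric \<eta> b a"
  by (simp add: hyp_metric_eq inner_commute mult.commute mult.left_commute)

lemma hyp_metric_nondegenerate:
  assumes "\<eta> \<in> disk" "\<And>v. hyp_metric \<eta> w v = 0"
  shows "w = 0"
proof -
  have "0 \<le> (klein_factor \<eta>)\<^sup>2 * (\<eta> \<bullet> w) * (\<eta> \<bullet> w)" by (simp add: mult.assoc)
  then have "klein_factor \<eta> * (w \<bullet> w) \<le> 0"
    using assms(2)[of w] by (simp add: hyp_metric_eq[OF assms(1)])
  then have "w \<bullet> w \<le> 0" using klein_factor_pos[OF assms(1)] by (simp add: mult_le_0_iff)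
  then have "w \<bullet> w = 0" using inner_ge_zero[of w] by linarith
  then show ?thesis by simp
qed

text \<open>
  The derivative of the metric coefficient \<open>g(a, b)\<close> at \<open>\<eta>\<close> in direction \<open>w\<close>, for constant \<open>a\<close> and \<open>b\<close>.
\<close>
definition klein_metric_derivative :: "complex \<Rightarrow> complex \<Rightarrow> complex \<Rightarrow> complex \<Rightarrow> real" where
  "klein_metric_derivative \<eta> w a b =
     2 * (\<eta> \<bullet> w) * (klein_factor \<eta>)\<^sup>2 * (a \<bullet> b)
     + 4 * (\<eta> \<bullet> w) * (klein_factor \<eta>) ^ 3 * (\<eta> \<bullet> a) * (\<eta> \<bullet> b)
     + (klein_factor \<eta>)\<^sup>2 * ((w \<bullet> a) * (\<eta> \<bullet> b) + (\<eta> \<bullet> a) * (w \<bullet> b))"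

lemma hyp_metric_has_derivative:
  assumes "\<eta> \<in> disk"
  shows "((\<lambda>\<eta>. hyp_metric \<eta> a b) has_derivative (\<lambda>w. klein_metric_derivative \<eta> w a b)) (at \<eta>)"
proof (rule has_derivative_transform_within_open[OF _ open_ball assms])
  show "((\<lambda>\<eta>. klein_factor \<eta> * (a \<bullet> b) + (klein_factor \<eta>)\<^sup>2 * (\<eta> \<bullet> a) * (\<eta> \<bullet> b)) has_derivative
      (\<lambda>w. klein_metric_derivative \<eta> w a b)) (at \<eta>)"
    by (rule derivative_eq_intros klein_factor_has_derivative[OF assms] refl)+
       (simp add: fun_eq_iff klein_metric_derivative_def algebra_simps power2_eq_square power3_eq_cube)
qed (simp add: hyp_metric_eq)

text \<open>
  The geodesics of the Klein model are straight lines up to parametrization, so the Christoffel symbols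
  have to be of the form \<open>\<alpha>(a) b + \<alpha>(b) a\<close> for some linear form \<open>\<alpha>\<close>.
\<close>
definition klein_christoffel :: "complex \<Rightarrow> complex \<Rightarrow> complex \<Rightarrow> complex" where
  "klein_christoffel \<eta> a b = klein_factor \<eta> *\<^sub>R ((\<eta> \<bullet> a) *\<^sub>R b + (\<eta> \<bullet> b) *\<^sub>R a)"

lemma klein_metric_derivative_eq:
  assumes "\<eta> \<in> disk"
  shows "klein_metric_derivative \<eta> w a b
    = hyp_metric \<eta> (klein_christoffel \<eta> w a) b + hyp_metric \<eta> a (klein_christoffel \<eta> w b)"
  unfolding hyp_metric_eq[OF assms] klein_metric_derivative_def klein_christoffel_def
  by (simp add: inner_simps inner_commute[of a w] algebra_simps power2_eq_square power3_eq_cube)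

lemma christoffel_unique:
  fixes h :: "'a::euclidean_space metric"
  assumes "open S" "p \<in> S" "\<And>q. q \<in> S \<Longrightarrow> bilinear (h q)"
    and "\<And>q u v. q \<in> S \<Longrightarrow> h q u v = h q v u" "\<And>w. (\<And>v. h p w v = 0) \<Longrightarrow> w = 0"
    and "\<And>u v. ((\<lambda>q. h q u v) has_derivative (\<lambda>w. D w u v)) (at p)"
    and "bilinear \<Gamma>" "\<And>u v. \<Gamma> u v = \<Gamma> v u"
    and "\<And>w u v. D w u v = h p (\<Gamma> w u) v + h p u (\<Gamma> w v)"
  shows "christoffel h p = \<Gamma>"
  unfolding christoffel_def
proof (rule the1_equality)
  show "\<exists>!\<Gamma>. is_levi_civita_at h p \<Gamma>"
    using assms(6) by (intro levi_civita_ex1[OF assms(1-5)]) (auto simp: differentiable_def)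
  show "is_levi_civita_at h p \<Gamma>"
    unfolding is_levi_civita_at_def
    using assms(7-9) by (simp add: frechet_derivative_at[OF assms(6), symmetric])
qed

lemma bilinear_klein_christoffel: "bilinear (klein_christoffel \<eta>)"
  by (auto simp: bilinear_def klein_christoffel_def algebra_simps inner_simps intro!: linearI)

lemma christoffel_hyp_metric:
  assumes "\<eta> \<in> disk"
  shows "christoffel hyp_metric \<eta> = klein_christoffel \<eta>"
proof (rule christoffel_unique[OF open_ball assms])
  show "klein_christoffel \<eta> u v = klein_christoffel \<eta> v u" for u v
    by (simp add: klein_christoffel_def add.commute)
qed (fact bilinear_hyp_metric hyp_metric_commute hyp_metric_nondegenerate[OF assms]
    hyp_metric_has_derivative[OF assms] bilinear_klein_christoffel klein_metric_derivative_eq[OF assms])+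

lemma sharp_hyp_metric:
  assumes "\<eta> \<in> disk"
  shows "sharp hyp_metric \<eta> (\<lambda>v. v \<bullet> b) = (1 - \<eta> \<bullet> \<eta>) *\<^sub>R (b - (\<eta> \<bullet> b) *\<^sub>R \<eta>)"
  unfolding sharp_def
proof (rule the1_equality)
  show "\<exists>!w. \<forall>v. hyp_metric \<eta> w v = v \<bullet> b"
    by (rule sharp_ex1[where h = hyp_metric and p = \<eta>])
       (use bilinear_hyp_metric[OF assms] hyp_metric_nondegenerate[OF assms] in
         \<open>auto simp: inner_simps intro!: linearI\<close>)
  define r where "r = klein_factor \<eta>"
  have r: "r * (1 - \<eta> \<bullet> \<eta>) = 1" using klein_factor_mult[OF assms] by (simp add: r_def)
  show "\<forall>v. hyp_metric \<eta> ((1 - \<eta> \<bullet> \<eta>) *\<^sub>R (b - (\<eta> \<bullet> b) *\<^sub>R \<eta>)) v = v \<bullet> b"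
  proof
    fix v
    have "hyp_metric \<eta> ((1 - \<eta> \<bullet> \<eta>) *\<^sub>R (b - (\<eta> \<bullet> b) *\<^sub>R \<eta>)) v
      = (r * (1 - \<eta> \<bullet> \<eta>)) * (v \<bullet> b - (\<eta> \<bullet> b) * (\<eta> \<bullet> v)) + (r * (1 - \<eta> \<bullet> \<eta>))\<^sup>2 * (\<eta> \<bullet> b) * (\<eta> \<bullet> v)"
      unfolding hyp_metric_eq[OF assms] r_def[symmetric]
      by (simp add: inner_simps inner_commute[of b v] algebra_simps power2_eq_square)
    then show "hyp_metric \<eta> ((1 - \<eta> \<bullet> \<eta>) *\<^sub>R (b - (\<eta> \<bullet> b) *\<^sub>R \<eta>)) v = v \<bullet> b"
      unfolding r by simp
  qed
qed

lemma metric_trace_hyp_metric: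
  fixes B :: "complex \<Rightarrow> complex \<Rightarrow> 'b::real_vector"
  assumes \<eta>: "\<eta> \<in> disk" and B: "\<And>b. linear (\<lambda>a. B a b)"
  shows "metric_trace hyp_metric \<eta> B = (1 - \<eta> \<bullet> \<eta>) *\<^sub>R
    ((1 - (Re \<eta>)\<^sup>2) *\<^sub>R B 1 1 - (Re \<eta> * Im \<eta>) *\<^sub>R (B \<i> 1 + B 1 \<i>) + (1 - (Im \<eta>)\<^sup>2) *\<^sub>R B \<i> \<i>)"
proof -
  have l: "B (Complex x y) b = x *\<^sub>R B 1 b + y *\<^sub>R B \<i> b" for x y b
  proof -
    have "Complex x y = x *\<^sub>R 1 + y *\<^sub>R \<i>" by (simp add: complex_eq_iff)
    then show ?thesis by (simp only: linear_add[OF B] linear_cmul[OF B])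
  qed
  have 1: "1 - (\<eta> \<bullet> 1) *\<^sub>R \<eta> = Complex (1 - (Re \<eta>)\<^sup>2) (- (Re \<eta> * Im \<eta>))"
    and 2: "\<i> - (\<eta> \<bullet> \<i>) *\<^sub>R \<eta> = Complex (- (Re \<eta> * Im \<eta>)) (1 - (Im \<eta>)\<^sup>2)"
    by (simp_all add: complex_eq_iff inner_eq_coords power2_eq_square)
  have "metric_trace hyp_metric \<eta> B
      = B (sharp hyp_metric \<eta> (\<lambda>v. v \<bullet> 1)) 1 + B (sharp hyp_metric \<eta> (\<lambda>v. v \<bullet> \<i>)) \<i>"
    by (simp add: metric_trace_def Basis_complex_def)
  then show ?thesis
    unfolding sharp_hyp_metric[OF \<eta>] linear_cmul[OF B] 1 2 l by (simp add: algebra_simps)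
qed

subsection \<open>The Laplacian\<close>

lemma hessian_hyp_metric:
  assumes f: "twice_differentiable_on disk f fx fy fxx fxy fyy" and \<eta>: "\<eta> \<in> disk"
  shows "hessian hyp_metric f \<eta> a b = Re a * Re b * fxx \<eta> + (Re a * Im b + Im a * Re b) * fxy \<eta>
      + Im a * Im b * fyy \<eta>
      - Re (klein_christoffel \<eta> a b) * fx \<eta> - Im (klein_christoffel \<eta> a b) * fy \<eta>"
proof -
  have p: "dir_deriv v f \<zeta> = Re v * fx \<zeta> + Im v * fy \<zeta>" if "\<zeta> \<in> disk" for v \<zeta>
    using f that by (auto simp: twice_differentiable_on_def intro: dir_deriv_partials)
  have "((\<lambda>\<eta>. Re b * fx \<eta> + Im b * fy \<eta>) has_derivative
      (\<lambda>a. Re b * (Re a * fxx \<eta> + Im a * fxy \<eta>) + Im b * (Re a * fxy \<eta> + Im a * fyy \<eta>))) (at \<eta>)"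
    by (intro has_derivative_add has_derivative_mult_right twice_differentiable_onD[OF f \<eta>])
  then have "((\<lambda>\<eta>. dir_deriv b f \<eta>) has_derivative
      (\<lambda>a. Re b * (Re a * fxx \<eta> + Im a * fxy \<eta>) + Im b * (Re a * fxy \<eta> + Im a * fyy \<eta>))) (at \<eta>)"
    by (rule has_derivative_transform_within_open[OF _ open_ball \<eta>])
       (rule p[symmetric])
  from dir_deriv_eq[OF this] show ?thesis
    unfolding hessian_def dir_deriv_def[symmetric] christoffel_hyp_metric[OF \<eta>] p[OF \<eta>]
    by (simp add: algebra_simps)
qed

lemma laplacian_hyp_metric:
  assumes f: "twice_differentiable_on disk f fx fy fxx fxy fyy" and \<eta>: "\<eta> \<in> disk"
  shows "laplacian hyp_metric f \<eta> =
    (1 - \<eta> \<bullet> \<eta>) * (klein_operator fxx fxy fyy \<eta> - 2 * (Re \<eta> * fx \<eta> + Im \<eta> * fy \<eta>))"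
proof -
  define r where "r = klein_factor \<eta>"
  define x y where "x = Re \<eta>" and "y = Im \<eta>"
  have r: "r * (1 - (x\<^sup>2 + y\<^sup>2)) = 1"
    using klein_factor_mult[OF \<eta>] by (simp add: r_def x_def y_def inner_eq_coords power2_eq_square)
  have lin: "linear (\<lambda>a. hessian hyp_metric f \<eta> a b)" for b
    unfolding hessian_hyp_metric[OF f \<eta>] klein_christoffel_def
    by (rule linearI) (simp_all add: inner_simps algebra_simps)
  have "(1 - x\<^sup>2) * hessian hyp_metric f \<eta> 1 1 - (x * y) * (hessian hyp_metric f \<eta> \<i> 1 + hessian hyp_metric f \<eta> 1 \<i>)
      + (1 - y\<^sup>2) * hessian hyp_metric f \<eta> \<i> \<i>
    = klein_operator fxx fxy fyy \<eta> - 2 * (r * (1 - (x\<^sup>2 + y\<^sup>2))) * (x * fx \<eta> + y * fy \<eta>)"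
    unfolding hessian_hyp_metric[OF f \<eta>] klein_christoffel_def r_def[symmetric]
    by (simp add: inner_eq_coords klein_operator_def x_def[symmetric] y_def[symmetric] algebra_simps power2_eq_square)
  then show ?thesis
    unfolding laplacian_def metric_trace_hyp_metric[OF \<eta> lin] r
    by (simp add: x_def[symmetric] y_def[symmetric])
qed

lemma height_mult_twice_differentiable:
  assumes F: "twice_differentiable_on disk F Fx Fy Fxx Fxy Fyy"
  shows "twice_differentiable_on disk (\<lambda>\<eta>. height \<eta> * F \<eta>)
    (\<lambda>\<eta>. height \<eta> * Fx \<eta> + Re \<eta> * height \<eta> ^ 3 * F \<eta>)
    (\<lambda>\<eta>. height \<eta> * Fy \<eta> + Im \<eta> * height \<eta> ^ 3 * F \<eta>)
    (\<lambda>\<eta>. height \<eta> * Fxx \<eta> + 2 * Re \<eta> * height \<eta> ^ 3 * Fx \<eta> + height \<eta> ^ 3 * F \<eta> + 3 * (Re \<eta>)\<^sup>2 * height \<eta> ^ 5 * F \<eta>)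
    (\<lambda>\<eta>. height \<eta> * Fxy \<eta> + height \<eta> ^ 3 * (Re \<eta> * Fy \<eta> + Im \<eta> * Fx \<eta>) + 3 * Re \<eta> * Im \<eta> * height \<eta> ^ 5 * F \<eta>)
    (\<lambda>\<eta>. height \<eta> * Fyy \<eta> + 2 * Im \<eta> * height \<eta> ^ 3 * Fy \<eta> + height \<eta> ^ 3 * F \<eta> + 3 * (Im \<eta>)\<^sup>2 * height \<eta> ^ 5 * F \<eta>)"
  unfolding twice_differentiable_on_def has_partials_on_def
  by (intro conjI ballI;
      (rule derivative_eq_intros height_has_derivative twice_differentiable_onD[OF F] refl | assumption)+,
      simp add: fun_eq_iff inner_eq_coords algebra_simps eval_nat_numeral)

text \<open>
  The factor \<open>height\<close> is the one between \<open>u\<close> and \<open>ubar u\<close>. It absorbs the terms of first and zeroth order of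
  \<open>\<Delta> - 2\<close>.
\<close>
lemma laplacian_height_mult:
  assumes F: "twice_differentiable_on disk F Fx Fy Fxx Fxy Fyy" and \<eta>: "\<eta> \<in> disk"
  shows "laplacian hyp_metric (\<lambda>\<eta>. height \<eta> * F \<eta>) \<eta> - 2 * (height \<eta> * F \<eta>)
    = (1 - \<eta> \<bullet> \<eta>) * height \<eta> * klein_operator Fxx Fxy Fyy \<eta>"
proof -
  define h x y where "h = height \<eta>" and "x = Re \<eta>" and "y = Im \<eta>"
  have h: "h\<^sup>2 * (1 - (x\<^sup>2 + y\<^sup>2)) = 1"
    using height_squared_mult[OF \<eta>] by (simp add: h_def x_def y_def inner_eq_coords power2_eq_square)
  show ?thesis
    unfolding laplacian_hyp_metric[OF height_mult_twice_differentiable[OF F] \<eta>] klein_operator_def inner_eq_coords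
      h_def[symmetric] x_def[symmetric] y_def[symmetric]
    using h by algebra
qed

section \<open>The tangent bundle with its neutral metric\<close>

text \<open>
  By the Leibniz rule for the Levi-Civita connection, the Christoffel symbols in the horizontal and
  vertical splitting add up to a derivative of \<open>g\<close>: the metric is the complete lift of \<open>g\<close>.
\<close>
lemma bundle_metric_eq:
  assumes "x \<in> disk"
  shows "bundle_metric hyp_metric (x, v) \<xi> \<zeta> =
    hyp_metric x (fst \<xi>) (snd \<zeta>) + hyp_metric x (snd \<xi>) (fst \<zeta>) + klein_metric_derivative x v (fst \<xi>) (fst \<zeta>)"
proof -
  have s: "klein_christoffel x a b = klein_christoffel x b a" for a b
    by (simp add: klein_christoffel_def add.commute)
  have l: "hyp_metric x a (b + c) = hyp_metric x a b + hyp_metric x a c"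
    "hyp_metric x (b + c) a = hyp_metric x b a + hyp_metric x c a" for a b c
    by (simp_all add: hyp_metric_eq[OF assms] inner_simps algebra_simps)
  show ?thesis
    unfolding klein_metric_derivative_eq[OF assms]
    by (simp add: bundle_metric_def hv_split_def christoffel_hyp_metric[OF assms] l s[of v])
qed

text \<open>
  The derivative of \<open>klein_metric_derivative \<eta> v a b\<close> with respect to \<open>\<eta>\<close> in direction \<open>w\<close>.
\<close>
definition klein_metric_second_derivative :: "complex \<Rightarrow> complex \<Rightarrow> complex \<Rightarrow> complex \<Rightarrow> complex \<Rightarrow> real" where
  "klein_metric_second_derivative \<eta> w v a b = (let r = klein_factor \<eta> in
     2 * r\<^sup>2 * (w \<bullet> v) * (a \<bullet> b) + 8 * r ^ 3 * (\<eta> \<bullet> w) * (\<eta> \<bullet> v) * (a \<bullet> b)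
     + 4 * r ^ 3 * ((w \<bullet> v) * (\<eta> \<bullet> a) * (\<eta> \<bullet> b) + (\<eta> \<bullet> v) * ((w \<bullet> a) * (\<eta> \<bullet> b) + (\<eta> \<bullet> a) * (w \<bullet> b)))
     + 24 * r ^ 4 * (\<eta> \<bullet> w) * (\<eta> \<bullet> v) * (\<eta> \<bullet> a) * (\<eta> \<bullet> b)
     + 4 * r ^ 3 * (\<eta> \<bullet> w) * ((v \<bullet> a) * (\<eta> \<bullet> b) + (\<eta> \<bullet> a) * (v \<bullet> b))
     + r\<^sup>2 * ((v \<bullet> a) * (w \<bullet> b) + (w \<bullet> a) * (v \<bullet> b)))"

lemma klein_metric_derivative_linear:
  "klein_metric_derivative \<eta> v (a + a') b = klein_metric_derivative \<eta> v a b + klein_metric_derivative \<eta> v a' b"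
  "klein_metric_derivative \<eta> v (c *\<^sub>R a) b = c * klein_metric_derivative \<eta> v a b"
  "klein_metric_derivative \<eta> v a (b + b') = klein_metric_derivative \<eta> v a b + klein_metric_derivative \<eta> v a b'"
  "klein_metric_derivative \<eta> v a (c *\<^sub>R b) = c * klein_metric_derivative \<eta> v a b"
  by (simp_all add: klein_metric_derivative_def inner_simps algebra_simps)

lemma bundle_metric_has_derivative:
  assumes x: "x \<in> disk"
  shows "((\<lambda>q. bundle_metric hyp_metric q \<xi> \<zeta>) has_derivative
    (\<lambda>w. klein_metric_derivative x (fst w) (fst \<xi>) (snd \<zeta>) + klein_metric_derivative x (fst w) (snd \<xi>) (fst \<zeta>)
       + klein_metric_second_derivative x (fst w) v (fst \<xi>) (fst \<zeta>)
       + klein_metric_derivative x (snd w) (fst \<xi>) (fst \<zeta>))) (at (x, v))"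
proof (rule has_derivative_transform_within_open[where s = "disk \<times> UNIV"])
  have f: "((\<lambda>q. f (fst q)) has_derivative (\<lambda>w. f' (fst w))) (at (x, v))"
    if "(f has_derivative f') (at x)" for f :: "complex \<Rightarrow> real" and f'
    by (rule has_derivative_compose[OF has_derivative_fst[OF has_derivative_ident]]) (simp add: that)
  have k: "((\<lambda>q::complex \<times> complex. klein_metric_derivative (fst q) (snd q) a b) has_derivative
      (\<lambda>w. klein_metric_second_derivative x (fst w) v a b + klein_metric_derivative x (snd w) a b)) (at (x, v))" for a b
  proof -
    have r: "((\<lambda>q. klein_factor (fst q)) has_derivative (\<lambda>w. 2 * (x \<bullet> fst w) * (klein_factor x)\<^sup>2)) (at (x, v))"
      by (rule f[OF klein_factor_has_derivative[OF x]])
    note i = has_derivative_inner[OF has_derivative_fst[OF has_derivative_ident] has_derivative_const]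
      has_derivative_inner[OF has_derivative_snd[OF has_derivative_ident] has_derivative_const]
      has_derivative_inner[OF has_derivative_fst[OF has_derivative_ident] has_derivative_snd[OF has_derivative_ident]]
    show ?thesis
      unfolding klein_metric_derivative_def
      by (rule has_derivative_eq_rhs, (rule i r has_derivative_add has_derivative_mult has_derivative_power has_derivative_const)+)
         (simp add: fun_eq_iff klein_metric_second_derivative_def Let_def inner_commute algebra_simps eval_nat_numeral)
  qed
  show "((\<lambda>q. hyp_metric (fst q) (fst \<xi>) (snd \<zeta>) + hyp_metric (fst q) (snd \<xi>) (fst \<zeta>)
        + klein_metric_derivative (fst q) (snd q) (fst \<xi>) (fst \<zeta>)) has_derivative
    (\<lambda>w. klein_metric_derivative x (fst w) (fst \<xi>) (snd \<zeta>) + klein_metric_derivative x (fst w) (snd \<xi>) (fst \<zeta>)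
       + klein_metric_second_derivative x (fst w) v (fst \<xi>) (fst \<zeta>)
       + klein_metric_derivative x (snd w) (fst \<xi>) (fst \<zeta>))) (at (x, v))"
    by (rule has_derivative_eq_rhs[OF has_derivative_add[OF has_derivative_add[OF
            f[OF hyp_metric_has_derivative[OF x]] f[OF hyp_metric_has_derivative[OF x]]] k]])
       (simp add: fun_eq_iff)
  show "open (disk \<times> (UNIV :: complex set))" by (intro open_Times) auto
  show "(x, v) \<in> disk \<times> UNIV" using x by simp
  show "hyp_metric (fst q) (fst \<xi>) (snd \<zeta>) + hyp_metric (fst q) (snd \<xi>) (fst \<zeta>)
        + klein_metric_derivative (fst q) (snd q) (fst \<xi>) (fst \<zeta>) = bundle_metric hyp_metric q \<xi> \<zeta>"
    if "q \<in> disk \<times> UNIV" for q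
    using that by (cases q) (simp add: bundle_metric_eq)
qed

text \<open>
  The derivative of \<open>klein_christoffel \<eta> a b\<close> with respect to \<open>\<eta>\<close> in direction \<open>v\<close>.
\<close>
definition klein_christoffel_derivative :: "complex \<Rightarrow> complex \<Rightarrow> complex \<Rightarrow> complex \<Rightarrow> complex" where
  "klein_christoffel_derivative \<eta> v a b =
     (2 * (\<eta> \<bullet> v) * (klein_factor \<eta>)\<^sup>2) *\<^sub>R ((\<eta> \<bullet> a) *\<^sub>R b + (\<eta> \<bullet> b) *\<^sub>R a)
     + klein_factor \<eta> *\<^sub>R ((v \<bullet> a) *\<^sub>R b + (v \<bullet> b) *\<^sub>R a)"

text \<open>
  The complete lift of the connection: the tangent map of \<open>(x, a, b) \<mapsto> klein_christoffel x a b\<close> at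
  \<open>(x, fst \<xi>, fst \<zeta>)\<close> in direction \<open>(v, snd \<xi>, snd \<zeta>)\<close>, where \<open>q = (x, v)\<close>.
\<close>
definition bundle_christoffel :: "complex \<times> complex \<Rightarrow> complex \<times> complex \<Rightarrow> complex \<times> complex \<Rightarrow> complex \<times> complex" where
  "bundle_christoffel q \<xi> \<zeta> = (klein_christoffel (fst q) (fst \<xi>) (fst \<zeta>),
     klein_christoffel_derivative (fst q) (snd q) (fst \<xi>) (fst \<zeta>)
     + klein_christoffel (fst q) (snd \<xi>) (fst \<zeta>) + klein_christoffel (fst q) (fst \<xi>) (snd \<zeta>))"

text \<open>
  This is the compatibility of metric and connection, \<open>klein_metric_derivative_eq\<close>, differentiated along
  \<open>v\<close>. It is the part of the compatibility on the tangent bundle that involves three base directions.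
\<close>
lemma klein_metric_second_derivative_eq:
  assumes "\<eta> \<in> disk"
  shows "klein_metric_second_derivative \<eta> w v a b
    = hyp_metric \<eta> (klein_christoffel_derivative \<eta> v w a) b
      + klein_metric_derivative \<eta> v (klein_christoffel \<eta> w a) b
      + hyp_metric \<eta> a (klein_christoffel_derivative \<eta> v w b)
      + klein_metric_derivative \<eta> v a (klein_christoffel \<eta> w b)"
  unfolding hyp_metric_eq[OF assms] klein_metric_derivative_def klein_metric_second_derivative_def
    klein_christoffel_def klein_christoffel_derivative_def Let_def
  by (simp add: inner_simps inner_commute algebra_simps eval_nat_numeral)

lemma christoffel_bundle_metric:
  assumes x: "x \<in> disk"
  shows "christoffel (bundle_metric hyp_metric) (x, v) = bundle_christoffel (x, v)"
proof (rule christoffel_unique[OF _ _ _ _ _ bundle_metric_has_derivative[OF x]])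
  show "open (disk \<times> (UNIV :: complex set))" by (intro open_Times) auto
  show "(x, v) \<in> disk \<times> UNIV" using x by simp
  show "bilinear (bundle_metric hyp_metric q)" if "q \<in> disk \<times> UNIV" for q
    using that by (cases q)
      (auto simp: bilinear_def bundle_metric_eq klein_metric_derivative_linear hyp_metric_eq
        inner_simps algebra_simps intro!: linearI)
  show "bundle_metric hyp_metric q \<xi> \<zeta> = bundle_metric hyp_metric q \<zeta> \<xi>" if "q \<in> disk \<times> UNIV" for q \<xi> \<zeta>
  proof -
    define y w where "y = fst q" and "w = snd q"
    have q: "q = (y, w)" "y \<in> disk" using that by (auto simp: y_def w_def)
    have "klein_metric_derivative y w a b = klein_metric_derivative y w b a" for a b
      by (simp add: klein_metric_derivative_def inner_commute[of a b] algebra_simps)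
    then show ?thesis
      unfolding q(1) bundle_metric_eq[OF q(2)] using hyp_metric_commute[OF q(2)] by (metis add.commute)
  qed
  show "\<xi> = 0" if "\<And>\<zeta>. bundle_metric hyp_metric (x, v) \<xi> \<zeta> = 0" for \<xi>
  proof -
    have "hyp_metric x (fst \<xi>) b = 0" for b
      using that[of "(0, b)"] by (simp add: bundle_metric_eq[OF x] hyp_metric_eq[OF x] klein_metric_derivative_def)
    then have 1: "fst \<xi> = 0" by (rule hyp_metric_nondegenerate[OF x])
    have "hyp_metric x (snd \<xi>) b = 0" for b
      using that[of "(b, 0)"] 1 by (simp add: bundle_metric_eq[OF x] hyp_metric_eq[OF x] klein_metric_derivative_def)
    then have "snd \<xi> = 0" by (rule hyp_metric_nondegenerate[OF x])
    with 1 show ?thesis by (simp add: prod_eq_iff)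
  qed
  show "bilinear (bundle_christoffel (x, v))"
    by (auto simp: bilinear_def bundle_christoffel_def klein_christoffel_def klein_christoffel_derivative_def
        inner_simps algebra_simps intro!: linearI)
  show "bundle_christoffel (x, v) \<xi> \<zeta> = bundle_christoffel (x, v) \<zeta> \<xi>" for \<xi> \<zeta>
    by (simp add: bundle_christoffel_def klein_christoffel_def klein_christoffel_derivative_def algebra_simps)
  have l: "hyp_metric x a (b + c) = hyp_metric x a b + hyp_metric x a c"
    "hyp_metric x (b + c) a = hyp_metric x b a + hyp_metric x c a" for a b c
    by (simp_all add: hyp_metric_eq[OF x] inner_simps algebra_simps)
  show "klein_metric_derivative x (fst w) (fst \<xi>) (snd \<zeta>) + klein_metric_derivative x (fst w) (snd \<xi>) (fst \<zeta>)
       + klein_metric_second_derivative x (fst w) v (fst \<xi>) (fst \<zeta>)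
       + klein_metric_derivative x (snd w) (fst \<xi>) (fst \<zeta>)
     = bundle_metric hyp_metric (x, v) (bundle_christoffel (x, v) w \<xi>) \<zeta>
       + bundle_metric hyp_metric (x, v) \<xi> (bundle_christoffel (x, v) w \<zeta>)" for w \<xi> \<zeta>
    unfolding bundle_metric_eq[OF x] klein_metric_second_derivative_eq[OF x] klein_metric_derivative_eq[OF x, of "fst w"]
      klein_metric_derivative_eq[OF x, of "snd w"]
    by (simp add: bundle_christoffel_def l)
qed

subsection \<open>The tension field of a vector field\<close>

text \<open>
  The base component is the tension of the identity map and vanishes. In the fibre component, the
  trace of \<open>2 klein_christoffel \<eta> (DV a) b\<close> cancels the term \<open>DV (klein_christoffel \<eta> a b)\<close> up to
  the contribution of \<open>A1\<close> and \<open>A2\<close>, the transposed derivative of the field applied to \<open>\<eta>\<close>.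
\<close>
lemma tension_field_bundle_section:
  assumes V1: "twice_differentiable_on disk V1 V1x V1y V1xx V1xy V1yy"
    and V2: "twice_differentiable_on disk V2 V2x V2y V2xx V2xy V2yy"
    and W: "\<And>\<eta>. \<eta> \<in> disk \<Longrightarrow> klein_push W \<eta> = Complex (V1 \<eta>) (V2 \<eta>)"
    and \<eta>: "\<eta> \<in> disk"
  defines "A1 \<equiv> Re \<eta> * V1x \<eta> + Im \<eta> * V2x \<eta>" and "A2 \<equiv> Re \<eta> * V1y \<eta> + Im \<eta> * V2y \<eta>"
  shows "tension_field hyp_metric (bundle_metric hyp_metric) (bundle_section W) \<eta> = (0, Complex
    ((1 - \<eta> \<bullet> \<eta>) * klein_operator V1xx V1xy V1yy \<eta> + 2 * V1 \<eta> + 2 * (Re \<eta> * V1 \<eta> + Im \<eta> * V2 \<eta>) * Re \<eta>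
      + 2 * A1 - 2 * (Re \<eta> * A1 + Im \<eta> * A2) * Re \<eta>)
    ((1 - \<eta> \<bullet> \<eta>) * klein_operator V2xx V2xy V2yy \<eta> + 2 * V2 \<eta> + 2 * (Re \<eta> * V1 \<eta> + Im \<eta> * V2 \<eta>) * Im \<eta>
      + 2 * A2 - 2 * (Re \<eta> * A1 + Im \<eta> * A2) * Im \<eta>))"
proof -
  define DV where "DV b q = Complex (Re b * V1x q + Im b * V1y q) (Re b * V2x q + Im b * V2y q)" for b q
  define DDV where "DDV a b = Complex (Re b * (Re a * V1xx \<eta> + Im a * V1xy \<eta>) + Im b * (Re a * V1xy \<eta> + Im a * V1yy \<eta>))
      (Re b * (Re a * V2xx \<eta> + Im a * V2xy \<eta>) + Im b * (Re a * V2xy \<eta> + Im a * V2yy \<eta>))" for a b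
  have d: "(bundle_section W has_derivative (\<lambda>b. (b, DV b q))) (at q)" if "q \<in> disk" for q
  proof (rule has_derivative_transform_within_open[OF _ open_ball that])
    show "((\<lambda>q. (q, Complex (V1 q) (V2 q))) has_derivative (\<lambda>b. (b, DV b q))) (at q)"
      unfolding DV_def
      by (intro has_derivative_Pair has_derivative_ident Complex_has_derivative
          twice_differentiable_onD(1)[OF V1 that] twice_differentiable_onD(1)[OF V2 that])
  qed (simp add: bundle_section_def W)
  have dd: "((\<lambda>q. dir_deriv b (bundle_section W) q) has_derivative (\<lambda>a. (0, DDV a b))) (at \<eta>)" for b
  proof (rule has_derivative_transform_within_open[OF _ open_ball \<eta>])
    show "((\<lambda>q. (b, DV b q)) has_derivative (\<lambda>a. (0, DDV a b))) (at \<eta>)"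
      unfolding DV_def DDV_def
      by (intro has_derivative_Pair has_derivative_const Complex_has_derivative has_derivative_add has_derivative_mult_right
          twice_differentiable_onD[OF V1 \<eta>] twice_differentiable_onD[OF V2 \<eta>])
  qed (simp add: dir_deriv_eq[OF d])
  define V where "V = Complex (V1 \<eta>) (V2 \<eta>)"
  define D where "D b = DV b \<eta>" for b
  have D: "D b = Complex (Re b * V1x \<eta> + Im b * V1y \<eta>) (Re b * V2x \<eta> + Im b * V2y \<eta>)" for b
    by (simp add: D_def DV_def)
  define B where "B a b = DDV a b + klein_christoffel_derivative \<eta> V a b + klein_christoffel \<eta> (D a) b
    + klein_christoffel \<eta> a (D b) - D (klein_christoffel \<eta> a b)" for a b
  have sd: "second_derivative hyp_metric (bundle_metric hyp_metric) (bundle_section W) \<eta> a b = (0, B a b)" for a b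
  proof -
    have "bundle_section W \<eta> = (\<eta>, V)" by (simp add: bundle_section_def W[OF \<eta>] V_def)
    then show ?thesis
      unfolding second_derivative_def dir_deriv_def[symmetric] dir_deriv_eq[OF dd] dir_deriv_eq[OF d[OF \<eta>]]
        christoffel_hyp_metric[OF \<eta>]
      by (simp add: christoffel_bundle_metric[OF \<eta>] bundle_christoffel_def B_def D_def)
  qed
  define r where "r = klein_factor \<eta>"
  define x y where "x = Re \<eta>" and "y = Im \<eta>"
  have r: "r * (1 - (x * x + y * y)) = 1"
    using klein_factor_mult[OF \<eta>] by (simp add: r_def x_def y_def inner_eq_coords)
  have Blin: "linear (\<lambda>a. B a b)" for b
    unfolding B_def DDV_def D klein_christoffel_def klein_christoffel_derivative_def
    by (rule linearI) (simp_all add: complex_eq_iff inner_eq_coords algebra_simps)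
  have lin: "linear (\<lambda>a. second_derivative hyp_metric (bundle_metric hyp_metric) (bundle_section W) \<eta> a b)" for b
    unfolding sd by (intro linearI) (simp_all add: linear_add[OF Blin] linear_cmul[OF Blin])
  note defs = B_def DDV_def D V_def klein_christoffel_def klein_christoffel_derivative_def r_def[symmetric]
    inner_eq_coords x_def[symmetric] y_def[symmetric]
  show ?thesis
    unfolding tension_field_def metric_trace_hyp_metric[OF \<eta> lin] sd klein_operator_def A1_def A2_def
  proof (simp add: complex_eq_iff defs, intro conjI)
  qed (use r in algebra)+
qed

subsection \<open>The complex structure and the Lagrangian condition\<close>

lemma klein_inv_nth: "klein_inv \<eta> $ 1 = height \<eta>" "klein_inv \<eta> $ 2 = height \<eta> * Re \<eta>"
  "klein_inv \<eta> $ 3 = height \<eta> * Im \<eta>"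
  by (simp_all add: klein_inv_eq)

lemma klein_derivative_at_klein_inv:
  assumes "\<eta> \<in> disk"
  shows "frechet_derivative klein (at (klein_inv \<eta>)) v =
    Complex ((v$2 - v$1 * Re \<eta>) / height \<eta>) ((v$3 - v$1 * Im \<eta>) / height \<eta>)"
  using height_pos[OF assms] by (subst klein_derivative) (simp_all add: klein_inv_nth)

lemma klein_J_eq:
  assumes "\<eta> \<in> disk"
  shows "klein_J \<eta> a = height \<eta> *\<^sub>R
    Complex (- Re \<eta> * Im \<eta> * Re a - (1 - (Re \<eta>)\<^sup>2) * Im a) ((1 - (Im \<eta>)\<^sup>2) * Re a + Re \<eta> * Im \<eta> * Im a)"
  unfolding klein_J_def klein_derivative_at_klein_inv[OF assms] klein_inv_derivative[OF assms] hyp_J_def mcross_eq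
  using height_pos[OF assms]
  by (simp add: klein_inv_nth complex_eq_iff field_simps power2_eq_square)

text \<open>
  Lowering an index of the complex structure gives the area form of the hyperbolic plane.
\<close>
lemma hyp_metric_klein_J:
  assumes "\<eta> \<in> disk"
  shows "hyp_metric \<eta> (klein_J \<eta> a) b = height \<eta> ^ 3 * (Re a * Im b - Im a * Re b)"
proof -
  have h: "(height \<eta>)\<^sup>2 * (1 - ((Re \<eta>)\<^sup>2 + (Im \<eta>)\<^sup>2)) = 1"
    using height_squared_mult[OF assms] by (simp add: inner_eq_coords power2_eq_square)
  show ?thesis
    unfolding hyp_metric_eq[OF assms] klein_J_eq[OF assms] height_squared[OF assms, symmetric] inner_eq_coords
    using h by (simp only: complex_scaleR complex.sel scaleR_complex.sel) algebra
qed

text \<open>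
  The hypothesis \<open>div\<close> says that the covariant derivative of the field has trace zero; the term with
  \<open>klein_factor\<close> is the trace of the Christoffel symbols. As the complex structure lowers to an area
  form, the pulled back form is \<open>det(a, N b) + det(N a, b) = tr N det(a, b)\<close> up to a factor, where \<open>N\<close>
  is the covariant derivative.
\<close>
lemma lagrangian_vector_fieldI:
  assumes V1: "has_partials_on disk V1 V1x V1y" and V2: "has_partials_on disk V2 V2x V2y"
    and W: "\<And>\<eta>. \<eta> \<in> disk \<Longrightarrow> klein_push W \<eta> = Complex (V1 \<eta>) (V2 \<eta>)"
    and div: "\<And>\<eta>. \<eta> \<in> disk \<Longrightarrow>
      V1x \<eta> + V2y \<eta> + 3 * klein_factor \<eta> * (Re \<eta> * V1 \<eta> + Im \<eta> * V2 \<eta>) = 0"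
  shows "lagrangian_vector_field W"
  unfolding lagrangian_vector_field_def
proof (intro ballI allI)
  fix \<eta> a b :: complex assume \<eta>: "\<eta> \<in> disk"
  define DV where "DV b = Complex (Re b * V1x \<eta> + Im b * V1y \<eta>) (Re b * V2x \<eta> + Im b * V2y \<eta>)" for b
  have "(bundle_section W has_derivative (\<lambda>b. (b, DV b))) (at \<eta>)"
  proof (rule has_derivative_transform_within_open[OF _ open_ball \<eta>])
    show "((\<lambda>q. (q, Complex (V1 q) (V2 q))) has_derivative (\<lambda>b. (b, DV b))) (at \<eta>)"
      unfolding DV_def using V1 V2 \<eta>
      by (auto simp: has_partials_on_def intro!: has_derivative_Pair has_derivative_ident Complex_has_derivative)
  qed (simp add: bundle_section_def W)
  note d = frechet_derivative_at[OF this, symmetric]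
  define V where "V = Complex (V1 \<eta>) (V2 \<eta>)"
  have s: "bundle_section W \<eta> = (\<eta>, V)" by (simp add: bundle_section_def W[OF \<eta>] V_def)
  define N where "N b = DV b + klein_christoffel \<eta> b V" for b
  have "bundle_form hyp_metric klein_J (bundle_section W \<eta>) (a, DV a) (b, DV b)
      = height \<eta> ^ 3 * ((Re a * Im (N b) - Im a * Re (N b)) - (Re b * Im (N a) - Im b * Re (N a)))"
    by (simp add: bundle_form_def hv_split_def s christoffel_hyp_metric[OF \<eta>] N_def[symmetric]
        hyp_metric_commute[OF \<eta>, of "N a"] hyp_metric_klein_J[OF \<eta>] right_diff_distrib)
  also have "(Re a * Im (N b) - Im a * Re (N b)) - (Re b * Im (N a) - Im b * Re (N a))
      = (Re a * Im b - Im a * Re b)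
        * (V1x \<eta> + V2y \<eta> + 3 * klein_factor \<eta> * (Re \<eta> * V1 \<eta> + Im \<eta> * V2 \<eta>))"
    by (simp add: N_def DV_def V_def klein_christoffel_def inner_eq_coords algebra_simps)
  finally show "bundle_form hyp_metric klein_J (bundle_section W \<eta>)
      (frechet_derivative (bundle_section W) (at \<eta>) a) (frechet_derivative (bundle_section W) (at \<eta>) b) = 0"
    unfolding d div[OF \<eta>] by simp
qed

section \<open>The rotated gradient\<close>

definition klein_rotated_gradient :: "(complex \<Rightarrow> real) \<Rightarrow> (complex \<Rightarrow> real) \<Rightarrow> (complex \<Rightarrow> real) \<Rightarrow> complex \<Rightarrow> complex" where
  "klein_rotated_gradient F Fx Fy \<eta> = \<i> * (of_real (F \<eta>) * \<eta> + of_real (1 - \<eta> \<bullet> \<eta>) * Complex (Fx \<eta>) (Fy \<eta>))"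

text \<open>
  The first vector is the Minkowski gradient at \<open>(1, \<eta>)\<close>, hence by homogeneity also at \<open>p = klein_inv \<eta>\<close>,
  of the extension of \<open>u\<close> of degree \<open>1\<close>. Its component normal to the hyperboloid is \<open>- u(p) p\<close>, by Euler's
  relation, and the second summand removes it.
\<close>
lemma hyp_grad_eq:
  assumes F: "has_partials_on disk F Fx Fy" and u: "\<And>\<eta>. \<eta> \<in> disk \<Longrightarrow> u (klein_inv \<eta>) = height \<eta> * F \<eta>"
    and \<eta>: "\<eta> \<in> disk"
  shows "hyp_grad u (klein_inv \<eta>) =
    vector [- (F \<eta> - Re \<eta> * Fx \<eta> - Im \<eta> * Fy \<eta>), Fx \<eta>, Fy \<eta>] + (height \<eta> * F \<eta>) *\<^sub>R klein_inv \<eta>"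
proof -
  define h x y where "h = height \<eta>" and "x = Re \<eta>" and "y = Im \<eta>"
  have hpos: "h > 0" using height_pos[OF \<eta>] by (simp add: h_def)
  have h: "h\<^sup>2 * (1 - (x\<^sup>2 + y\<^sup>2)) = 1"
    using height_squared_mult[OF \<eta>] by (simp add: h_def x_def y_def inner_eq_coords power2_eq_square)
  have xy: "x\<^sup>2 + y\<^sup>2 < 1" using disk_inner[OF \<eta>] by (simp add: x_def y_def inner_eq_coords power2_eq_square)
  have tan: "v \<in> tangent_hyp (klein_inv \<eta>) \<longleftrightarrow> v$1 = x * v$2 + y * v$3" for v
  proof -
    have "mink (klein_inv \<eta>) v = h * (x * v$2 + y * v$3 - v$1)"
      by (simp add: mink_def klein_inv_nth h_def x_def y_def algebra_simps)
    then show ?thesis using hpos by (auto simp: tangent_hyp_def)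
  qed
  have "((\<lambda>\<eta>. height \<eta> * F \<eta>) has_derivative
      (\<lambda>v. h * (Re v * Fx \<eta> + Im v * Fy \<eta>) + (\<eta> \<bullet> v) * h ^ 3 * F \<eta>)) (at \<eta>)"
    unfolding h_def using F \<eta>
    by (intro has_derivative_mult height_has_derivative) (auto simp: has_partials_on_def)
  then have "((u \<circ> klein_inv) has_derivative
      (\<lambda>v. h * (Re v * Fx \<eta> + Im v * Fy \<eta>) + (\<eta> \<bullet> v) * h ^ 3 * F \<eta>)) (at \<eta>)"
    by (rule has_derivative_transform_within_open[OF _ open_ball \<eta>]) (simp add: u)
  note du = frechet_derivative_at[OF this, symmetric]
  define g where "g = vector [- (F \<eta> - x * Fx \<eta> - y * Fy \<eta>), Fx \<eta>, Fy \<eta>] + (h * F \<eta>) *\<^sub>R klein_inv \<eta>"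
  have g: "g$1 = - (F \<eta> - x * Fx \<eta> - y * Fy \<eta>) + h\<^sup>2 * F \<eta>" "g$2 = Fx \<eta> + h\<^sup>2 * F \<eta> * x" "g$3 = Fy \<eta> + h\<^sup>2 * F \<eta> * y"
    by (simp_all add: g_def klein_inv_nth h_def x_def y_def power2_eq_square)
  have gtan: "g \<in> tangent_hyp (klein_inv \<eta>)" unfolding tan g using h by algebra
  have gmink: "mink g w = hyp_differential u (klein_inv \<eta>) w" if "w \<in> tangent_hyp (klein_inv \<eta>)" for w
  proof -
    define a b where "a = (w$2 - w$1 * x) / h" and "b = (w$3 - w$1 * y) / h"
    have ab: "h * a = w$2 - w$1 * x" "h * b = w$3 - w$1 * y" using hpos by (simp_all add: a_def b_def)
    have "hyp_differential u (klein_inv \<eta>) w = h * (a * Fx \<eta> + b * Fy \<eta>) + (x * a + y * b) * h ^ 3 * F \<eta>"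
      using \<eta> unfolding hyp_differential_def klein_derivative_at_klein_inv[OF \<eta>]
      by (simp add: klein_klein_inv du a_def b_def h_def x_def y_def inner_eq_coords)
    then show ?thesis using that ab h unfolding tan mink_def g by algebra
  qed
  have "hyp_grad u (klein_inv \<eta>) = g"
    unfolding hyp_grad_def
  proof (rule the_equality)
    show "g \<in> tangent_hyp (klein_inv \<eta>) \<and> (\<forall>w\<in>tangent_hyp (klein_inv \<eta>). mink g w = hyp_differential u (klein_inv \<eta>) w)"
      using gtan gmink by blast
    fix v assume v: "v \<in> tangent_hyp (klein_inv \<eta>) \<and> (\<forall>w\<in>tangent_hyp (klein_inv \<eta>). mink v w = hyp_differential u (klein_inv \<eta>) w)"
    define d where "d = v - g"
    have d1: "d$1 = x * d$2 + y * d$3" using v gtan by (simp add: tan d_def algebra_simps)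
    have "mink v d = mink g d" using v gmink d1 by (simp add: tan)
    then have "- (d$1 * d$1) + d$2 * d$2 + d$3 * d$3 = 0" by (simp add: d_def mink_def algebra_simps)
    \<comment> \<open>Positivity of the Minkowski form on the tangent plane, in the guise of Lagrange's identity.\<close>
    then have "(1 - (x\<^sup>2 + y\<^sup>2)) * ((d$2)\<^sup>2 + (d$3)\<^sup>2) + (x * d$3 - y * d$2)\<^sup>2 = 0" unfolding d1 by algebra
    moreover have "0 \<le> (1 - (x\<^sup>2 + y\<^sup>2)) * ((d$2)\<^sup>2 + (d$3)\<^sup>2)" using xy by simp
    ultimately have "(1 - (x\<^sup>2 + y\<^sup>2)) * ((d$2)\<^sup>2 + (d$3)\<^sup>2) = 0" by (smt (verit) zero_le_power2)
    then have "d$2 = 0 \<and> d$3 = 0" using xy by (simp add: sum_power2_eq_zero_iff)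
    then have "d = 0" using d1 by (simp add: vec_eq_iff forall_3)
    then show "v = g" by (simp add: d_def)
  qed
  then show ?thesis by (simp add: g_def h_def x_def y_def)
qed

text \<open>
  The multiple of \<open>p\<close> in the gradient disappears in the cross product with \<open>p\<close>.
\<close>
lemma klein_push_rotated_gradient:
  assumes F: "has_partials_on disk F Fx Fy" and u: "\<And>\<eta>. \<eta> \<in> disk \<Longrightarrow> u (klein_inv \<eta>) = height \<eta> * F \<eta>"
    and \<eta>: "\<eta> \<in> disk"
  shows "klein_push (\<lambda>p. hyp_J p (hyp_grad u p)) \<eta> = klein_rotated_gradient F Fx Fy \<eta>"
proof -
  define g where "g = hyp_grad u (klein_inv \<eta>)"
  have g: "g = vector [- (F \<eta> - Re \<eta> * Fx \<eta> - Im \<eta> * Fy \<eta>), Fx \<eta>, Fy \<eta>] + (height \<eta> * F \<eta>) *\<^sub>R klein_inv \<eta>"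
    unfolding g_def by (rule hyp_grad_eq[OF F u \<eta>])
  show ?thesis
    unfolding klein_push_def klein_derivative_at_klein_inv[OF \<eta>] hyp_J_def mcross_eq klein_rotated_gradient_def
      g_def[symmetric]
    using height_pos[OF \<eta>]
    by (simp add: g klein_inv_nth complex_eq_iff inner_eq_coords field_simps power2_eq_square)
qed

subsection \<open>Smoothness\<close>

text \<open>
  The derivative of such a power is a lower power times a linear function, so the induction on the
  order of differentiability has to treat all exponents at once.
\<close>
lemma Ck_on_powr_one_minus_inner: "Ck_on k disk (\<lambda>\<eta>. (1 - \<eta> \<bullet> \<eta>) powr a)"
proof (induction k arbitrary: a)
  case 0
  then show ?case
    using disk_inner by (fastforce intro!: continuous_intros)
next
  case (Suc k)
  show ?case
  proof (rule Ck_on_SucI[OF open_ball, where f' = "\<lambda>\<eta> v. (- 2 * a) * (1 - \<eta> \<bullet> \<eta>) powr (a - 1) * (\<eta> \<bullet> v)"])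
    fix \<eta> :: complex assume "\<eta> \<in> disk"
    then have "1 - \<eta> \<bullet> \<eta> > 0" using disk_inner by fastforce
    then have "((\<lambda>s. s powr a) has_derivative (*) (a * (1 - \<eta> \<bullet> \<eta>) powr (a - 1))) (at (1 - \<eta> \<bullet> \<eta>))"
      using has_real_derivative_powr has_field_derivative_def by blast
    from has_derivative_compose[OF one_minus_inner_has_derivative this]
    show "((\<lambda>\<eta>. (1 - \<eta> \<bullet> \<eta>) powr a) has_derivative
        (\<lambda>v. (- 2 * a) * (1 - \<eta> \<bullet> \<eta>) powr (a - 1) * (\<eta> \<bullet> v))) (at \<eta>)"
      by (rule has_derivative_eq_rhs) (simp add: fun_eq_iff)
  next
    show "Ck_on k disk (\<lambda>\<eta>. (- 2 * a) * (1 - \<eta> \<bullet> \<eta>) powr (a - 1) * (\<eta> \<bullet> v))" for v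
      by (intro Ck_on_mult Ck_on_const Suc.IH open_ball
          Ck_on_bounded_linear[OF bounded_linear_inner_left _ Ck_on_id])
  qed
qed

lemma smooth_on_ubar:
  assumes "smooth_fun_hyp u"
  shows "smooth_on disk (ubar u)"
proof (rule smooth_on_cong[OF open_ball])
  show "smooth_on disk (\<lambda>\<eta>. (1 - \<eta> \<bullet> \<eta>) powr (1/2) * (u \<circ> klein_inv) \<eta>)"
    using Ck_on_powr_one_minus_inner
    by (intro smooth_on_mult open_ball assms[unfolded smooth_fun_hyp_def]) (simp add: smooth_on_def)
  show "(1 - \<eta> \<bullet> \<eta>) powr (1/2) * (u \<circ> klein_inv) \<eta> = ubar u \<eta>" if "\<eta> \<in> disk" for \<eta>
    using disk_inner[OF that] by (simp add: ubar_def dot_square_norm powr_half_sqrt)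
qed

lemma smooth_on_klein_rotated_gradient:
  assumes "smooth_on disk F"
  shows "smooth_on disk (klein_rotated_gradient F (dir_deriv 1 F) (dir_deriv \<i> F))"
proof -
  have s: "smooth_on disk (\<lambda>\<eta>::complex. 1 - \<eta> \<bullet> \<eta>)" "smooth_on disk Re" "smooth_on disk Im"
  proof -
    show re: "smooth_on disk Re" and im: "smooth_on disk Im"
      by (intro smooth_on_linear[OF _ open_ball smooth_on_id[OF open_ball]] bounded_linear_Re bounded_linear_Im)+
    have "smooth_on disk (\<lambda>\<eta>. 1 + - 1 * (Re \<eta> * Re \<eta> + Im \<eta> * Im \<eta>))"
      by (intro smooth_on_add smooth_on_mult smooth_on_const re im open_ball)
    moreover have "(\<lambda>\<eta>::complex. 1 - \<eta> \<bullet> \<eta>) = (\<lambda>\<eta>. 1 + - 1 * (Re \<eta> * Re \<eta> + Im \<eta> * Im \<eta>))"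
      by (simp add: fun_eq_iff inner_eq_coords)
    ultimately show "smooth_on disk (\<lambda>\<eta>::complex. 1 - \<eta> \<bullet> \<eta>)" by (simp only:)
  qed
  note d = smooth_on_dir_deriv[OF assms]
  have "smooth_on disk (\<lambda>\<eta>. (- 1 * (Im \<eta> * F \<eta>) + - 1 * ((1 - \<eta> \<bullet> \<eta>) * dir_deriv \<i> F \<eta>)) *\<^sub>R 1
      + (Re \<eta> * F \<eta> + (1 - \<eta> \<bullet> \<eta>) * dir_deriv 1 F \<eta>) *\<^sub>R \<i>)"
    by (intro smooth_on_add smooth_on_linear[OF bounded_linear_scaleR_left] smooth_on_mult smooth_on_const s d assms open_ball)
  then show ?thesis
    by (rule smooth_on_cong[OF open_ball, rotated]) (simp add: klein_rotated_gradient_def complex_eq_iff)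
qed

section \<open>Harmonicity and the Lagrangian property\<close>

text \<open>
  These are the two first derivatives of the equation; the right-hand sides come from
  differentiating the coefficients.
\<close>
lemma klein_operator_partials_vanish:
  assumes xx: "has_partials_on disk Fxx Fxxx Fxxy" and xy: "has_partials_on disk Fxy Fxxy Fxyy"
    and yy: "has_partials_on disk Fyy Fxyy Fyyy"
    and e: "\<And>\<eta>. \<eta> \<in> disk \<Longrightarrow> klein_operator Fxx Fxy Fyy \<eta> = 0" and \<eta>: "\<eta> \<in> disk"
  shows "klein_operator Fxxx Fxxy Fxyy \<eta> = 2 * (Re \<eta> * Fxx \<eta> + Im \<eta> * Fxy \<eta>)"
    and "klein_operator Fxxy Fxyy Fyyy \<eta> = 2 * (Re \<eta> * Fxy \<eta> + Im \<eta> * Fyy \<eta>)"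
proof -
  have d: "(Fxx has_derivative (\<lambda>v. Re v * Fxxx \<eta> + Im v * Fxxy \<eta>)) (at \<eta>)"
    "(Fxy has_derivative (\<lambda>v. Re v * Fxxy \<eta> + Im v * Fxyy \<eta>)) (at \<eta>)"
    "(Fyy has_derivative (\<lambda>v. Re v * Fxyy \<eta> + Im v * Fyyy \<eta>)) (at \<eta>)"
    using xx xy yy \<eta> by (auto simp: has_partials_on_def)
  have "((\<lambda>\<eta>. klein_operator Fxx Fxy Fyy \<eta>) has_derivative
      (\<lambda>v. Re v * (klein_operator Fxxx Fxxy Fxyy \<eta> - 2 * (Re \<eta> * Fxx \<eta> + Im \<eta> * Fxy \<eta>))
         + Im v * (klein_operator Fxxy Fxyy Fyyy \<eta> - 2 * (Re \<eta> * Fxy \<eta> + Im \<eta> * Fyy \<eta>)))) (at \<eta>)"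
    unfolding klein_operator_def
    by (rule derivative_eq_intros d refl)+ (simp add: fun_eq_iff algebra_simps power2_eq_square)
  moreover have "((\<lambda>\<eta>. klein_operator Fxx Fxy Fyy \<eta>) has_derivative (\<lambda>v. 0)) (at \<eta>)"
    by (rule has_derivative_transform_within_open[OF has_derivative_const open_ball \<eta>]) (rule e[symmetric])
  ultimately have "(\<lambda>v. Re v * (klein_operator Fxxx Fxxy Fxyy \<eta> - 2 * (Re \<eta> * Fxx \<eta> + Im \<eta> * Fxy \<eta>))
         + Im v * (klein_operator Fxxy Fxyy Fyyy \<eta> - 2 * (Re \<eta> * Fxy \<eta> + Im \<eta> * Fyy \<eta>))) = (\<lambda>v. 0)"
    by (rule has_derivative_unique)
  from fun_cong[OF this, of 1] fun_cong[OF this, of \<i>]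
  show "klein_operator Fxxx Fxxy Fxyy \<eta> = 2 * (Re \<eta> * Fxx \<eta> + Im \<eta> * Fxy \<eta>)"
    "klein_operator Fxxy Fxyy Fyyy \<eta> = 2 * (Re \<eta> * Fxy \<eta> + Im \<eta> * Fyy \<eta>)" by simp_all
qed

lemma rotated_gradient_harmonic_lagrangian:
  assumes F: "smooth_on disk F" and W: "\<And>\<eta>. \<eta> \<in> disk \<Longrightarrow>
      klein_push W \<eta> = klein_rotated_gradient F (dir_deriv 1 F) (dir_deriv \<i> F) \<eta>"
    and tangent: "\<And>p. p \<in> hyp \<Longrightarrow> W p \<in> tangent_hyp p"
    and eq: "\<And>\<eta>. \<eta> \<in> disk \<Longrightarrow> klein_operator (dir_deriv 1 (dir_deriv 1 F))
      (dir_deriv \<i> (dir_deriv 1 F)) (dir_deriv \<i> (dir_deriv \<i> F)) \<eta> = 0"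
  shows "harmonic_lagrangian W"
proof -
  define Fx Fy where "Fx = dir_deriv 1 F" and "Fy = dir_deriv \<i> F"
  define Fxx Fxy Fyy where "Fxx = dir_deriv 1 Fx" and "Fxy = dir_deriv \<i> Fx" and "Fyy = dir_deriv \<i> Fy"
  define Fxxx Fxxy Fxyy Fyyy where "Fxxx = dir_deriv 1 Fxx" and "Fxxy = dir_deriv \<i> Fxx"
    and "Fxyy = dir_deriv \<i> Fxy" and "Fyyy = dir_deriv \<i> Fyy"
  have sFx: "smooth_on disk Fx" and sFy: "smooth_on disk Fy"
    by (simp_all add: Fx_def Fy_def smooth_on_dir_deriv F)
  note T = smooth_on_twice_differentiable[OF open_ball]
  note T0 = T[OF F, folded Fx_def Fy_def, folded Fxx_def Fxy_def Fyy_def]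
  note Tx = T[OF sFx, folded Fxx_def Fxy_def, folded Fxxx_def Fxxy_def Fxyy_def]
  have "has_partials_on disk Fyy Fxyy Fyyy"
  proof -
    have "dir_deriv 1 Fyy \<eta> = Fxyy \<eta>" if "\<eta> \<in> disk" for \<eta>
    proof -
      have d: "((dir_deriv 1 Fy) has_derivative (\<lambda>v. dir_deriv v Fxy \<eta>)) (at \<eta>)"
      proof (rule has_derivative_transform_within_open[OF _ open_ball that])
        show "(Fxy has_derivative (\<lambda>v. dir_deriv v Fxy \<eta>)) (at \<eta>)"
          unfolding Fxy_def by (rule smooth_on_has_derivative[OF smooth_on_dir_deriv[OF sFx] that])
        show "Fxy \<zeta> = dir_deriv 1 Fy \<zeta>" if "\<zeta> \<in> disk" for \<zeta>
          unfolding Fxy_def Fx_def Fy_def by (rule dir_deriv_commute[OF open_ball F that])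
      qed
      have "dir_deriv 1 Fyy \<eta> = dir_deriv \<i> (dir_deriv 1 Fy) \<eta>"
        unfolding Fyy_def by (rule dir_deriv_commute[OF open_ball sFy that])
      also have "\<dots> = Fxyy \<eta>" unfolding Fxyy_def by (rule dir_deriv_eq[OF d])
      finally show ?thesis .
    qed
    then show ?thesis
      using has_partials_on_cong_derivative[OF smooth_on_has_partials[OF smooth_on_dir_deriv[OF sFy, of \<i>]]]
      unfolding Fyyy_def Fyy_def by blast
  qed
  note p = T0[unfolded twice_differentiable_on_def] Tx[unfolded twice_differentiable_on_def] this
  have E: "klein_operator Fxx Fxy Fyy \<eta> = 0" if "\<eta> \<in> disk" for \<eta>
    using eq[OF that] unfolding Fxx_def Fxy_def Fyy_def Fx_def Fy_def .
  have E': "klein_operator Fxxx Fxxy Fxyy \<eta> = 2 * (Re \<eta> * Fxx \<eta> + Im \<eta> * Fxy \<eta>)"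
    "klein_operator Fxxy Fxyy Fyyy \<eta> = 2 * (Re \<eta> * Fxy \<eta> + Im \<eta> * Fyy \<eta>)" if "\<eta> \<in> disk" for \<eta>
    using klein_operator_partials_vanish[OF _ _ _ E that] p by blast+
  define V1 V2 where "V1 \<eta> = - Im \<eta> * F \<eta> - (1 - \<eta> \<bullet> \<eta>) * Fy \<eta>"
    and "V2 \<eta> = Re \<eta> * F \<eta> + (1 - \<eta> \<bullet> \<eta>) * Fx \<eta>" for \<eta>
  have W': "klein_push W \<eta> = Complex (V1 \<eta>) (V2 \<eta>)" if "\<eta> \<in> disk" for \<eta>
    unfolding W[OF that] by (simp add: klein_rotated_gradient_def complex_eq_iff V1_def V2_def Fx_def Fy_def)
  \<comment> \<open>The partial derivatives of \<open>V1\<close> and \<open>V2\<close> up to second order, with the mixed ones already identified.\<close>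
  define V1x V1y V2x V2y where
    "V1x \<eta> = - Im \<eta> * Fx \<eta> + 2 * Re \<eta> * Fy \<eta> - (1 - \<eta> \<bullet> \<eta>) * Fxy \<eta>" and
    "V1y \<eta> = - F \<eta> + Im \<eta> * Fy \<eta> - (1 - \<eta> \<bullet> \<eta>) * Fyy \<eta>" and
    "V2x \<eta> = F \<eta> - Re \<eta> * Fx \<eta> + (1 - \<eta> \<bullet> \<eta>) * Fxx \<eta>" and
    "V2y \<eta> = Re \<eta> * Fy \<eta> - 2 * Im \<eta> * Fx \<eta> + (1 - \<eta> \<bullet> \<eta>) * Fxy \<eta>" for \<eta>
  define V1xx V1xy V1yy V2xx V2xy V2yy where
    "V1xx \<eta> = - Im \<eta> * Fxx \<eta> + 2 * Fy \<eta> + 4 * Re \<eta> * Fxy \<eta> - (1 - \<eta> \<bullet> \<eta>) * Fxxy \<eta>" and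
    "V1xy \<eta> = - Fx \<eta> + Im \<eta> * Fxy \<eta> + 2 * Re \<eta> * Fyy \<eta> - (1 - \<eta> \<bullet> \<eta>) * Fxyy \<eta>" and
    "V1yy \<eta> = 3 * Im \<eta> * Fyy \<eta> - (1 - \<eta> \<bullet> \<eta>) * Fyyy \<eta>" and
    "V2xx \<eta> = - 3 * Re \<eta> * Fxx \<eta> + (1 - \<eta> \<bullet> \<eta>) * Fxxx \<eta>" and
    "V2xy \<eta> = Fy \<eta> - Re \<eta> * Fxy \<eta> - 2 * Im \<eta> * Fxx \<eta> + (1 - \<eta> \<bullet> \<eta>) * Fxxy \<eta>" and
    "V2yy \<eta> = Re \<eta> * Fyy \<eta> - 2 * Fx \<eta> - 4 * Im \<eta> * Fxy \<eta> + (1 - \<eta> \<bullet> \<eta>) * Fxyy \<eta>" for \<eta>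
  have ders: "(F has_derivative (\<lambda>v. Re v * Fx \<eta> + Im v * Fy \<eta>)) (at \<eta>)"
    "(Fx has_derivative (\<lambda>v. Re v * Fxx \<eta> + Im v * Fxy \<eta>)) (at \<eta>)"
    "(Fy has_derivative (\<lambda>v. Re v * Fxy \<eta> + Im v * Fyy \<eta>)) (at \<eta>)"
    "(Fxx has_derivative (\<lambda>v. Re v * Fxxx \<eta> + Im v * Fxxy \<eta>)) (at \<eta>)"
    "(Fxy has_derivative (\<lambda>v. Re v * Fxxy \<eta> + Im v * Fxyy \<eta>)) (at \<eta>)"
    "(Fyy has_derivative (\<lambda>v. Re v * Fxyy \<eta> + Im v * Fyyy \<eta>)) (at \<eta>)" if "\<eta> \<in> disk" for \<eta>
    using p that by (auto simp: has_partials_on_def)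
  note s = one_minus_inner_has_derivative
  have TV1: "twice_differentiable_on disk V1 V1x V1y V1xx V1xy V1yy"
    unfolding twice_differentiable_on_def has_partials_on_def V1_def[abs_def] V1x_def[abs_def] V1y_def[abs_def]
      V1xx_def V1xy_def V1yy_def
    by (intro conjI ballI;
        (rule derivative_eq_intros s ders refl | assumption)+,
        simp add: fun_eq_iff inner_eq_coords algebra_simps)
  have TV2: "twice_differentiable_on disk V2 V2x V2y V2xx V2xy V2yy"
    unfolding twice_differentiable_on_def has_partials_on_def V2_def[abs_def] V2x_def[abs_def] V2y_def[abs_def]
      V2xx_def V2xy_def V2yy_def
    by (intro conjI ballI;
        (rule derivative_eq_intros s ders refl | assumption)+,
        simp add: fun_eq_iff inner_eq_coords algebra_simps)
  have "smooth_vector_field_hyp W"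
    unfolding smooth_vector_field_hyp_def
    using tangent smooth_on_cong[OF open_ball W[symmetric] smooth_on_klein_rotated_gradient[OF F]] by blast
  moreover have "harmonic_vector_field W"
    unfolding harmonic_vector_field_def harmonic_map_on_def
  proof (intro conjI ballI)
    have "smooth_on disk (\<lambda>\<eta>. (\<eta>, 0) + (0, klein_push W \<eta>))"
    proof (intro smooth_on_add open_ball)
      show "smooth_on disk (\<lambda>\<eta>::complex. (\<eta>, 0::complex))"
        by (rule smooth_on_linear[OF _ open_ball smooth_on_id[OF open_ball]])
           (intro bounded_linear_Pair bounded_linear_ident bounded_linear_zero)
      show "smooth_on disk (\<lambda>\<eta>. (0::complex, klein_push W \<eta>))"
        using \<open>smooth_vector_field_hyp W\<close> unfolding smooth_vector_field_hyp_def
        by (intro smooth_on_linear[where l = "\<lambda>v. (0, v)"] bounded_linear_Pair bounded_linear_ident bounded_linear_zero open_ball) blast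
    qed
    then show "smooth_on disk (bundle_section W)" by (simp add: bundle_section_def[abs_def])
    fix \<eta> :: complex assume \<eta>: "\<eta> \<in> disk"
    define x y \<sigma> where "x = Re \<eta>" and "y = Im \<eta>" and "\<sigma> = 1 - \<eta> \<bullet> \<eta>"
    have \<sigma>: "\<sigma> = 1 - x\<^sup>2 - y\<^sup>2" by (simp add: \<sigma>_def x_def y_def inner_eq_coords power2_eq_square)
    note eqs = E[OF \<eta>] E'[OF \<eta>]
    note defs = klein_operator_def V1_def V2_def V1x_def V1y_def V2x_def V2y_def V1xx_def V1xy_def V1yy_def
      V2xx_def V2xy_def V2yy_def x_def[symmetric] y_def[symmetric] \<sigma>_def[symmetric]
    \<comment> \<open>Each component of the tension field is a multiple of the equation plus a multiple of one of its
        first derivatives.\<close>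
    have "(1 - \<eta> \<bullet> \<eta>) * klein_operator V1xx V1xy V1yy \<eta> + 2 * V1 \<eta> + 2 * (Re \<eta> * V1 \<eta> + Im \<eta> * V2 \<eta>) * Re \<eta>
        + 2 * (Re \<eta> * V1x \<eta> + Im \<eta> * V2x \<eta>)
        - 2 * (Re \<eta> * (Re \<eta> * V1x \<eta> + Im \<eta> * V2x \<eta>) + Im \<eta> * (Re \<eta> * V1y \<eta> + Im \<eta> * V2y \<eta>)) * Re \<eta>
      = \<sigma> * y * klein_operator Fxx Fxy Fyy \<eta>
        - \<sigma>\<^sup>2 * (klein_operator Fxxy Fxyy Fyyy \<eta> - 2 * (x * Fxy \<eta> + y * Fyy \<eta>))"
      unfolding defs \<sigma> by algebra
    moreover have "(1 - \<eta> \<bullet> \<eta>) * klein_operator V2xx V2xy V2yy \<eta> + 2 * V2 \<eta> + 2 * (Re \<eta> * V1 \<eta> + Im \<eta> * V2 \<eta>) * Im \<eta>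
        + 2 * (Re \<eta> * V1y \<eta> + Im \<eta> * V2y \<eta>)
        - 2 * (Re \<eta> * (Re \<eta> * V1x \<eta> + Im \<eta> * V2x \<eta>) + Im \<eta> * (Re \<eta> * V1y \<eta> + Im \<eta> * V2y \<eta>)) * Im \<eta>
      = - (\<sigma> * x * klein_operator Fxx Fxy Fyy \<eta>
        - \<sigma>\<^sup>2 * (klein_operator Fxxx Fxxy Fxyy \<eta> - 2 * (x * Fxx \<eta> + y * Fxy \<eta>)))"
      unfolding defs \<sigma> by algebra
    ultimately show "tension_field hyp_metric (bundle_metric hyp_metric) (bundle_section W) \<eta> = 0"
      by (intro trans[OF tension_field_bundle_section[OF TV1 TV2 _ \<eta>]] W')
         (simp_all only: eqs x_def y_def, simp add: zero_prod_def complex_eq_iff)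
  qed
  moreover have "lagrangian_vector_field W"
  proof (rule lagrangian_vector_fieldI[OF _ _ W'])
    show "has_partials_on disk V1 V1x V1y" "has_partials_on disk V2 V2x V2y"
      using TV1 TV2 by (auto simp: twice_differentiable_on_def)
    fix \<eta> :: complex assume \<eta>: "\<eta> \<in> disk"
    have "V1x \<eta> + V2y \<eta> = 3 * (Re \<eta> * Fy \<eta> - Im \<eta> * Fx \<eta>)"
      by (simp add: V1x_def V2y_def algebra_simps)
    moreover have "klein_factor \<eta> * (Re \<eta> * V1 \<eta> + Im \<eta> * V2 \<eta>)
        = (klein_factor \<eta> * (1 - \<eta> \<bullet> \<eta>)) * (Im \<eta> * Fx \<eta> - Re \<eta> * Fy \<eta>)"
      unfolding V1_def V2_def by (simp add: algebra_simps)
    ultimately show "V1x \<eta> + V2y \<eta> + 3 * klein_factor \<eta> * (Re \<eta> * V1 \<eta> + Im \<eta> * V2 \<eta>) = 0"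
      unfolding klein_factor_mult[OF \<eta>] by (simp add: mult.assoc)
  qed
  ultimately show ?thesis unfolding harmonic_lagrangian_def by blast
qed

section \<open>Boundary behaviour\<close>

text \<open>
  The frame \<open>(1, \<eta>)\<close>, \<open>(\<rho>, \<omega>)\<close>, \<open>(0, s \<i> \<omega>)\<close>, with \<open>\<eta> = \<rho> \<omega>\<close> and \<open>s = sqrt (1 - \<rho>\<^sup>2)\<close>, moves the origin to \<open>\<eta>\<close>.
  For the transformed solution \<open>G\<close>, the partial derivatives at the origin are \<open>\<rho> F + s\<^sup>2 R\<close> and \<open>s T\<close>, where
  \<open>R\<close> and \<open>T\<close> are the radial and tangential derivatives of \<open>F\<close> at \<open>\<eta>\<close>. On the disk of radius \<open>1/2\<close> the
  factor \<open>D\<close> lies between \<open>1/2\<close> and \<open>3/2\<close>, which gives \<open>|G| \<le> 3/2 M\<close> and points \<open>Z\<close> at distance at most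
  \<open>2 s\<close> from \<open>\<eta>\<close>; the constant is \<open>25 = (12 + 1) + 12\<close> with \<open>12 = 8 * 3/2\<close>.
\<close>
lemma gradient_estimate:
  assumes sol: "klein_solution F Fx Fy" and M: "M > 0" and \<eta>: "\<eta> \<in> disk" "\<eta> \<noteq> 0"
    and bound: "\<And>\<zeta>. \<zeta> \<in> disk \<Longrightarrow> norm (\<zeta> - \<eta>) \<le> 2 * sqrt (1 - (norm \<eta>)\<^sup>2) \<Longrightarrow> \<bar>F \<zeta>\<bar> \<le> M"
  shows "(1 - (norm \<eta>)\<^sup>2) * norm (Complex (Fx \<eta>) (Fy \<eta>)) \<le> 25 * M"
proof -
  define \<rho> where "\<rho> = norm \<eta>"
  define \<omega> where "\<omega> = \<eta> /\<^sub>R \<rho>"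
  have \<rho>: "0 < \<rho>" "\<rho> < 1" using \<eta> by (auto simp: \<rho>_def)
  then have \<rho>2: "\<rho>\<^sup>2 < 1" by (simp add: abs_square_less_1)
  define s where "s = sqrt (1 - \<rho>\<^sup>2)"
  have s: "0 < s" "s \<le> 1" "s\<^sup>2 = 1 - \<rho>\<^sup>2" using \<rho>2 by (auto simp: s_def)
  have \<omega>: "norm \<omega> = 1" "\<eta> = \<rho> *\<^sub>R \<omega>" using \<rho> by (auto simp: \<omega>_def \<rho>_def)
  then have \<omega>2: "(Re \<omega>)\<^sup>2 + (Im \<omega>)\<^sup>2 = 1" by (simp add: cmod_power2[symmetric])
  define D where "D \<zeta> = 1 + Re \<zeta> * \<rho> + Im \<zeta> * 0" for \<zeta>
  define Z where "Z \<zeta> = (\<rho> *\<^sub>R \<omega> + Re \<zeta> *\<^sub>R \<omega> + Im \<zeta> *\<^sub>R (s *\<^sub>R (\<i> * \<omega>))) /\<^sub>R D \<zeta>" for \<zeta>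
  have D: "D \<zeta> > 0" if "norm \<zeta> < 1" for \<zeta>
  proof -
    have "\<bar>Re \<zeta> * \<rho>\<bar> < 1 * 1"
      unfolding abs_mult using abs_Re_le_cmod[of \<zeta>] that \<rho> by (intro mult_strict_mono) auto
    then show ?thesis unfolding D_def by linarith
  qed
  have Zform: "Z \<zeta> = \<omega> * Complex (\<rho> + Re \<zeta>) (s * Im \<zeta>) /\<^sub>R D \<zeta>" for \<zeta>
    by (simp add: Z_def complex_eq_iff algebra_simps)
  have Z: "Z \<zeta> \<in> disk" if "norm \<zeta> < 1" for \<zeta>
  proof -
    have "(Re \<zeta>)\<^sup>2 + (Im \<zeta>)\<^sup>2 < 1" using that by (simp add: cmod_power2[symmetric] abs_square_less_1)
    then have "0 < s\<^sup>2 * (1 - ((Re \<zeta>)\<^sup>2 + (Im \<zeta>)\<^sup>2))" using s(1) by (intro mult_pos_pos) auto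
    also have "\<dots> = (D \<zeta>)\<^sup>2 - (norm (Complex (\<rho> + Re \<zeta>) (s * Im \<zeta>)))\<^sup>2"
      unfolding D_def cmod_power2 complex.sel power_mult_distrib s(3) by (simp add: algebra_simps power2_eq_square)
    finally have "norm (Complex (\<rho> + Re \<zeta>) (s * Im \<zeta>)) < D \<zeta>"
      using D[OF that] by (simp add: power2_less_imp_less)
    then show ?thesis using D[OF that] by (simp add: Zform norm_mult \<omega> divide_simps)
  qed
  define G where "G \<zeta> = D \<zeta> * F (Z \<zeta>)" for \<zeta>
  have sol': "klein_solution G
      (\<lambda>\<zeta>. \<rho> * F (Z \<zeta>) + Fx (Z \<zeta>) * (Re \<omega> - \<rho> * Re (Z \<zeta>)) + Fy (Z \<zeta>) * (Im \<omega> - \<rho> * Im (Z \<zeta>)))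
      (\<lambda>\<zeta>. 0 * F (Z \<zeta>) + Fx (Z \<zeta>) * (Re (s *\<^sub>R (\<i> * \<omega>)) - 0 * Re (Z \<zeta>)) + Fy (Z \<zeta>) * (Im (s *\<^sub>R (\<i> * \<omega>)) - 0 * Im (Z \<zeta>)))"
    unfolding G_def
  proof (rule klein_solution_lorentz[OF sol D_def Z_def, where \<kappa> = "1 - \<rho>\<^sup>2"])
    show "D \<zeta> > 0" "Z \<zeta> \<in> disk" if "\<zeta> \<in> disk" for \<zeta> using D Z that by auto
    show "(Re \<omega>)\<^sup>2 + (Re (s *\<^sub>R (\<i> * \<omega>)))\<^sup>2 - (Re (\<rho> *\<^sub>R \<omega>))\<^sup>2 = 1 - \<rho>\<^sup>2"
      "(Im \<omega>)\<^sup>2 + (Im (s *\<^sub>R (\<i> * \<omega>)))\<^sup>2 - (Im (\<rho> *\<^sub>R \<omega>))\<^sup>2 = 1 - \<rho>\<^sup>2"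
      "Re \<omega> * Im \<omega> + Re (s *\<^sub>R (\<i> * \<omega>)) * Im (s *\<^sub>R (\<i> * \<omega>)) = Re (\<rho> *\<^sub>R \<omega>) * Im (\<rho> *\<^sub>R \<omega>)"
      using s(3) \<omega>2 by (simp_all) algebra+
  qed auto
  have Gb: "\<bar>G \<zeta>\<bar> \<le> 3/2 * M" if \<zeta>: "norm \<zeta> \<le> 1/2" for \<zeta>
  proof -
    have re: "\<bar>Re \<zeta>\<bar> \<le> 1/2" "\<bar>Im \<zeta>\<bar> \<le> 1/2"
      using abs_Re_le_cmod[of \<zeta>] abs_Im_le_cmod[of \<zeta>] \<zeta> by auto
    have "\<bar>Re \<zeta> * \<rho>\<bar> \<le> 1/2 * 1" unfolding abs_mult using re \<rho> by (intro mult_mono) auto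
    then have Db: "1/2 \<le> D \<zeta>" "D \<zeta> \<le> 3/2" unfolding D_def by linarith+
    have "D \<zeta> *\<^sub>R Z \<zeta> = \<omega> * Complex (\<rho> + Re \<zeta>) (s * Im \<zeta>)" using Db unfolding Zform by simp
    then have "D \<zeta> *\<^sub>R (Z \<zeta> - \<eta>) = \<omega> * Complex (\<rho> + Re \<zeta>) (s * Im \<zeta>) - D \<zeta> *\<^sub>R (\<rho> *\<^sub>R \<omega>)"
      by (simp only: scaleR_diff_right \<omega>(2))
    also have "\<dots> = \<omega> * Complex (s\<^sup>2 * Re \<zeta>) (s * Im \<zeta>)"
      unfolding s(3) D_def by (simp add: complex_eq_iff algebra_simps power2_eq_square)
    finally have "norm (D \<zeta> *\<^sub>R (Z \<zeta> - \<eta>)) = norm (Complex (s\<^sup>2 * Re \<zeta>) (s * Im \<zeta>))"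
      by (simp only: norm_mult \<omega>(1) mult_1)
    have "norm (Complex (s\<^sup>2 * Re \<zeta>) (s * Im \<zeta>)) \<le> \<bar>s\<^sup>2 * Re \<zeta>\<bar> + \<bar>s * Im \<zeta>\<bar>"
      using cmod_le by (metis complex.sel)
    also have "\<dots> \<le> s * (1/2) + s * (1/2)"
    proof (intro add_mono)
      show "\<bar>s * Im \<zeta>\<bar> \<le> s * (1/2)" unfolding abs_mult using s(1,2) re by (intro mult_mono) auto
      have "s\<^sup>2 \<le> s" using s(1,2) by (simp add: power2_eq_square mult_left_le)
      then show "\<bar>s\<^sup>2 * Re \<zeta>\<bar> \<le> s * (1/2)" unfolding abs_mult using s(1,2) re by (intro mult_mono) auto
    qed
    finally have 1: "norm (Complex (s\<^sup>2 * Re \<zeta>) (s * Im \<zeta>)) \<le> s" by simp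
    have "1/2 * norm (Z \<zeta> - \<eta>) \<le> D \<zeta> * norm (Z \<zeta> - \<eta>)" using Db by (intro mult_right_mono) auto
    also have "\<dots> \<le> s" using 1 Db \<open>norm (D \<zeta> *\<^sub>R (Z \<zeta> - \<eta>)) = _\<close> by simp
    finally have "norm (Z \<zeta> - \<eta>) \<le> 2 * s" by simp
    then have "\<bar>F (Z \<zeta>)\<bar> \<le> M" using Z[of \<zeta>] \<zeta> by (intro bound) (auto simp: s_def \<rho>_def)
    then have "\<bar>D \<zeta>\<bar> * \<bar>F (Z \<zeta>)\<bar> \<le> 3/2 * M" using Db by (intro mult_mono) auto
    then show ?thesis by (simp add: G_def abs_mult)
  qed
  have Z0: "Z 0 = \<eta>" by (simp add: Z_def D_def \<omega>(2))
  define R T where "R = Fx \<eta> * Re \<omega> + Fy \<eta> * Im \<omega>" and "T = Fy \<eta> * Re \<omega> - Fx \<eta> * Im \<omega>"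
  have est: "\<bar>\<rho> * F \<eta> + s\<^sup>2 * R\<bar> \<le> 12 * M" "\<bar>s * T\<bar> \<le> 12 * M"
    using gradient_estimate_origin[OF sol' _ Gb] M unfolding Z0 s(3) R_def T_def
    by (simp_all add: \<omega>(2) algebra_simps power2_eq_square)
  have "\<bar>\<rho> * F \<eta>\<bar> \<le> 1 * M"
    unfolding abs_mult using bound[OF \<eta>(1)] \<rho> s by (intro mult_mono) (auto simp: s_def \<rho>_def)
  then have 1: "s\<^sup>2 * \<bar>R\<bar> \<le> 13 * M" using est(1) by (simp add: abs_mult[symmetric, of "s\<^sup>2", simplified])
  have "s\<^sup>2 * \<bar>T\<bar> = s * \<bar>s * T\<bar>" using s by (simp add: abs_mult power2_eq_square)
  also have "\<dots> \<le> 1 * \<bar>s * T\<bar>" using s by (intro mult_right_mono) auto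
  finally have 2: "s\<^sup>2 * \<bar>T\<bar> \<le> 12 * M" using est(2) by simp
  have "Complex (Fx \<eta>) (Fy \<eta>) = of_real R * \<omega> + of_real T * (\<i> * \<omega>)"
    using \<omega>2 by (simp add: complex_eq_iff R_def T_def) algebra
  then have "norm (Complex (Fx \<eta>) (Fy \<eta>)) \<le> \<bar>R\<bar> + \<bar>T\<bar>"
    using norm_triangle_ineq[of "of_real R * \<omega>" "of_real T * (\<i> * \<omega>)"] by (simp add: norm_mult \<omega>)
  then have "s\<^sup>2 * norm (Complex (Fx \<eta>) (Fy \<eta>)) \<le> s\<^sup>2 * (\<bar>R\<bar> + \<bar>T\<bar>)" by (intro mult_left_mono) auto
  then show ?thesis using 1 2 by (simp add: distrib_left s(3) \<rho>_def)
qed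

text \<open>
  Near \<open>z\<close> the solution \<open>F - F0 z\<close> is small, and the neighbourhood of \<open>\<eta>\<close> on which \<open>gradient_estimate\<close> requires
  a bound shrinks to \<open>z\<close> together with \<open>\<eta>\<close>.
\<close>
lemma gradient_vanishes_at_boundary:
  assumes sol: "klein_solution F Fx Fy" and F0: "continuous_on (cball 0 1) F0"
    and F: "\<And>\<eta>. \<eta> \<in> disk \<Longrightarrow> F0 \<eta> = F \<eta>" and z: "z \<in> circle"
    and \<eta>: "\<And>n::nat. \<eta> n \<in> disk" "\<eta> \<longlonglongrightarrow> z"
  shows "(\<lambda>n. of_real (1 - \<eta> n \<bullet> \<eta> n) * Complex (Fx (\<eta> n)) (Fy (\<eta> n))) \<longlonglongrightarrow> 0"
proof (rule tendstoI)
  fix e :: real assume e: "e > 0"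
  define M where "M = e / 26"
  have M: "M > 0" using e by (simp add: M_def)
  obtain d where d: "d > 0" "\<And>\<zeta>. \<zeta> \<in> cball 0 1 \<Longrightarrow> dist \<zeta> z < d \<Longrightarrow> dist (F0 \<zeta>) (F0 z) < M"
    using F0 z M unfolding continuous_on_iff by (metis mem_cball mem_sphere order_refl)
  have n: "(\<lambda>n. norm (\<eta> n)) \<longlonglongrightarrow> 1" using tendsto_norm[OF \<eta>(2)] z by simp
  have "(\<lambda>n. norm (\<eta> n - z) + 2 * sqrt (1 - (norm (\<eta> n))\<^sup>2)) \<longlonglongrightarrow> norm (z - z) + 2 * sqrt (1 - 1\<^sup>2)"
    by (intro tendsto_intros \<eta> n)
  then have "\<forall>\<^sub>F n in sequentially. norm (\<eta> n - z) + 2 * sqrt (1 - (norm (\<eta> n))\<^sup>2) < d"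
    using d(1) by (intro order_tendstoD(2)) auto
  moreover have "\<forall>\<^sub>F n in sequentially. norm (\<eta> n) > 0"
    by (rule order_tendstoD(1)[OF n]) simp
  ultimately show "\<forall>\<^sub>F n in sequentially. dist (of_real (1 - \<eta> n \<bullet> \<eta> n) * Complex (Fx (\<eta> n)) (Fy (\<eta> n))) 0 < e"
  proof eventually_elim
    case (elim n)
    have sol': "klein_solution (\<lambda>\<eta>. 1 * F \<eta> + - F0 z * 1) (\<lambda>\<eta>. 1 * Fx \<eta> + - F0 z * 0) (\<lambda>\<eta>. 1 * Fy \<eta> + - F0 z * 0)"
      by (rule klein_solution_lincomb[OF sol klein_solution_const])
    have "\<bar>1 * F \<zeta> + - F0 z * 1\<bar> \<le> M"
      if "\<zeta> \<in> disk" "norm (\<zeta> - \<eta> n) \<le> 2 * sqrt (1 - (norm (\<eta> n))\<^sup>2)" for \<zeta>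
    proof -
      have "dist \<zeta> z < d"
        using norm_triangle_ineq[of "\<zeta> - \<eta> n" "\<eta> n - z"] elim(1) that(2) by (simp add: dist_norm)
      then show ?thesis using d(2)[of \<zeta>] that(1) F[OF that(1)] by (simp add: dist_real_def)
    qed
    from gradient_estimate[OF sol' M \<eta>(1) _ this]
    have "(1 - (norm (\<eta> n))\<^sup>2) * norm (Complex (Fx (\<eta> n)) (Fy (\<eta> n))) \<le> 25 * M"
      using elim(2) by simp
    moreover have "0 \<le> 1 - \<eta> n \<bullet> \<eta> n" using disk_inner[OF \<eta>(1)[of n]] by simp
    ultimately have "norm (of_real (1 - \<eta> n \<bullet> \<eta> n) * Complex (Fx (\<eta> n)) (Fy (\<eta> n))) \<le> 25 * M"
      by (simp add: norm_mult dot_square_norm del: of_real_diff)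
    then show ?case using M by (simp add: M_def)
  qed
qed

theorem proposition5p12:
  fixes X :: "complex \<Rightarrow> complex" and u :: "real^3 \<Rightarrow> real"
  assumes "continuous_circle_field X"
    and "smooth_fun_hyp u"
    and "\<forall>p\<in>hyp. hyp_laplacian u p - 2 * u p = 0"
    and "has_boundary_values u (support_function X)"
  shows "harmonic_lagrangian (\<lambda>p. hyp_J p (hyp_grad u p)) \<and>
         extends_continuously_to (\<lambda>p. hyp_J p (hyp_grad u p)) X"
proof -
  define F where "F = ubar u"
  define W where "W = (\<lambda>p. hyp_J p (hyp_grad u p))"
  have sF: "smooth_on disk F" unfolding F_def by (rule smooth_on_ubar[OF assms(2)])
  have u: "u (klein_inv \<eta>) = height \<eta> * F \<eta>" if "\<eta> \<in> disk" for \<eta>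
    using disk_inner[OF that] by (simp add: F_def ubar_def height_def dot_square_norm)
  note P = smooth_on_has_partials[OF sF]
  note T = smooth_on_twice_differentiable[OF open_ball sF]
  have W: "klein_push W \<eta> = klein_rotated_gradient F (dir_deriv 1 F) (dir_deriv \<i> F) \<eta>" if "\<eta> \<in> disk" for \<eta>
    unfolding W_def by (rule klein_push_rotated_gradient[OF P u that])
  have eq: "klein_operator (dir_deriv 1 (dir_deriv 1 F)) (dir_deriv \<i> (dir_deriv 1 F)) (dir_deriv \<i> (dir_deriv \<i> F)) \<eta> = 0"
    if \<eta>: "\<eta> \<in> disk" for \<eta>
  proof -
    have d: "twice_differentiable_on disk (u \<circ> klein_inv) a b c d e"
      if "twice_differentiable_on disk (\<lambda>\<eta>. height \<eta> * F \<eta>) a b c d e" for a b c d e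
      using that unfolding twice_differentiable_on_def
      by (auto intro: has_partials_on_cong[OF open_ball, where f = "\<lambda>\<eta>. height \<eta> * F \<eta>"] simp: u)
    have "laplacian hyp_metric (u \<circ> klein_inv) \<eta> = laplacian hyp_metric (\<lambda>\<eta>. height \<eta> * F \<eta>) \<eta>"
      unfolding laplacian_hyp_metric[OF height_mult_twice_differentiable[OF T] \<eta>]
        laplacian_hyp_metric[OF d[OF height_mult_twice_differentiable[OF T]] \<eta>] ..
    moreover have "klein_inv \<eta> \<in> hyp" "klein (klein_inv \<eta>) = \<eta>"
      using \<eta> by (auto simp: klein_inv_in_hyp klein_klein_inv)
    ultimately have "laplacian hyp_metric (\<lambda>\<eta>. height \<eta> * F \<eta>) \<eta> - 2 * (height \<eta> * F \<eta>) = 0"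
      using assms(3) u[OF \<eta>] unfolding hyp_laplacian_def by metis
    then show ?thesis
      unfolding laplacian_height_mult[OF T \<eta>] using height_pos[OF \<eta>] disk_inner[OF \<eta>] by simp
  qed
  have "harmonic_lagrangian W"
  proof (rule rotated_gradient_harmonic_lagrangian[OF sF W _ eq])
    show "W p \<in> tangent_hyp p" for p
      by (simp add: W_def hyp_J_def tangent_hyp_def mcross_eq mink_def algebra_simps)
  qed
  moreover have "extends_continuously_to W X"
    unfolding extends_continuously_to_def
  proof (intro allI impI)
    fix \<eta> z assume \<eta>: "\<forall>n::nat. \<eta> n \<in> disk" "\<eta> \<longlonglongrightarrow> z" and z: "z \<in> circle"
    obtain F0 where F0: "continuous_on (cball 0 1) F0" "\<And>\<eta>. \<eta> \<in> disk \<Longrightarrow> F0 \<eta> = F \<eta>" "F0 z = support_function X z"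
      using assms(4) z unfolding has_boundary_values_def F_def by blast
    have sol: "klein_solution F (dir_deriv 1 F) (dir_deriv \<i> F)"
      unfolding klein_solution_def using T eq by blast
    have "(\<lambda>n. F0 (\<eta> n)) \<longlonglongrightarrow> F0 z"
      using continuous_on_tendsto_compose[OF F0(1) \<eta>(2)] z \<eta>(1) by (simp add: less_imp_le)
    then have "(\<lambda>n. F (\<eta> n)) \<longlonglongrightarrow> F0 z" using F0(2) \<eta>(1) by simp
    then have "(\<lambda>n. klein_rotated_gradient F (dir_deriv 1 F) (dir_deriv \<i> F) (\<eta> n)) \<longlonglongrightarrow> \<i> * (of_real (F0 z) * z + 0)"
      unfolding klein_rotated_gradient_def
      using \<eta> by (intro tendsto_intros gradient_vanishes_at_boundary[OF sol F0(1,2) z]) auto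
    also have "\<i> * (of_real (F0 z) * z + 0) = X z"
      using support_function[OF assms(1) z] F0(3) by (simp add: mult_ac)
    finally show "(\<lambda>n. klein_push W (\<eta> n)) \<longlonglongrightarrow> X z" using \<eta>(1) by (simp add: W)
  qed
  ultimately show ?thesis unfolding W_def by blast
qed

end
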